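(* Let $V$ be a complex vector space of dimension $2$, and let $d\ge 2$ and $t\ge 2$ be integers. Then, in the representation ring of $SL(V)=SL_2(\mathbb{C})$, $$S^t(S^d)=S^{td}+S^2(S^{d-2})\cdot S^{t-2}(S^d)-S^1\cdot S^3(S^{d-3})\cdot S^{t-3}(S^d)+S^2\cdot S^4(S^{d-4})\cdot S^{t-4}(S^d)-\cdots+(-1)^{d-1}S^{d-3}\cdot S^{d-1}(S^1)\cdot S^{t-d+1}(S^d)+(-1)^dS^{d-2}\cdot S^d(S^0)\cdot S^{t-d}(S^d),$$ that is, $$S^t(S^d)=S^{td}+\sum_{m=2}^{d}(-1)^m\,S^{m-2}\cdot S^m(S^{d-m})\cdot S^{t-m}(S^d).$$
   Context: $S^m$ denotes the $m$-th symmetric power $S^m(V)$, $S^r(S^s)$ denotes $S^r(S^s(V))$, the product $\cdot$ denotes the tensor product of representations, and $+$, $-$ denote sum and difference in the representation (Grothendieck) ring. By convention $S^\ell(\ldots)=0$ for $\ell<0$. *)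

theory Defs
  imports "HOL-Analysis.Analysis" "HOL-Library.Poly_Mapping"
begin

definition SL2 :: "(complex^2^2) set" where
  "SL2 = {g. det g = 1}"

text \<open>The coordinate ring of \<open>SL\<^sub>2(\<complex>)\<close>; by \<open>cong\<close>, the values of a function outside \<open>SL2\<close> are irrelevant.\<close>

inductive sl2_regular :: "(complex^2^2 \<Rightarrow> complex) \<Rightarrow> bool" where
  const: "sl2_regular (\<lambda>g. c)"
| entry: "sl2_regular (\<lambda>g. g $ i $ j)"
| add: "sl2_regular f \<Longrightarrow> sl2_regular h \<Longrightarrow> sl2_regular (\<lambda>g. f g + h g)"
| mult: "sl2_regular f \<Longrightarrow> sl2_regular h \<Longrightarrow> sl2_regular (\<lambda>g. f g * h g)"
| cong: "sl2_regular f \<Longrightarrow> (\<And>g. g \<in> SL2 \<Longrightarrow> f g = h g) \<Longrightarrow> sl2_regular h"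

text \<open>
  Matrices are functions of a row and a column index; only the values at indices in the
  relevant finite index sets matter.  The product sums over the inner index set \<open>K\<close>.
\<close>

definition mmul :: "'k set \<Rightarrow> ('i \<Rightarrow> 'k \<Rightarrow> complex) \<Rightarrow> ('k \<Rightarrow> 'j \<Rightarrow> complex) \<Rightarrow> 'i \<Rightarrow> 'j \<Rightarrow> complex" where
  "mmul K A B = (\<lambda>i j. \<Sum>k\<in>K. A i k * B k j)"

definition mone :: "'i \<Rightarrow> 'i \<Rightarrow> complex" where
  "mone = (\<lambda>i j. if i = j then 1 else 0)"

definition meq :: "'i set \<Rightarrow> 'j set \<Rightarrow> ('i \<Rightarrow> 'j \<Rightarrow> complex) \<Rightarrow> ('i \<Rightarrow> 'j \<Rightarrow> complex) \<Rightarrow> bool" where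
  "meq I J A B \<longleftrightarrow> (\<forall>i\<in>I. \<forall>j\<in>J. A i j = B i j)"

text \<open>
  A finite-dimensional rational representation, on the vector space with basis \<open>I\<close>:
  \<open>\<rho> g\<close> is the matrix of \<open>g\<close>, with \<open>g \<cdot> e\<^sub>j = (\<Sum>i\<in>I. \<rho> g i j e\<^sub>i)\<close>.
\<close>

definition is_sl2_rep :: "'i set \<Rightarrow> (complex^2^2 \<Rightarrow> 'i \<Rightarrow> 'i \<Rightarrow> complex) \<Rightarrow> bool" where
  "is_sl2_rep I \<rho> \<longleftrightarrow> finite I \<and>
     (\<forall>i\<in>I. \<forall>j\<in>I. sl2_regular (\<lambda>g. \<rho> g i j)) \<and>
     meq I I (\<rho> (mat 1)) mone \<and>
     (\<forall>g\<in>SL2. \<forall>h\<in>SL2. meq I I (\<rho> (g ** h)) (mmul I (\<rho> g) (\<rho> h)))"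

typedef 'i sl2_rep = "{(I :: 'i set, \<rho>). is_sl2_rep I \<rho>}"
  by (rule exI[of _ "({}, \<lambda>_ _ _. 0)"]) (simp add: is_sl2_rep_def meq_def)

setup_lifting type_definition_sl2_rep

lift_definition rep_basis :: "'i sl2_rep \<Rightarrow> 'i set" is fst .
lift_definition rep_act :: "'i sl2_rep \<Rightarrow> complex^2^2 \<Rightarrow> 'i \<Rightarrow> 'i \<Rightarrow> complex" is snd .

lemma is_sl2_rep_rep: "is_sl2_rep (rep_basis R) (rep_act R)"
  by transfer auto

lemma finite_rep_basis [simp]: "finite (rep_basis R)"
  using is_sl2_rep_rep[of R] by (simp add: is_sl2_rep_def)

lemma rep_act_regular:
  "i \<in> rep_basis R \<Longrightarrow> j \<in> rep_basis R \<Longrightarrow> sl2_regular (\<lambda>g. rep_act R g i j)"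
  using is_sl2_rep_rep[of R] by (simp add: is_sl2_rep_def)

lemma rep_act_one:
  "i \<in> rep_basis R \<Longrightarrow> j \<in> rep_basis R \<Longrightarrow> rep_act R (mat 1) i j = (if i = j then 1 else 0)"
  using is_sl2_rep_rep[of R] by (simp add: is_sl2_rep_def meq_def mone_def)

lemma rep_act_mult:
  "g \<in> SL2 \<Longrightarrow> h \<in> SL2 \<Longrightarrow> i \<in> rep_basis R \<Longrightarrow> j \<in> rep_basis R \<Longrightarrow>
   rep_act R (g ** h) i j = (\<Sum>k\<in>rep_basis R. rep_act R g i k * rep_act R h k j)"
  using is_sl2_rep_rep[of R] by (simp add: is_sl2_rep_def meq_def mmul_def)

definition rep_iso :: "'i sl2_rep \<Rightarrow> 'j sl2_rep \<Rightarrow> bool" where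
  "rep_iso R S \<longleftrightarrow> (\<exists>P Q.
     meq (rep_basis R) (rep_basis R) (mmul (rep_basis S) Q P) mone \<and>
     meq (rep_basis S) (rep_basis S) (mmul (rep_basis R) P Q) mone \<and>
     (\<forall>g\<in>SL2. meq (rep_basis S) (rep_basis R)
        (mmul (rep_basis R) P (rep_act R g)) (mmul (rep_basis S) (rep_act S g) P)))"


lift_definition std_rep :: "2 sl2_rep" is "(UNIV, \<lambda>g i j. g $ i $ j)"
  by (simp add: is_sl2_rep_def meq_def mmul_def mone_def matrix_matrix_mult_def mat_def
      sl2_regular.entry)

lift_definition zero_rep :: "unit sl2_rep" is "({}, \<lambda>g i j. 0)"
  by (simp add: is_sl2_rep_def meq_def)

lift_definition triv_rep :: "unit sl2_rep" is "(UNIV, \<lambda>g i j. 1)"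
  by (simp add: is_sl2_rep_def meq_def mmul_def mone_def sl2_regular.const)

lemma sl2_regular_sum:
  "(\<And>x. x \<in> X \<Longrightarrow> sl2_regular (f x)) \<Longrightarrow> sl2_regular (\<lambda>g. \<Sum>x\<in>X. f x g)"
  by (induction X rule: infinite_finite_induct) (auto intro: sl2_regular.intros)

lemma mone_sum:
  "mone (Inl i) (Inl i') = mone i i'" "mone (Inr j) (Inr j') = mone j j'"
  "mone (Inl i) (Inr j) = 0" "mone (Inr j) (Inl i) = 0"
  by (simp_all add: mone_def)

lemma mone_prod: "mone (i, j) (i', j') = mone i i' * mone j j'"
  by (simp add: mone_def)

lift_definition dsum_rep :: "'i sl2_rep \<Rightarrow> 'j sl2_rep \<Rightarrow> ('i + 'j) sl2_rep" is
  "\<lambda>(I, \<rho>) (J, \<sigma>). (I <+> J, \<lambda>g a b.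
     case (a, b) of (Inl i, Inl i') \<Rightarrow> \<rho> g i i' | (Inr j, Inr j') \<Rightarrow> \<sigma> g j j' | _ \<Rightarrow> 0)"
  by (auto simp: is_sl2_rep_def meq_def mmul_def mone_sum sum.Plus sl2_regular.const)

lift_definition tensor_rep :: "'i sl2_rep \<Rightarrow> 'j sl2_rep \<Rightarrow> ('i \<times> 'j) sl2_rep" is
  "\<lambda>(I, \<rho>) (J, \<sigma>). (I \<times> J, \<lambda>g (i, j) (i', j'). \<rho> g i i' * \<sigma> g j j')"
proof (clarsimp, goal_cases)
  case (1 I \<rho> J \<sigma>)
  then show ?case
    by (auto simp: is_sl2_rep_def meq_def mmul_def mone_prod sum_product sum.cartesian_product
        case_prod_unfold mult_ac intro: sl2_regular.mult)
qed

text \<open>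
  The symmetric algebra on the vector space with basis \<open>I\<close> is the polynomial ring in the
  variables \<open>I\<close>, i.e.\ the monoid algebra \<open>'i multiset \<Rightarrow>\<^sub>0 complex\<close> restricted to monomials
  (multisets) over \<open>I\<close>.  A matrix \<open>M\<close> acts on it by the algebra endomorphism sending the
  variable \<open>i\<close> to the linear form \<open>lin_form I M i\<close>.  The \<open>l\<close>-th symmetric power is the span of
  the monomials of degree \<open>l\<close>; \<open>sym_mat I M \<beta> \<alpha>\<close> is the coefficient of the monomial \<open>\<beta>\<close> in the
  image of the monomial \<open>\<alpha>\<close>.  For \<open>l < 0\<close> there are no monomials, hence \<open>sym_rep l R\<close> is the
  zero representation.
\<close>

definition lin_form :: "'i set \<Rightarrow> ('i \<Rightarrow> 'i \<Rightarrow> complex) \<Rightarrow> 'i \<Rightarrow> 'i multiset \<Rightarrow>\<^sub>0 complex" where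
  "lin_form I M i = (\<Sum>j\<in>I. Poly_Mapping.single {#j#} (M j i))"

definition sym_mat ::
  "'i set \<Rightarrow> ('i \<Rightarrow> 'i \<Rightarrow> complex) \<Rightarrow> 'i multiset \<Rightarrow> 'i multiset \<Rightarrow> complex" where
  "sym_mat I M \<beta> \<alpha> = Poly_Mapping.lookup (\<Prod>i\<in>#\<alpha>. lin_form I M i) \<beta>"

definition monomials :: "int \<Rightarrow> 'i set \<Rightarrow> 'i multiset set" where
  "monomials l I = {\<alpha>. set_mset \<alpha> \<subseteq> I \<and> int (size \<alpha>) = l}"

lemma finite_monomials: assumes "finite I" shows "finite (monomials l I)"
proof (rule finite_subset)
  show "monomials l I \<subseteq> mset ` {xs. set xs \<subseteq> I \<and> length xs = nat l}"
  proof
    fix \<alpha> assume a: "\<alpha> \<in> monomials l I"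
    obtain xs where xs: "mset xs = \<alpha>" using ex_mset by blast
    have "set xs \<subseteq> I \<and> length xs = nat l"
      using a unfolding monomials_def xs[symmetric] by auto
    with xs show "\<alpha> \<in> mset ` {xs. set xs \<subseteq> I \<and> length xs = nat l}" by blast
  qed
  show "finite (mset ` {xs. set xs \<subseteq> I \<and> length xs = nat l})"
    using assms by (intro finite_imageI finite_lists_length_eq)
qed

lemma lookup_single_mult_mset:
  fixes q :: "'i multiset \<Rightarrow>\<^sub>0 complex"
  shows "Poly_Mapping.lookup (Poly_Mapping.single {#j#} c * q) \<beta> =
    (if j \<in># \<beta> then c * Poly_Mapping.lookup q (\<beta> - {#j#}) else 0)"
proof -
  have "Poly_Mapping.lookup (Poly_Mapping.single {#j#} c * q) \<beta> =
      c * (\<Sum>\<gamma>. Poly_Mapping.lookup q \<gamma> when \<beta> = {#j#} + \<gamma>)"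
    by (simp add: lookup_mult lookup_single when_mult del: add_mset_add_single)
  also have "\<dots> = (if j \<in># \<beta> then c * Poly_Mapping.lookup q (\<beta> - {#j#}) else 0)"
  proof (cases "j \<in># \<beta>")
    case True
    then have "\<beta> = {#j#} + \<gamma> \<longleftrightarrow> \<gamma> = \<beta> - {#j#}" for \<gamma> by auto
    then show ?thesis using True by simp
  next
    case False
    then have "\<beta> \<noteq> {#j#} + \<gamma>" for \<gamma> by auto
    then show ?thesis using False by simp
  qed
  finally show ?thesis .
qed

lemma sym_mat_empty: "sym_mat I M \<beta> {#} = (if \<beta> = {#} then 1 else 0)"
  by (auto simp: sym_mat_def lookup_one when_def)

lemma sym_mat_add_mset:
  "sym_mat I M \<beta> (add_mset a \<alpha>) =
    (\<Sum>j\<in>I. if j \<in># \<beta> then M j a * sym_mat I M (\<beta> - {#j#}) \<alpha> else 0)"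
  by (simp add: sym_mat_def lin_form_def sum_distrib_right lookup_sum lookup_single_mult_mset
      cong: if_cong)

lemma sym_mat_regular:
  assumes "finite I" "\<And>i j. i \<in> I \<Longrightarrow> j \<in> I \<Longrightarrow> sl2_regular (\<lambda>g. \<rho> g i j)" "set_mset \<alpha> \<subseteq> I"
  shows "sl2_regular (\<lambda>g. sym_mat I (\<rho> g) \<beta> \<alpha>)"
  using assms(3)
proof (induction \<alpha> arbitrary: \<beta>)
  case empty
  show ?case by (simp add: sym_mat_empty sl2_regular.const)
next
  case (add a \<alpha>)
  have "sl2_regular (\<lambda>g. if j \<in># \<beta> then \<rho> g j a * sym_mat I (\<rho> g) (\<beta> - {#j#}) \<alpha> else 0)"
    if "j \<in> I" for j
    using that add assms(2) by (cases "j \<in># \<beta>") (auto intro: sl2_regular.intros)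
  then show ?case unfolding sym_mat_add_mset by (rule sl2_regular_sum)
qed

lemma sym_mat_cong:
  assumes "meq I I M N" "set_mset \<alpha> \<subseteq> I"
  shows "sym_mat I M \<beta> \<alpha> = sym_mat I N \<beta> \<alpha>"
proof -
  have "lin_form I M i = lin_form I N i" if "i \<in># \<alpha>" for i
    using assms that by (auto simp: lin_form_def meq_def subset_iff intro!: sum.cong)
  then have "image_mset (lin_form I M) \<alpha> = image_mset (lin_form I N) \<alpha>"
    by (rule image_mset_cong)
  then show ?thesis by (simp add: sym_mat_def)
qed

lemma sym_mat_one:
  assumes "finite I" "set_mset \<alpha> \<subseteq> I"
  shows "sym_mat I mone \<beta> \<alpha> = (if \<beta> = \<alpha> then 1 else 0)"
  using assms(2)
proof (induction \<alpha> arbitrary: \<beta>)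
  case empty
  show ?case by (simp add: sym_mat_empty)
next
  case (add a \<alpha>)
  have "sym_mat I mone \<beta> (add_mset a \<alpha>) =
      (\<Sum>j\<in>I. if j = a then (if a \<in># \<beta> \<and> \<beta> - {#a#} = \<alpha> then 1 else 0) else 0)"
    unfolding sym_mat_add_mset using add by (intro sum.cong) (auto simp: mone_def)
  also have "\<dots> = (if a \<in># \<beta> \<and> \<beta> - {#a#} = \<alpha> then 1 else 0)"
    using add.prems assms(1) by simp
  also have "a \<in># \<beta> \<and> \<beta> - {#a#} = \<alpha> \<longleftrightarrow> \<beta> = add_mset a \<alpha>"
    by auto
  finally show ?case .
qed

lemma sum_monomials_shift:
  fixes F :: "'i multiset \<Rightarrow> 'i multiset \<Rightarrow> complex"
  assumes "finite I" "k \<in> I"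
  shows "(\<Sum>\<gamma>\<in>monomials (l + 1) I. if k \<in># \<gamma> then F (\<gamma> - {#k#}) \<gamma> else 0) =
         (\<Sum>\<gamma>\<in>monomials l I. F \<gamma> (add_mset k \<gamma>))"
proof -
  have "(\<Sum>\<gamma>\<in>monomials (l + 1) I. if k \<in># \<gamma> then F (\<gamma> - {#k#}) \<gamma> else 0) =
      (\<Sum>\<gamma>\<in>{\<gamma>\<in>monomials (l + 1) I. k \<in># \<gamma>}. F (\<gamma> - {#k#}) \<gamma>)"
    using finite_monomials[OF assms(1)] by (simp add: sum.inter_filter)
  also have "\<dots> = (\<Sum>\<gamma>\<in>monomials l I. F \<gamma> (add_mset k \<gamma>))"
  proof (rule sum.reindex_bij_witness[of _ "add_mset k" "\<lambda>\<gamma>. \<gamma> - {#k#}"])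
    fix \<gamma> assume g: "\<gamma> \<in> {\<gamma> \<in> monomials (l + 1) I. k \<in># \<gamma>}"
    then obtain \<delta> where "\<gamma> = add_mset k \<delta>" by (auto dest: multi_member_split)
    with g show "\<gamma> - {#k#} \<in> monomials l I" by (auto simp: monomials_def)
  qed (use assms(2) in \<open>auto simp: monomials_def\<close>)
  finally show ?thesis .
qed

lemma sym_mat_mult:
  assumes "finite I" "set_mset \<alpha> \<subseteq> I"
  shows "sym_mat I (mmul I M N) \<beta> \<alpha> =
    (\<Sum>\<gamma>\<in>monomials (int (size \<alpha>)) I. sym_mat I M \<beta> \<gamma> * sym_mat I N \<gamma> \<alpha>)"
  using assms(2)
proof (induction \<alpha> arbitrary: \<beta>)
  case empty
  have "monomials 0 I = {{#}}" by (auto simp: monomials_def)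
  then show ?case by (simp add: sym_mat_empty)
next
  case (add a \<alpha>)
  let ?B = "monomials (int (size \<alpha>)) I"
  have IH: "sym_mat I (mmul I M N) \<beta> \<alpha> = (\<Sum>\<gamma>\<in>?B. sym_mat I M \<beta> \<gamma> * sym_mat I N \<gamma> \<alpha>)" for \<beta>
    using add by auto
  have "(\<Sum>\<gamma>\<in>monomials (int (size (add_mset a \<alpha>))) I.
           sym_mat I M \<beta> \<gamma> * sym_mat I N \<gamma> (add_mset a \<alpha>)) =
      (\<Sum>\<gamma>\<in>monomials (int (size \<alpha>) + 1) I. \<Sum>k\<in>I.
           if k \<in># \<gamma> then N k a * sym_mat I N (\<gamma> - {#k#}) \<alpha> * sym_mat I M \<beta> \<gamma> else 0)"
    unfolding sym_mat_add_mset sum_distrib_left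
    by (intro sum.cong) (auto simp: add.commute)
  also have "\<dots> = (\<Sum>k\<in>I. \<Sum>\<gamma>\<in>?B. N k a * sym_mat I N \<gamma> \<alpha> * sym_mat I M \<beta> (add_mset k \<gamma>))"
    by (subst sum.swap, rule sum.cong[OF refl])
      (rule sum_monomials_shift[OF assms(1),
          where F = "\<lambda>\<gamma> \<gamma>'. N _ a * sym_mat I N \<gamma> \<alpha> * sym_mat I M \<beta> \<gamma>'"])
  also have "\<dots> = (\<Sum>k\<in>I. \<Sum>\<gamma>\<in>?B. \<Sum>j\<in>I. if j \<in># \<beta> then
       M j k * N k a * (sym_mat I M (\<beta> - {#j#}) \<gamma> * sym_mat I N \<gamma> \<alpha>) else 0)"
    unfolding sym_mat_add_mset sum_distrib_left by (intro sum.cong) auto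
  also have "\<dots> = (\<Sum>k\<in>I. \<Sum>j\<in>I. \<Sum>\<gamma>\<in>?B. if j \<in># \<beta> then
       M j k * N k a * (sym_mat I M (\<beta> - {#j#}) \<gamma> * sym_mat I N \<gamma> \<alpha>) else 0)"
    by (intro sum.cong refl sum.swap)
  also have "\<dots> = (\<Sum>j\<in>I. \<Sum>k\<in>I. \<Sum>\<gamma>\<in>?B. if j \<in># \<beta> then
       M j k * N k a * (sym_mat I M (\<beta> - {#j#}) \<gamma> * sym_mat I N \<gamma> \<alpha>) else 0)"
    by (rule sum.swap)
  also have "\<dots> = sym_mat I (mmul I M N) \<beta> (add_mset a \<alpha>)"
    unfolding sym_mat_add_mset IH unfolding mmul_def
    by (intro sum.cong refl, simp add: sum_distrib_left sum_distrib_right, intro impI sum.swap)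
  finally show ?case ..
qed

lift_definition sym_rep :: "int \<Rightarrow> 'i sl2_rep \<Rightarrow> 'i multiset sl2_rep" is
  "\<lambda>l (I, \<rho>). (monomials l I, \<lambda>g. sym_mat I (\<rho> g))"
proof (clarsimp, goal_cases)
  case (1 l I \<rho>)
  then have fin: "finite I" by (simp add: is_sl2_rep_def)
  show ?case
    unfolding is_sl2_rep_def
  proof (intro conjI ballI)
    show "finite (monomials l I)" by (rule finite_monomials[OF fin])
    show "sl2_regular (\<lambda>g. sym_mat I (\<rho> g) \<beta> \<alpha>)" if "\<alpha> \<in> monomials l I" for \<alpha> \<beta>
      using 1 that fin by (intro sym_mat_regular) (auto simp: is_sl2_rep_def monomials_def)
    show "meq (monomials l I) (monomials l I) (sym_mat I (\<rho> (mat 1))) mone"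
      unfolding meq_def
    proof (intro ballI)
      fix \<beta> \<alpha> assume "\<beta> \<in> monomials l I" "\<alpha> \<in> monomials l I"
      then have s: "set_mset \<alpha> \<subseteq> I" by (simp add: monomials_def)
      have "sym_mat I (\<rho> (mat 1)) \<beta> \<alpha> = sym_mat I mone \<beta> \<alpha>"
        using 1 s by (intro sym_mat_cong) (auto simp: is_sl2_rep_def)
      then show "sym_mat I (\<rho> (mat 1)) \<beta> \<alpha> = mone \<beta> \<alpha>"
        using sym_mat_one[OF fin s] by (simp add: mone_def)
    qed
    fix g h assume gh: "g \<in> SL2" "h \<in> SL2"
    show "meq (monomials l I) (monomials l I) (sym_mat I (\<rho> (g ** h)))
            (mmul (monomials l I) (sym_mat I (\<rho> g)) (sym_mat I (\<rho> h)))"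
      unfolding meq_def
    proof (intro ballI)
      fix \<beta> \<alpha> assume "\<beta> \<in> monomials l I" "\<alpha> \<in> monomials l I"
      then have s: "set_mset \<alpha> \<subseteq> I" and l: "l = int (size \<alpha>)" by (simp_all add: monomials_def)
      have "sym_mat I (\<rho> (g ** h)) \<beta> \<alpha> = sym_mat I (mmul I (\<rho> g) (\<rho> h)) \<beta> \<alpha>"
        using 1 s gh by (intro sym_mat_cong) (auto simp: is_sl2_rep_def)
      then show "sym_mat I (\<rho> (g ** h)) \<beta> \<alpha> =
          mmul (monomials l I) (sym_mat I (\<rho> g)) (sym_mat I (\<rho> h)) \<beta> \<alpha>"
        using sym_mat_mult[OF fin s] l by (simp add: mmul_def)
    qed
  qed
qed


lemma mmul_assoc: "mmul K (mmul L A B) C = mmul L A (mmul K B C)"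
proof (intro ext)
  fix i j
  have "mmul K (mmul L A B) C i j = (\<Sum>k\<in>K. \<Sum>l\<in>L. A i l * B l k * C k j)"
    by (simp add: mmul_def sum_distrib_right)
  also have "\<dots> = (\<Sum>l\<in>L. \<Sum>k\<in>K. A i l * B l k * C k j)" by (rule sum.swap)
  also have "\<dots> = mmul L A (mmul K B C) i j"
    by (simp add: mmul_def sum_distrib_left mult.assoc)
  finally show "mmul K (mmul L A B) C i j = mmul L A (mmul K B C) i j" .
qed

lemma meq_refl: "meq I J A A" by (simp add: meq_def)

lemma meq_sym: "meq I J A B \<Longrightarrow> meq I J B A" by (simp add: meq_def)

lemma meq_trans [trans]: "meq I J A B \<Longrightarrow> meq I J B C \<Longrightarrow> meq I J A C" by (simp add: meq_def)

lemma meq_mmul: "meq I K A A' \<Longrightarrow> meq K J B B' \<Longrightarrow> meq I J (mmul K A B) (mmul K A' B')"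
  by (auto simp: meq_def mmul_def intro!: sum.cong)

lemma meq_mone_left: "finite I \<Longrightarrow> meq I J (mmul I mone A) A"
  by (auto simp: meq_def mmul_def mone_def if_distrib[where f = "\<lambda>x. x * _"] cong: if_cong)

lemma meq_mone_right: "finite J \<Longrightarrow> meq I J (mmul J A mone) A"
  by (auto simp: meq_def mmul_def mone_def if_distrib[where f = "\<lambda>x. _ * x"] cong: if_cong)

lemma rep_iso_reindex:
  assumes f: "bij_betw f (rep_basis R) (rep_basis S)"
    and act: "\<And>g i j. g \<in> SL2 \<Longrightarrow> i \<in> rep_basis R \<Longrightarrow> j \<in> rep_basis R \<Longrightarrow>
      rep_act S g (f i) (f j) = rep_act R g i j"
  shows "rep_iso R S"
proof -
  have inj: "inj_on f (rep_basis R)" and im: "rep_basis S = f ` rep_basis R"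
    using f by (auto simp: bij_betw_def)
  have eq: "f i = f j \<longleftrightarrow> i = j" if "i \<in> rep_basis R" "j \<in> rep_basis R" for i j
    using inj that by (auto dest: inj_onD)
  have red: "sum h (rep_basis S) = (\<Sum>i\<in>rep_basis R. h (f i))" for h :: "_ \<Rightarrow> complex"
    unfolding im using inj by (simp add: sum.reindex)
  define P :: "'b \<Rightarrow> 'a \<Rightarrow> complex" where "P = (\<lambda>s i. if s = f i then 1 else 0)"
  define Q :: "'a \<Rightarrow> 'b \<Rightarrow> complex" where "Q = (\<lambda>i s. if s = f i then 1 else 0)"
  have P: "P (f i) j = (if i = j then 1 else 0)" and Q: "Q i (f j) = (if i = j then 1 else 0)"
    if "i \<in> rep_basis R" "j \<in> rep_basis R" for i j
    using eq[OF that] eq[OF that(2,1)] by (auto simp: P_def Q_def)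
  have R1: "(\<Sum>k\<in>rep_basis R. h k * P (f k) j) = h j" 
    and R2: "(\<Sum>k\<in>rep_basis R. P (f j) k * h k) = h j"
    and R3: "(\<Sum>k\<in>rep_basis R. Q j (f k) * h k) = h j"
    if "j \<in> rep_basis R" for h :: "'a \<Rightarrow> complex" and j
    using that by (simp_all add: P Q if_distrib[where f = "\<lambda>x. x * _"]
        if_distrib[where f = "\<lambda>x. _ * x"] cong: if_cong)
  show ?thesis
    unfolding rep_iso_def
  proof (intro exI[of _ P] exI[of _ Q] conjI ballI)
    show "meq (rep_basis R) (rep_basis R) (mmul (rep_basis S) Q P) mone"
      by (simp add: meq_def mmul_def red R3 mone_def P)
    show "meq (rep_basis S) (rep_basis S) (mmul (rep_basis R) P Q) mone"
      by (auto simp add: meq_def mmul_def im R2 mone_def Q eq)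
    show "meq (rep_basis S) (rep_basis R) (mmul (rep_basis R) P (rep_act R g))
        (mmul (rep_basis S) (rep_act S g) P)" if g: "g \<in> SL2" for g
    proof -
      have "(\<Sum>k\<in>rep_basis R. rep_act S g (f i) (f k) * P (f k) j) = rep_act R g i j"
        if "i \<in> rep_basis R" "j \<in> rep_basis R" for i j
        using R1[OF that(2), of "\<lambda>k. rep_act S g (f i) (f k)"] act[OF g that] by simp
      then have "\<forall>i\<in>rep_basis R. \<forall>j\<in>rep_basis R. mmul (rep_basis R) P (rep_act R g) (f i) j =
          mmul (rep_basis S) (rep_act S g) P (f i) j"
        unfolding mmul_def red by (simp add: R2)
      then show ?thesis unfolding meq_def im by blast
    qed
  qed
qed

lemma rep_iso_refl: "rep_iso R R"
  by (rule rep_iso_reindex[of id]) auto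

lemma rep_iso_sym: assumes "rep_iso R S" shows "rep_iso S R"
proof -
  let ?I = "rep_basis R" and ?J = "rep_basis S"
  obtain P Q where QP: "meq ?I ?I (mmul ?J Q P) mone" and PQ: "meq ?J ?J (mmul ?I P Q) mone"
    and tw: "\<And>g. g \<in> SL2 \<Longrightarrow> meq ?J ?I (mmul ?I P (rep_act R g)) (mmul ?J (rep_act S g) P)"
    using assms unfolding rep_iso_def by blast
  have "meq ?I ?J (mmul ?J Q (rep_act S g)) (mmul ?I (rep_act R g) Q)" if g: "g \<in> SL2" for g
  proof -
    have "meq ?I ?J (mmul ?J Q (rep_act S g)) (mmul ?J Q (mmul ?J (rep_act S g) (mmul ?I P Q)))"
    proof -
      have "meq ?J ?J (rep_act S g) (mmul ?J (rep_act S g) (mmul ?I P Q))"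
        by (rule meq_trans[OF meq_sym[OF meq_mone_right[OF finite_rep_basis]]
              meq_mmul[OF meq_refl meq_sym[OF PQ]]])
      then show ?thesis by (rule meq_mmul[OF meq_refl])
    qed
    also have "meq ?I ?J \<dots> (mmul ?J Q (mmul ?I (mmul ?J (rep_act S g) P) Q))"
      by (simp add: mmul_assoc meq_refl)
    also have "meq ?I ?J \<dots> (mmul ?J Q (mmul ?I (mmul ?I P (rep_act R g)) Q))"
      by (rule meq_mmul[OF meq_refl meq_mmul[OF meq_sym[OF tw[OF g]] meq_refl]])
    also have "meq ?I ?J \<dots> (mmul ?I (mmul ?J Q P) (mmul ?I (rep_act R g) Q))"
      by (simp add: mmul_assoc meq_refl)
    also have "meq ?I ?J \<dots> (mmul ?I mone (mmul ?I (rep_act R g) Q))"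
      by (rule meq_mmul[OF QP meq_refl])
    also have "meq ?I ?J \<dots> (mmul ?I (rep_act R g) Q)"
      by (rule meq_mone_left[OF finite_rep_basis])
    finally show ?thesis .
  qed
  then show ?thesis unfolding rep_iso_def using QP PQ by blast
qed

lemma rep_iso_trans: assumes "rep_iso R S" "rep_iso S T" shows "rep_iso R T"
proof -
  let ?I = "rep_basis R" and ?J = "rep_basis S" and ?K = "rep_basis T"
  obtain P Q where QP: "meq ?I ?I (mmul ?J Q P) mone" and PQ: "meq ?J ?J (mmul ?I P Q) mone"
    and tw: "\<And>g. g \<in> SL2 \<Longrightarrow> meq ?J ?I (mmul ?I P (rep_act R g)) (mmul ?J (rep_act S g) P)"
    using assms(1) unfolding rep_iso_def by blast
  obtain P' Q' where QP': "meq ?J ?J (mmul ?K Q' P') mone" and PQ': "meq ?K ?K (mmul ?J P' Q') mone"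
    and tw': "\<And>g. g \<in> SL2 \<Longrightarrow> meq ?K ?J (mmul ?J P' (rep_act S g)) (mmul ?K (rep_act T g) P')"
    using assms(2) unfolding rep_iso_def by blast
  show ?thesis
    unfolding rep_iso_def
  proof (intro exI[of _ "mmul ?J P' P"] exI[of _ "mmul ?J Q Q'"] conjI ballI)
    have "meq ?I ?I (mmul ?K (mmul ?J Q Q') (mmul ?J P' P)) (mmul ?J Q (mmul ?J (mmul ?K Q' P') P))"
      by (simp add: mmul_assoc meq_refl)
    also have "meq ?I ?I \<dots> (mmul ?J Q (mmul ?J mone P))"
      by (intro meq_mmul meq_refl QP')
    also have "meq ?I ?I \<dots> (mmul ?J Q P)"
      by (intro meq_mmul meq_refl meq_mone_left finite_rep_basis)
    also note QP
    finally show "meq ?I ?I (mmul ?K (mmul ?J Q Q') (mmul ?J P' P)) mone" .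
    have "meq ?K ?K (mmul ?I (mmul ?J P' P) (mmul ?J Q Q')) (mmul ?J P' (mmul ?J (mmul ?I P Q) Q'))"
      by (simp add: mmul_assoc meq_refl)
    also have "meq ?K ?K \<dots> (mmul ?J P' (mmul ?J mone Q'))"
      by (intro meq_mmul meq_refl PQ)
    also have "meq ?K ?K \<dots> (mmul ?J P' Q')"
      by (intro meq_mmul meq_refl meq_mone_left finite_rep_basis)
    also note PQ'
    finally show "meq ?K ?K (mmul ?I (mmul ?J P' P) (mmul ?J Q Q')) mone" .
    fix g assume g: "g \<in> SL2"
    have "meq ?K ?I (mmul ?I (mmul ?J P' P) (rep_act R g)) (mmul ?J P' (mmul ?I P (rep_act R g)))"
      by (simp add: mmul_assoc meq_refl)
    also have "meq ?K ?I \<dots> (mmul ?J P' (mmul ?J (rep_act S g) P))"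
      by (intro meq_mmul meq_refl tw[OF g])
    also have "meq ?K ?I \<dots> (mmul ?J (mmul ?J P' (rep_act S g)) P)"
      by (simp add: mmul_assoc meq_refl)
    also have "meq ?K ?I \<dots> (mmul ?J (mmul ?K (rep_act T g) P') P)"
      by (intro meq_mmul meq_refl tw'[OF g])
    also have "meq ?K ?I \<dots> (mmul ?K (rep_act T g) (mmul ?J P' P))"
      by (simp add: mmul_assoc meq_refl)
    finally show "meq ?K ?I (mmul ?I (mmul ?J P' P) (rep_act R g))
        (mmul ?K (rep_act T g) (mmul ?J P' P))" .
  qed
qed

lemma rep_iso_card: assumes "rep_iso R S" shows "card (rep_basis R) = card (rep_basis S)"
proof -
  let ?I = "rep_basis R" and ?J = "rep_basis S"
  obtain P Q where QP: "meq ?I ?I (mmul ?J Q P) mone" and PQ: "meq ?J ?J (mmul ?I P Q) mone"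
    using assms unfolding rep_iso_def by blast
  have "of_nat (card ?I) = (\<Sum>i\<in>?I. mmul ?J Q P i i)"
    using QP by (simp add: meq_def mone_def)
  also have "\<dots> = (\<Sum>j\<in>?J. mmul ?I P Q j j)"
    unfolding mmul_def by (subst sum.swap) (simp add: mult.commute)
  also have "\<dots> = (of_nat (card ?J) :: complex)"
    using PQ by (simp add: meq_def mone_def)
  finally show ?thesis by simp
qed

lemma rep_basis_zero [simp]: "rep_basis zero_rep = {}" by transfer simp
lemma rep_basis_triv [simp]: "rep_basis triv_rep = UNIV" by transfer simp
lemma rep_act_triv [simp]: "rep_act triv_rep g i j = 1" by transfer simp
lemma rep_basis_std [simp]: "rep_basis std_rep = UNIV" by transfer simp
lemma rep_act_std [simp]: "rep_act std_rep g i j = g $ i $ j" by transfer simp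

lemma rep_basis_sym [simp]: "rep_basis (sym_rep l R) = monomials l (rep_basis R)"
  by transfer auto

lemma rep_act_sym [simp]: "rep_act (sym_rep l R) g = sym_mat (rep_basis R) (rep_act R g)"
  by transfer auto

lemma rep_basis_dsum [simp]: "rep_basis (dsum_rep R S) = rep_basis R <+> rep_basis S"
  by transfer auto

lemma rep_act_dsum [simp]:
  "rep_act (dsum_rep R S) g (Inl i) (Inl i') = rep_act R g i i'"
  "rep_act (dsum_rep R S) g (Inr j) (Inr j') = rep_act S g j j'"
  "rep_act (dsum_rep R S) g (Inl i) (Inr j) = 0"
  "rep_act (dsum_rep R S) g (Inr j) (Inl i) = 0"
  by (transfer, auto)+

lemma rep_basis_tensor [simp]: "rep_basis (tensor_rep R S) = rep_basis R \<times> rep_basis S"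
  by transfer auto

lemma rep_act_tensor [simp]:
  "rep_act (tensor_rep R S) g (i, j) (i', j') = rep_act R g i i' * rep_act S g j j'"
  by transfer auto

lemma rep_iso_dsum:
  assumes "rep_iso R R'" "rep_iso S S'"
  shows "rep_iso (dsum_rep R S) (dsum_rep R' S')"
proof -
  obtain P Q where *: "meq (rep_basis R) (rep_basis R) (mmul (rep_basis R') Q P) mone"
      "meq (rep_basis R') (rep_basis R') (mmul (rep_basis R) P Q) mone"
      "\<And>g. g \<in> SL2 \<Longrightarrow> meq (rep_basis R') (rep_basis R)
        (mmul (rep_basis R) P (rep_act R g)) (mmul (rep_basis R') (rep_act R' g) P)"
    using assms(1) unfolding rep_iso_def by blast
  obtain P' Q' where **: "meq (rep_basis S) (rep_basis S) (mmul (rep_basis S') Q' P') mone"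
      "meq (rep_basis S') (rep_basis S') (mmul (rep_basis S) P' Q') mone"
      "\<And>g. g \<in> SL2 \<Longrightarrow> meq (rep_basis S') (rep_basis S)
        (mmul (rep_basis S) P' (rep_act S g)) (mmul (rep_basis S') (rep_act S' g) P')"
    using assms(2) unfolding rep_iso_def by blast
  define PP where "PP = (\<lambda>a b. case (a, b) of (Inl i, Inl i') \<Rightarrow> P i i' | (Inr j, Inr j') \<Rightarrow> P' j j' | _ \<Rightarrow> 0)"
  define QQ where "QQ = (\<lambda>a b. case (a, b) of (Inl i, Inl i') \<Rightarrow> Q i i' | (Inr j, Inr j') \<Rightarrow> Q' j j' | _ \<Rightarrow> 0)"
  show ?thesis
    unfolding rep_iso_def
  proof (intro exI[of _ PP] exI[of _ QQ] conjI ballI)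
    fix g assume g: "g \<in> SL2"
    show "meq (rep_basis (dsum_rep R' S')) (rep_basis (dsum_rep R S))
        (mmul (rep_basis (dsum_rep R S)) PP (rep_act (dsum_rep R S) g))
        (mmul (rep_basis (dsum_rep R' S')) (rep_act (dsum_rep R' S') g) PP)"
      using *(3)[OF g] **(3)[OF g] by (auto simp: meq_def mmul_def sum.Plus PP_def)
  qed (use *(1,2) **(1,2) in \<open>auto simp: meq_def mmul_def mone_sum sum.Plus PP_def QQ_def\<close>)
qed

lemma mmul_kronecker:
  "mmul (K \<times> L) (\<lambda>(i, j) (k, l). A i k * B j l) (\<lambda>(k, l) (i', j'). C k i' * D l j') (i, j) (i', j') =
   mmul K A C i i' * mmul L B D j j'"
  by (simp add: mmul_def sum_product sum.cartesian_product case_prod_unfold mult_ac)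

lemma rep_iso_tensor:
  assumes "rep_iso R R'" "rep_iso S S'"
  shows "rep_iso (tensor_rep R S) (tensor_rep R' S')"
proof -
  obtain P Q where *: "meq (rep_basis R) (rep_basis R) (mmul (rep_basis R') Q P) mone"
      "meq (rep_basis R') (rep_basis R') (mmul (rep_basis R) P Q) mone"
      "\<And>g. g \<in> SL2 \<Longrightarrow> meq (rep_basis R') (rep_basis R)
        (mmul (rep_basis R) P (rep_act R g)) (mmul (rep_basis R') (rep_act R' g) P)"
    using assms(1) unfolding rep_iso_def by blast
  obtain P' Q' where **: "meq (rep_basis S) (rep_basis S) (mmul (rep_basis S') Q' P') mone"
      "meq (rep_basis S') (rep_basis S') (mmul (rep_basis S) P' Q') mone"
      "\<And>g. g \<in> SL2 \<Longrightarrow> meq (rep_basis S') (rep_basis S)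
        (mmul (rep_basis S) P' (rep_act S g)) (mmul (rep_basis S') (rep_act S' g) P')"
    using assms(2) unfolding rep_iso_def by blast
  have act: "rep_act (tensor_rep T U) g = (\<lambda>(i, j) (i', j'). rep_act T g i i' * rep_act U g j j')"
    for T :: "'x sl2_rep" and U :: "'y sl2_rep" and g
    by (auto simp: fun_eq_iff)
  show ?thesis
    unfolding rep_iso_def
  proof (intro exI[of _ "\<lambda>(i, j) (k, l). P i k * P' j l"]
      exI[of _ "\<lambda>(i, j) (k, l). Q i k * Q' j l"] conjI ballI)
    fix g assume g: "g \<in> SL2"
    show "meq (rep_basis (tensor_rep R' S')) (rep_basis (tensor_rep R S))
        (mmul (rep_basis (tensor_rep R S)) (\<lambda>(i, j) (k, l). P i k * P' j l)
          (rep_act (tensor_rep R S) g))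
        (mmul (rep_basis (tensor_rep R' S')) (rep_act (tensor_rep R' S') g)
          (\<lambda>(i, j) (k, l). P i k * P' j l))"
      using *(3)[OF g] **(3)[OF g] by (auto simp: meq_def act mmul_kronecker)
  qed (use *(1,2) **(1,2) in \<open>auto simp: meq_def mmul_kronecker mone_prod\<close>)
qed

lemma ex_nat_rep: "\<exists>N :: nat sl2_rep. rep_iso R N"
proof -
  let ?I = "rep_basis R"
  obtain f where f: "bij_betw f {..<card ?I} ?I"
    using ex_bij_betw_nat_finite[OF finite_rep_basis[of R]] by (auto simp: atLeast0LessThan)
  define h where "h = the_inv_into {..<card ?I} f"
  have h: "bij_betw h ?I {..<card ?I}"
    unfolding h_def by (rule bij_betw_the_inv_into[OF f])
  have fh: "f (h i) = i" if "i \<in> ?I" for i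
    using f that unfolding h_def by (simp add: f_the_inv_into_f_bij_betw)
  have fI: "f n \<in> ?I" if "n < card ?I" for n
    using f that by (auto simp: bij_betw_def)
  have inj: "f n = f m \<longleftrightarrow> n = m" if "n < card ?I" "m < card ?I" for n m
    using f that by (auto simp: bij_betw_def dest: inj_onD)
  define N where "N = Abs_sl2_rep ({..<card ?I}, \<lambda>g n m. rep_act R g (f n) (f m))"
  have "is_sl2_rep {..<card ?I} (\<lambda>g n m. rep_act R g (f n) (f m))"
  proof -
    have "rep_act R (g ** h) (f n) (f m) =
        (\<Sum>k<card ?I. rep_act R g (f n) (f k) * rep_act R h (f k) (f m))"
      if "g \<in> SL2" "h \<in> SL2" "n < card ?I" "m < card ?I" for g h n m
      unfolding rep_act_mult[OF that(1,2) fI[OF that(3)] fI[OF that(4)]]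
      by (rule sum.reindex_bij_betw[OF f, symmetric])
    then show ?thesis
      by (simp add: is_sl2_rep_def meq_def mmul_def mone_def rep_act_regular rep_act_one fI inj)
  qed
  then have "Rep_sl2_rep N = ({..<card ?I}, \<lambda>g n m. rep_act R g (f n) (f m))"
    unfolding N_def by (intro Abs_sl2_rep_inverse) simp
  then have N: "rep_basis N = {..<card ?I}" "rep_act N g n m = rep_act R g (f n) (f m)" for g n m
    by (simp_all add: rep_basis.rep_eq rep_act.rep_eq)
  have "rep_iso R N"
    using h by (intro rep_iso_reindex[of h]) (simp_all add: N fh)
  then show ?thesis by (rule exI)
qed

definition nat_rep :: "'i sl2_rep \<Rightarrow> nat sl2_rep" where
  "nat_rep R = (SOME N. rep_iso R N)"

lemma rep_iso_nat_rep: "rep_iso R (nat_rep R)"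
  unfolding nat_rep_def by (rule someI_ex) (rule ex_nat_rep)

lemma rep_iso_nat_rep_cong: "rep_iso R S \<Longrightarrow> rep_iso (nat_rep R) (nat_rep S)"
  by (rule rep_iso_trans[OF rep_iso_sym[OF rep_iso_nat_rep] rep_iso_trans[OF _ rep_iso_nat_rep]])


quotient_type rep_class = "nat sl2_rep" / rep_iso
  by (intro equivpI reflpI sympI transpI) (fact rep_iso_refl rep_iso_sym rep_iso_trans)+

definition class_of :: "'i sl2_rep \<Rightarrow> rep_class" where
  "class_of R = abs_rep_class (nat_rep R)"

lemma class_of_eq_iff: "class_of R = class_of S \<longleftrightarrow> rep_iso R S"
proof -
  have "class_of R = class_of S \<longleftrightarrow> rep_iso (nat_rep R) (nat_rep S)"
    unfolding class_of_def by (simp add: rep_class.abs_eq_iff)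
  also have "\<dots> \<longleftrightarrow> rep_iso R S"
  proof
    assume "rep_iso (nat_rep R) (nat_rep S)"
    then show "rep_iso R S"
      by (rule rep_iso_trans[OF rep_iso_nat_rep rep_iso_trans[OF _ rep_iso_sym[OF rep_iso_nat_rep]]])
  qed (rule rep_iso_nat_rep_cong)
  finally show ?thesis .
qed

lemma abs_rep_class_eq_class_of: "abs_rep_class N = class_of N"
  unfolding class_of_def rep_class.abs_eq_iff by (rule rep_iso_nat_rep)

lemma class_of_nat_rep: "class_of (nat_rep R) = class_of R"
  unfolding class_of_eq_iff by (rule rep_iso_sym[OF rep_iso_nat_rep])

lemma rep_class_cases: obtains R :: "nat sl2_rep" where "a = class_of R"
proof -
  have "\<exists>R :: nat sl2_rep. a = class_of R"
    by (induct a rule: rep_class.abs_induct) (auto simp: abs_rep_class_eq_class_of)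
  then show ?thesis using that by blast
qed

instantiation rep_class :: comm_semiring_1
begin

definition zero_rep_class :: rep_class where "0 = class_of zero_rep"
definition one_rep_class :: rep_class where "1 = class_of triv_rep"

lift_definition plus_rep_class :: "rep_class \<Rightarrow> rep_class \<Rightarrow> rep_class" is
  "\<lambda>R S. nat_rep (dsum_rep R S)"
  by (intro rep_iso_nat_rep_cong rep_iso_dsum)

lift_definition times_rep_class :: "rep_class \<Rightarrow> rep_class \<Rightarrow> rep_class" is
  "\<lambda>R S. nat_rep (tensor_rep R S)"
  by (intro rep_iso_nat_rep_cong rep_iso_tensor)

lemma class_of_dsum: "class_of (dsum_rep R S) = class_of R + class_of S"
proof -
  have "class_of R + class_of S = class_of (dsum_rep (nat_rep R) (nat_rep S))"
    unfolding class_of_def[of R] class_of_def[of S] plus_rep_class.abs_eq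
    by (simp add: abs_rep_class_eq_class_of class_of_nat_rep)
  then show ?thesis by (simp add: class_of_eq_iff rep_iso_dsum rep_iso_nat_rep)
qed

lemma class_of_tensor: "class_of (tensor_rep R S) = class_of R * class_of S"
proof -
  have "class_of R * class_of S = class_of (tensor_rep (nat_rep R) (nat_rep S))"
    unfolding class_of_def[of R] class_of_def[of S] times_rep_class.abs_eq
    by (simp add: abs_rep_class_eq_class_of class_of_nat_rep)
  then show ?thesis by (simp add: class_of_eq_iff rep_iso_tensor rep_iso_nat_rep)
qed

instance
proof
  fix a b c :: rep_class
  obtain A B C :: "nat sl2_rep" where abc: "a = class_of A" "b = class_of B" "c = class_of C"
    by (meson rep_class_cases)
  note defs = abc zero_rep_class_def one_rep_class_def
    class_of_dsum[symmetric] class_of_tensor[symmetric] class_of_eq_iff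
  show "a + b + c = a + (b + c)"
    unfolding defs
    by (rule rep_iso_reindex[of "\<lambda>x. case x of Inl (Inl i) \<Rightarrow> Inl i | Inl (Inr j) \<Rightarrow> Inr (Inl j) | Inr k \<Rightarrow> Inr (Inr k)"])
      (auto intro!: bij_betw_byWitness[where f' = "\<lambda>x. case x of Inl i \<Rightarrow> Inl (Inl i) | Inr (Inl j) \<Rightarrow> Inl (Inr j) | Inr (Inr k) \<Rightarrow> Inr k"])
  show "a + b = b + a"
    unfolding defs
    by (rule rep_iso_reindex[of "\<lambda>x. case x of Inl i \<Rightarrow> Inr i | Inr j \<Rightarrow> Inl j"])
      (auto intro!: bij_betw_byWitness[where f' = "\<lambda>x. case x of Inl i \<Rightarrow> Inr i | Inr j \<Rightarrow> Inl j"])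
  show "0 + a = a"
    unfolding defs
    by (rule rep_iso_reindex[of "\<lambda>x. case x of Inr j \<Rightarrow> j | Inl _ \<Rightarrow> undefined"])
      (auto intro!: bij_betw_byWitness[where f' = Inr])
  show "a * b * c = a * (b * c)"
    unfolding defs
    by (rule rep_iso_reindex[of "\<lambda>((i, j), k). (i, (j, k))"])
      (auto simp: mult.assoc intro!: bij_betw_byWitness[where f' = "\<lambda>(i, (j, k)). ((i, j), k)"])
  show "a * b = b * a"
    unfolding defs
    by (rule rep_iso_reindex[of "\<lambda>(i, j). (j, i)"])
      (auto intro!: bij_betw_byWitness[where f' = "\<lambda>(i, j). (j, i)"])
  show "1 * a = a"
    unfolding defs
    by (rule rep_iso_reindex[of snd]) (auto intro!: bij_betw_byWitness[where f' = "Pair ()"])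
  show "(a + b) * c = a * c + b * c"
    unfolding defs
    by (rule rep_iso_reindex[of "\<lambda>(x, k). case x of Inl i \<Rightarrow> Inl (i, k) | Inr j \<Rightarrow> Inr (j, k)"])
      (auto intro!: bij_betw_byWitness[where f' = "\<lambda>x. case x of Inl (i, k) \<Rightarrow> (Inl i, k) | Inr (j, k) \<Rightarrow> (Inr j, k)"])
  show "0 * a = 0"
    unfolding defs
    by (rule rep_iso_reindex[of "\<lambda>_. ()"]) (auto simp: bij_betw_def)
  show "a * 0 = 0"
    unfolding defs
    by (rule rep_iso_reindex[of "\<lambda>_. ()"]) (auto simp: bij_betw_def)
  show "(0 :: rep_class) \<noteq> 1"
    unfolding defs by (auto dest: rep_iso_card)
qed

end

lift_definition class_dim :: "rep_class \<Rightarrow> nat" is "\<lambda>R. card (rep_basis R)"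
  by (rule rep_iso_card)

lemma class_dim_class_of: "class_dim (class_of R) = card (rep_basis R)"
  unfolding class_of_def class_dim.abs_eq by (rule rep_iso_card[OF rep_iso_sym[OF rep_iso_nat_rep]])

lemma class_dim_0: "class_dim 0 = 0" and class_dim_1: "class_dim 1 = 1"
  by (simp_all add: zero_rep_class_def one_rep_class_def class_dim_class_of)

lemma class_dim_add: "class_dim (a + b) = class_dim a + class_dim b"
proof -
  obtain A B :: "nat sl2_rep" where "a = class_of A" "b = class_of B"
    by (meson rep_class_cases)
  then show ?thesis
    by (simp add: class_of_dsum[symmetric] class_dim_class_of card_Plus)
qed


text \<open>
  The group completion of the semiring of isomorphism classes: \<open>(a, b)\<close> stands for the
  virtual representation \<open>a - b\<close>.  Since rational representations of \<open>SL\<^sub>2(\<complex>)\<close> are completely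
  reducible, imposing \<open>[B] = [A] + [C]\<close> for direct sums only or for all short exact sequences
  gives the same ring.
\<close>

definition virtual_eq :: "rep_class \<times> rep_class \<Rightarrow> rep_class \<times> rep_class \<Rightarrow> bool" where
  "virtual_eq = (\<lambda>(a, b) (c, d). \<exists>e. a + d + e = c + b + e)"

lemma virtual_eqI: "a + d = c + b \<Longrightarrow> virtual_eq (a, b) (c, d)"
  by (simp add: virtual_eq_def)

quotient_type rep_ring = "rep_class \<times> rep_class" / virtual_eq
proof (intro equivpI reflpI sympI transpI)
  show "virtual_eq x x" for x by (auto simp: virtual_eq_def)
  show "virtual_eq y x" if "virtual_eq x y" for x y
    using that unfolding virtual_eq_def case_prod_unfold by (elim exE) (rule exI, rule sym)
  show "virtual_eq x z" if xy: "virtual_eq x y" and yz: "virtual_eq y z" for x y z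
  proof -
    obtain a b c d u v where xyz: "x = (a, b)" "y = (c, d)" "z = (u, v)"
      by (metis surj_pair)
    obtain e f where e: "a + d + e = c + b + e" and f: "c + v + f = u + d + f"
      using xy yz by (auto simp: virtual_eq_def xyz)
    have "a + v + (d + c + e + f) = (a + d + e) + (c + v + f)" by (simp add: ac_simps)
    also have "\<dots> = u + b + (d + c + e + f)" unfolding e f by (simp add: ac_simps)
    finally show ?thesis by (auto simp: virtual_eq_def xyz)
  qed
qed

instantiation rep_ring :: comm_ring_1
begin

lift_definition zero_rep_ring :: rep_ring is "(0, 0)" .
lift_definition one_rep_ring :: rep_ring is "(1, 0)" .

lift_definition plus_rep_ring :: "rep_ring \<Rightarrow> rep_ring \<Rightarrow> rep_ring" is
  "\<lambda>(a, b) (c, d). (a + c, b + d)"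
proof (clarsimp simp: virtual_eq_def)
  fix a b c d a' b' c' d' e f :: rep_class
  assume e: "a + b' + e = a' + b + e" and f: "c + d' + f = c' + d + f"
  have "a + c + (b' + d') + (e + f) = (a + b' + e) + (c + d' + f)" by (simp add: ac_simps)
  also have "\<dots> = a' + c' + (b + d) + (e + f)" unfolding e f by (simp add: ac_simps)
  finally show "\<exists>e. a + c + (b' + d') + e = a' + c' + (b + d) + e" by blast
qed

lift_definition uminus_rep_ring :: "rep_ring \<Rightarrow> rep_ring" is "\<lambda>(a, b). (b, a)"
proof (clarsimp simp: virtual_eq_def)
  fix a b c d e :: rep_class assume "a + d + e = c + b + e"
  then have "b + c + e = d + a + e" by (simp add: add.commute)
  then show "\<exists>e. b + c + e = d + a + e" by blast
qed

definition minus_rep_ring :: "rep_ring \<Rightarrow> rep_ring \<Rightarrow> rep_ring" where "x - y = x + (- y)"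
  for x y :: rep_ring

lift_definition times_rep_ring :: "rep_ring \<Rightarrow> rep_ring \<Rightarrow> rep_ring" is
  "\<lambda>(a, b) (c, d). (a * c + b * d, a * d + b * c)"
proof (clarsimp simp: virtual_eq_def)
  fix a b c d a' b' c' d' e f :: rep_class
  assume e: "a + b' + e = a' + b + e" and f: "c + d' + f = c' + d + f"
  have "(a * c + b * d) + (a' * d' + b' * c') + (e * c + e * d + a' * f + b' * f + b' * c + a' * d
        + a' * c + b' * d) =
      (a + b' + e) * c + (a' + b + e) * d + a' * (c + d' + f) + b' * (c' + d + f)"
    by (simp add: algebra_simps)
  also have "\<dots> = (a' + b + e) * c + (a + b' + e) * d + a' * (c' + d + f) + b' * (c + d' + f)"
    unfolding e f ..
  also have "\<dots> = (a' * c' + b' * d') + (a * d + b * c) + (e * c + e * d + a' * f + b' * f + b' * c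
        + a' * d + a' * c + b' * d)"
    by (simp add: algebra_simps)
  finally show "\<exists>e. a * c + b * d + (a' * d' + b' * c') + e = a' * c' + b' * d' + (a * d + b * c) + e"
    by blast
qed

instance
proof
  fix x y z :: rep_ring
  show "x + y + z = x + (y + z)"
    by transfer (auto intro!: virtual_eqI simp: ac_simps)
  show "x + y = y + x"
    by transfer (auto intro!: virtual_eqI simp: ac_simps)
  show "0 + x = x"
    by transfer (auto intro!: virtual_eqI simp: ac_simps)
  show "- x + x = 0"
    by transfer (auto intro!: virtual_eqI simp: ac_simps)
  show "x - y = x + - y" by (rule minus_rep_ring_def)
  show "x * y * z = x * (y * z)"
    by transfer (auto intro!: virtual_eqI simp: algebra_simps)
  show "x * y = y * x"
    by transfer (auto intro!: virtual_eqI simp: algebra_simps)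
  show "1 * x = x"
    by transfer (auto intro!: virtual_eqI simp: algebra_simps)
  show "(x + y) * z = x * z + y * z"
    by transfer (auto intro!: virtual_eqI simp: algebra_simps)
  show "(0 :: rep_ring) \<noteq> 1"
  proof (transfer, clarsimp simp: virtual_eq_def)
    fix e :: rep_class assume "e = 1 + e"
    then have "class_dim e = class_dim (1 + e)" by simp
    then show False by (simp add: class_dim_add class_dim_1)
  qed
qed

end

definition rep_cls :: "'i sl2_rep \<Rightarrow> rep_ring" where
  "rep_cls R = abs_rep_ring (class_of R, 0)"

lemma rep_cls_eq_iff:
  "rep_cls R = rep_cls S \<longleftrightarrow> (\<exists>T :: nat sl2_rep. rep_iso (dsum_rep R T) (dsum_rep S T))"
proof -
  have "rep_cls R = rep_cls S \<longleftrightarrow> (\<exists>e. class_of R + e = class_of S + e)"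
    by (simp add: rep_cls_def rep_ring.abs_eq_iff virtual_eq_def)
  also have "\<dots> \<longleftrightarrow> (\<exists>T :: nat sl2_rep. class_of R + class_of T = class_of S + class_of T)"
  proof
    assume "\<exists>e. class_of R + e = class_of S + e"
    then obtain e where e: "class_of R + e = class_of S + e" ..
    obtain T :: "nat sl2_rep" where "e = class_of T" by (rule rep_class_cases)
    with e show "\<exists>T :: nat sl2_rep. class_of R + class_of T = class_of S + class_of T" by auto
  qed blast
  finally show ?thesis by (simp add: class_of_eq_iff flip: class_of_dsum)
qed

lemma rep_cls_cong: "rep_iso R S \<Longrightarrow> rep_cls R = rep_cls S"
  by (simp add: rep_cls_def class_of_eq_iff[THEN iffD2])

lemma rep_cls_dsum: "rep_cls (dsum_rep R S) = rep_cls R + rep_cls S"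
  by (simp add: rep_cls_def class_of_dsum plus_rep_ring.abs_eq)

lemma rep_cls_tensor: "rep_cls (tensor_rep R S) = rep_cls R * rep_cls S"
  by (simp add: rep_cls_def class_of_tensor times_rep_ring.abs_eq)

lemma rep_cls_zero: "rep_cls zero_rep = 0"
  by (simp add: rep_cls_def zero_rep_ring_def zero_rep_class_def)

lemma rep_cls_triv: "rep_cls triv_rep = 1"
  by (simp add: rep_cls_def one_rep_ring_def one_rep_class_def)

lemma rep_cls_sym_neg: "l < 0 \<Longrightarrow> rep_cls (sym_rep l R) = 0"
  unfolding rep_cls_zero[symmetric]
  by (intro rep_cls_cong rep_iso_reindex[of "\<lambda>_. ()"]) (auto simp: monomials_def bij_betw_def)

end

theory Submission
  imports Defs "HOL-Computational_Algebra.Formal_Power_Series"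
begin

text \<open>
  All representations involved carry a positive definite hermitian form for which the adjoint of \<open>g\<close>
  acts as the conjugate transpose of \<open>g\<close>, and a weight basis.  The image of a highest weight vector
  orthogonal to a maximal orthogonal family of copies of binary forms would generate a further copy,
  so such a representation is a direct sum of \<open>S\<^sup>n\<close>'s and its class is determined by its character.

  For characters, let \<open>E(x) = (\<Prod>j<d. 1 - q\<^bsup>d-1-2j\<^esup> x)\<close> and \<open>H(x) = (\<Prod>j\<le>d. 1 / (1 - q\<^bsup>d-2j\<^esup> x))\<close>.
  By the \<open>q\<close>-binomial theorem \<open>E\<close> is the generating function of the characters of
  \<open>(-1)\<^sup>m S\<^sup>m(S\<^bsup>d-m\<^esup>)\<close>, and \<open>H\<close> is that of \<open>S\<^sup>t(S\<^sup>d)\<close>.  Telescoping gives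
  \<open>E(q x) H(x) = 1 / (1 - q\<^bsup>-d\<^esup> x)\<close> and \<open>E(x / q) H(x) = 1 / (1 - q\<^sup>d x)\<close>; the claim is a linear
  combination of the coefficients of \<open>x\<^sup>t\<close>, where the character of \<open>S\<^bsup>m-2\<^esup>\<close> supplies
  \<open>(q\<^bsup>m-1\<^esup> - q\<^bsup>1-m\<^esup>) / (q - q\<^sup>-\<^sup>1)\<close>, which is \<open>-1\<close> at \<open>m = 0\<close> and \<open>0\<close> at \<open>m = 1\<close>.
\<close>

section \<open>The character identity\<close>

definition lin_prod :: "nat \<Rightarrow> (nat \<Rightarrow> complex) \<Rightarrow> complex fps" where
  "lin_prod n c = (\<Prod>j<n. 1 - fps_const (c j) * fps_X)"

text \<open>These are the eigenvalues of diag(q, 1/q) on \<open>S^n\<close>, from the highest weight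
  at \<open>j = 0\<close> to the lowest at \<open>j = n\<close>.\<close>

definition sym_weight :: "complex \<Rightarrow> nat \<Rightarrow> nat \<Rightarrow> complex" where
  "sym_weight q n j = q powi (int n - 2 * int j)"

text \<open>Generating function of the complete homogeneous symmetric polynomials in these
  \<open>n + 1\<close> weights. For nonzero \<open>q\<close> its coefficients are Gaussian binomials
  in the form symmetric under q -> 1/q.\<close>

definition hsym :: "complex \<Rightarrow> nat \<Rightarrow> complex fps" where
  "hsym q n = inverse (lin_prod (Suc n) (sym_weight q n))"

lemma lin_prod_Suc: "lin_prod (Suc n) c = lin_prod n c * (1 - fps_const (c n) * fps_X)"
  by (simp add: lin_prod_def)

lemma lin_prod_Suc_shift:
  "lin_prod (Suc n) c = (1 - fps_const (c 0) * fps_X) * lin_prod n (\<lambda>j. c (Suc j))"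
  unfolding lin_prod_def by (subst prod.lessThan_Suc_shift) (simp only: o_def)

lemma lin_prod_nth_0: "fps_nth (lin_prod n c) 0 = 1"
  by (induction n) (simp_all add: lin_prod_def)

lemma lin_prod_scale:
  "lin_prod n c oo (fps_const s * fps_X) = lin_prod n (\<lambda>j. s * c j)"
  by (simp add: lin_prod_def fps_compose_prod_distrib fps_compose_sub_distrib
      fps_compose_mult_distrib mult_ac flip: fps_const_mult)

lemma hsym_mult: "hsym q n * lin_prod (Suc n) (sym_weight q n) = 1"
  unfolding hsym_def by (rule inverse_mult_eq_1) (simp add: lin_prod_nth_0)

lemma hsym_nth_0: "fps_nth (hsym q n) 0 = 1"
  unfolding hsym_def by (simp add: lin_prod_nth_0)

lemma sym_weight_Suc:
  assumes "q \<noteq> 0"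
  shows "sym_weight q (Suc n) j = q * sym_weight q n j"
  using assms by (simp add: sym_weight_def power_int_add_1' algebra_simps flip: power_int_add_1')

text \<open>The substitution x -> q x turns the denominator for \<open>n\<close> into all factors of
  the denominator for \<open>n + 1\<close> except the last. Comparing coefficients in
  \<open>?f * hsym q (Suc n) = hsym q n oo ?s\<close> gives this q-Pascal rule.\<close>

lemma hsym_Suc:
  assumes q: "q \<noteq> 0"
  shows "fps_nth (hsym q (Suc n)) (Suc m) =
    q ^ Suc m * fps_nth (hsym q n) (Suc m) + q powi (- int (Suc n)) * fps_nth (hsym q (Suc n)) m"
proof -
  let ?s = "fps_const q * fps_X :: complex fps"
  let ?f = "1 - fps_const (q powi (- int (Suc n))) * fps_X :: complex fps"
  have "lin_prod (Suc (Suc n)) (sym_weight q (Suc n)) = (lin_prod (Suc n) (sym_weight q n) oo ?s) * ?f"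
    unfolding lin_prod_Suc[of "Suc n"] lin_prod_scale
    by (simp add: sym_weight_Suc[OF q, abs_def] sym_weight_def[of q n "Suc n"] sym_weight_Suc[OF q])
      (simp add: sym_weight_def flip: power_int_add_1'[OF disjI1[OF q]])
  then have "(hsym q n oo ?s) * (lin_prod (Suc n) (sym_weight q n) oo ?s) * ?f * hsym q (Suc n) =
      (hsym q n oo ?s) * (hsym q (Suc n) * lin_prod (Suc (Suc n)) (sym_weight q (Suc n)))"
    by (simp add: mult_ac)
  moreover have "(hsym q n oo ?s) * (lin_prod (Suc n) (sym_weight q n) oo ?s) = 1"
    by (subst fps_compose_mult_distrib[symmetric]) (simp_all add: hsym_mult)
  ultimately have "?f * hsym q (Suc n) = hsym q n oo ?s"
    by (simp add: hsym_mult)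
  then have "fps_nth (?f * hsym q (Suc n)) (Suc m) = q ^ Suc m * fps_nth (hsym q n) (Suc m)"
    by (simp add: fps_compose_linear)
  then show ?thesis
    by (simp add: algebra_simps del: power_Suc)
qed

lemma hsym_0: assumes q: "q \<noteq> 0" shows "fps_nth (hsym q 0) m = 1"
proof -
  have "lin_prod (Suc 0) (sym_weight q 0) = 1 - fps_X"
    by (simp add: lin_prod_def sym_weight_def)
  then have "hsym q 0 * (1 - fps_X) = 1" using hsym_mult[of q 0] by simp
  moreover have "(1 - fps_X) * Abs_fps (\<lambda>n. 1) = (1 :: complex fps)"
  proof (rule fps_ext)
    fix n show "fps_nth ((1 - fps_X) * Abs_fps (\<lambda>n. 1)) n = fps_nth (1 :: complex fps) n"
      by (cases n) (simp_all add: algebra_simps)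
  qed
  ultimately have "hsym q 0 = Abs_fps (\<lambda>n. 1)"
    by (metis (no_types, lifting) mult.assoc mult.commute mult_1)
  then show ?thesis by simp
qed

text \<open>The guard matters: for \<open>m > d\<close> the truncated difference
  \<open>d - m\<close> is 0, and there the coefficient of \<open>hsym\<close> would be 1 instead of
  0.\<close>

definition ext_coeff :: "complex \<Rightarrow> nat \<Rightarrow> nat \<Rightarrow> complex" where
  "ext_coeff q d m = (if m \<le> d then (-1) ^ m * fps_nth (hsym q (d - m)) m else 0)"

text \<open>For \<open>m < d\<close> this is \<open>hsym_Suc\<close> at
  \<open>n = d - m - 1\<close>. At \<open>m = d\<close> only the second term survives, with exponent
  0; beyond that both sides vanish.\<close>

lemma ext_coeff_Suc:
  assumes q: "q \<noteq> 0"
  shows "ext_coeff q (Suc d) (Suc m) =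
    q ^ Suc m * ext_coeff q d (Suc m) - q powi (int m - int d) * ext_coeff q d m"
proof (cases "Suc m \<le> d")
  case True
  then obtain n where d: "d = Suc m + n" by (metis le_add_diff_inverse)
  have e: "int m - int d = - int (Suc n)" using d by simp
  show ?thesis
    unfolding ext_coeff_def e using hsym_Suc[OF q, of n m] d
    by (simp add: algebra_simps Suc_diff_le)
next
  case False
  then consider "m = d" | "m > d" by linarith
  then show ?thesis
    by cases (simp_all add: ext_coeff_def hsym_0[OF q])
qed

text \<open>The \<open>q\<close>-binomial theorem: \<open>S\<^sup>m(S\<^sup>d\<^sup>-\<^sup>m)\<close> has the character of the
  \<open>m\<close>-th exterior power of \<open>S\<^sup>d\<^sup>-\<^sup>1\<close>.\<close>

lemma q_binomial:
  assumes q: "q \<noteq> 0"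
  shows "Abs_fps (\<lambda>m. s ^ m * ext_coeff q d m) =
    lin_prod d (\<lambda>j. s * q powi (int d - 1 - 2 * int j))"
\<comment> \<open>The scale \<open>s\<close> has to vary: passing to \<open>Suc d\<close> multiplies
  the first \<open>d\<close> weights by \<open>q\<close>, which is absorbed into \<open>s\<close>,
  and adds one new lowest weight.\<close>
proof (induction d arbitrary: s)
  case 0
  have "(\<lambda>m. s ^ m * ext_coeff q 0 m) = (\<lambda>m. if m = 0 then 1 else 0)"
    by (auto simp: ext_coeff_def hsym_nth_0 fun_eq_iff)
  then show ?case by (simp add: lin_prod_def fps_eq_iff)
next
  case (Suc d)
  let ?f = "1 - fps_const (s * q powi (- int d)) * fps_X :: complex fps"
  have "lin_prod (Suc d) (\<lambda>j. s * q powi (int (Suc d) - 1 - 2 * int j)) =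
      lin_prod d (\<lambda>j. (s * q) * q powi (int d - 1 - 2 * int j)) * ?f"
  proof -
    have w: "(\<lambda>j. s * q powi (int (Suc d) - 1 - 2 * int j)) =
        (\<lambda>j. (s * q) * q powi (int d - 1 - 2 * int j))"
      using power_int_add_1'[of q "int d - 1 - 2 * int _"] q by (simp add: mult.assoc)
    have "s * q powi (int (Suc d) - 1 - 2 * int d) = s * q powi (- int d)" by simp
    then show ?thesis unfolding lin_prod_Suc by (simp only: w)
  qed
  also have "\<dots> = Abs_fps (\<lambda>m. (s * q) ^ m * ext_coeff q d m) * ?f"
    by (simp only: Suc.IH)
  also have "\<dots> = Abs_fps (\<lambda>m. s ^ m * ext_coeff q (Suc d) m)"
  proof (rule fps_ext)
    fix m
    show "fps_nth (Abs_fps (\<lambda>m. (s * q) ^ m * ext_coeff q d m) * ?f) m =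
        fps_nth (Abs_fps (\<lambda>m. s ^ m * ext_coeff q (Suc d) m)) m"
    proof (cases m)
      case 0
      then show ?thesis by (simp add: ext_coeff_def hsym_nth_0)
    next
      case (Suc k)
      have "q powi (int k - int d) = q ^ k * q powi (- int d)"
        using q by (simp add: power_int_diff power_int_minus field_simps)
      then show ?thesis
        unfolding Suc by (simp add: ext_coeff_Suc[OF q] algebra_simps power_mult_distrib)
    qed
  qed
  finally show ?case ..
qed

text \<open>The \<open>d\<close> weights of \<open>q_binomial\<close>, multiplied by
  \<open>q\<close>, are all the weights of \<open>hsym q d\<close> except the lowest; multiplied by
  \<open>inverse q\<close>, all except the highest. After cancellation a single geometric series is
  left.\<close>

lemma ext_hsym_convolution:
  assumes q: "q \<noteq> 0"
  shows "(\<Sum>m\<le>t. q ^ m * ext_coeff q d m * fps_nth (hsym q d) (t - m)) = q powi (- int (t * d))"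
    and "(\<Sum>m\<le>t. inverse q ^ m * ext_coeff q d m * fps_nth (hsym q d) (t - m)) = q powi int (t * d)"
proof -
  have *: "(\<Sum>m\<le>t. s ^ m * ext_coeff q d m * fps_nth (hsym q d) (t - m)) = u ^ t"
    if "lin_prod (Suc d) (sym_weight q d) =
      lin_prod d (\<lambda>j. s * q powi (int d - 1 - 2 * int j)) * (1 - fps_const u * fps_X)" for s u
  proof -
    let ?F = "Abs_fps (\<lambda>m. s ^ m * ext_coeff q d m)" and ?g = "1 - fps_const u * fps_X :: complex fps"
    have "?F * ?g * hsym q d = 1"
      using hsym_mult[of q d] unfolding that q_binomial[OF q] by (simp add: mult_ac)
    moreover have g: "?g * Abs_fps (\<lambda>n. u ^ n) = 1"
    proof (rule fps_ext)
      fix n show "fps_nth (?g * Abs_fps (\<lambda>n. u ^ n)) n = fps_nth 1 n"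
        by (cases n) (simp_all add: algebra_simps)
    qed
    ultimately have "?F * hsym q d = Abs_fps (\<lambda>n. u ^ n)"
      by (metis (no_types, lifting) mult.assoc mult.commute mult_1)
    then have "fps_nth (?F * hsym q d) t = u ^ t" by simp
    then show ?thesis by (simp add: fps_mult_nth atMost_atLeast0)
  qed
  have w: "sym_weight q d = (\<lambda>j. q * q powi (int d - 1 - 2 * int j))"
    using power_int_add_1'[of q "int d - 1 - 2 * int _"] q by (simp add: sym_weight_def fun_eq_iff)
  have "sym_weight q d d = q powi (- int d)"
    by (simp add: sym_weight_def)
  then have "lin_prod (Suc d) (sym_weight q d) =
      lin_prod d (\<lambda>j. q * q powi (int d - 1 - 2 * int j)) * (1 - fps_const (q powi (- int d)) * fps_X)"
    unfolding lin_prod_Suc by (simp only: w)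
  from *[OF this] show "(\<Sum>m\<le>t. q ^ m * ext_coeff q d m * fps_nth (hsym q d) (t - m)) = q powi (- int (t * d))"
    by (simp only: power_int_minus power_int_of_nat power_mult power_inverse mult.commute[of t d])
  have "sym_weight q d (Suc j) = inverse q * q powi (int d - 1 - 2 * int j)" for j
  proof -
    define k where "k = int d - 2 * int (Suc j)"
    have "int d - 1 - 2 * int j = k + 1" by (simp add: k_def)
    then show ?thesis
      unfolding sym_weight_def k_def[symmetric] using q by (simp only: power_int_add_1' simp_thms) simp
  qed
  then have "lin_prod (Suc d) (sym_weight q d) =
      lin_prod d (\<lambda>j. inverse q * q powi (int d - 1 - 2 * int j)) * (1 - fps_const (q powi int d) * fps_X)"
    by (subst lin_prod_Suc_shift) (simp add: sym_weight_def[of q d 0] mult.commute)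
  from *[OF this] show "(\<Sum>m\<le>t. inverse q ^ m * ext_coeff q d m * fps_nth (hsym q d) (t - m)) = q powi int (t * d)"
    by (simp only: power_int_of_nat power_mult mult.commute[of t d])
qed

text \<open>The quantum integer \<open>[k]\<close>, so that \<open>qint q (n + 1)\<close> is the
  character of \<open>S^n\<close> by Weyl's formula. Being defined for all integers
  \<open>k\<close>, it also gives a weight to the terms \<open>m = 0\<close> and
  \<open>m = 1\<close> of the alternating sum.\<close>

definition qint :: "complex \<Rightarrow> int \<Rightarrow> complex" where
  "qint q k = (q powi k - q powi (- k)) / (q - inverse q)"

text \<open>The weight \<open>qint q (m - 1)\<close> is a combination of \<open>q ^ m\<close> and
  \<open>inverse q ^ m\<close>, so the full sum from \<open>m = 0\<close> follows from the two
  convolutions. Its \<open>m = 0\<close> term is minus the left-hand side and its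
  \<open>m = 1\<close> term vanishes.\<close>

lemma hsym_plethysm:
  assumes q: "q \<noteq> 0" and q2: "q\<^sup>2 \<noteq> 1" and d: "d \<ge> 2"
  shows "fps_nth (hsym q d) t = qint q (int (t * d) + 1) +
    (\<Sum>m = 2..d. (-1) ^ m * qint q (int m - 1) * fps_nth (hsym q (d - m)) m *
       (if m \<le> t then fps_nth (hsym q d) (t - m) else 0))"
proof -
  let ?c = "\<lambda>m. ext_coeff q d m * (if m \<le> t then fps_nth (hsym q d) (t - m) else 0)"
  have D: "q - inverse q \<noteq> 0"
    using q q2 by (auto simp: power2_eq_square) (metis right_inverse)
  \<comment> \<open>Both ranges are compared with \<open>max t d\<close>: terms with
    \<open>m > t\<close> vanish by the explicit case distinction in \<open>?c\<close>, terms with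
    \<open>m > d\<close> by the definition of \<open>ext_coeff\<close>.\<close>
  have ext: "(\<Sum>m\<le>t. f m * ext_coeff q d m * fps_nth (hsym q d) (t - m)) = (\<Sum>m\<le>d. f m * ?c m)" for f
  proof -
    have "(\<Sum>m\<le>t. f m * ext_coeff q d m * fps_nth (hsym q d) (t - m)) = (\<Sum>m\<le>max t d. f m * ?c m)"
      by (rule sum.mono_neutral_cong_left) auto
    also have "\<dots> = (\<Sum>m\<le>d. f m * ?c m)"
      by (rule sum.mono_neutral_right) (auto simp: ext_coeff_def)
    finally show ?thesis .
  qed
  have "(\<Sum>m\<le>d. qint q (int m - 1) * ?c m) =
      (\<Sum>m\<le>d. (inverse q * (q ^ m * ?c m) - q * (inverse q ^ m * ?c m)) / (q - inverse q))"
  proof (rule sum.cong[OF refl])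
    fix m
    have "q powi (int m - 1) = inverse q * q ^ m" "q powi (- (int m - 1)) = q * inverse q ^ m"
      using q by (simp_all add: power_int_diff power_int_minus field_simps)
    then show "qint q (int m - 1) * ?c m =
        (inverse q * (q ^ m * ?c m) - q * (inverse q ^ m * ?c m)) / (q - inverse q)"
      unfolding qint_def by (simp add: algebra_simps)
  qed
  also have "\<dots> = (inverse q * (\<Sum>m\<le>d. q ^ m * ?c m) - q * (\<Sum>m\<le>d. inverse q ^ m * ?c m)) / (q - inverse q)"
    by (simp only: sum_distrib_left sum_subtractf flip: sum_divide_distrib)
  also have "\<dots> = (inverse q * q powi (- int (t * d)) - q * q powi int (t * d)) / (q - inverse q)"
    using ext_hsym_convolution[OF q, where t = t and d = d] unfolding ext by simp
  also have "\<dots> = - qint q (int (t * d) + 1)"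
  proof -
    have "q powi (int (t * d) + 1) = q * q powi int (t * d)"
      using q by (intro power_int_add_1' simp_thms) simp
    moreover have "q powi (- (int (t * d) + 1)) = inverse q * q powi (- int (t * d))"
      using power_int_add[of q "- int (t * d)" "-1"] q by (simp add: mult.commute)
    ultimately show ?thesis
      unfolding qint_def by (simp only: minus_divide_left minus_diff_eq)
  qed
  finally have main: "(\<Sum>m\<le>d. qint q (int m - 1) * ?c m) = - qint q (int (t * d) + 1)" .
  have "{..d} = {0, 1} \<union> {2..d}" using d by auto
  then have "(\<Sum>m\<le>d. qint q (int m - 1) * ?c m) =
      qint q (-1) * ?c 0 + qint q 0 * ?c 1 + (\<Sum>m = 2..d. qint q (int m - 1) * ?c m)"
    by simp
  also have "qint q 0 = 0" by (simp add: qint_def)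
  also have "qint q (-1) = -1"
    using D by (simp add: qint_def field_simps)
  also have "(\<Sum>m = 2..d. qint q (int m - 1) * ?c m) =
    (\<Sum>m = 2..d. (-1) ^ m * qint q (int m - 1) * fps_nth (hsym q (d - m)) m *
       (if m \<le> t then fps_nth (hsym q d) (t - m) else 0))"
    by (rule sum.cong) (auto simp: ext_coeff_def)
  finally show ?thesis
    using main by (simp add: ext_coeff_def hsym_nth_0 algebra_simps)
qed

section \<open>Representations with a hermitian form\<close>

definition torus :: "complex \<Rightarrow> complex^2^2" where
  "torus z = vector [vector [z, 0], vector [0, inverse z]]"

definition upper :: "complex \<Rightarrow> complex^2^2" where
  "upper x = vector [vector [1, x], vector [0, 1]]"

definition lower :: "complex \<Rightarrow> complex^2^2" where
  "lower x = vector [vector [1, 0], vector [x, 1]]"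

text \<open>Conjugate transposition preserves \<open>SL2\<close>, so orthogonal complements can be
  handled algebraically on the whole group, without averaging over a compact subgroup.\<close>

definition ctrans :: "complex^2^2 \<Rightarrow> complex^2^2" where
  "ctrans g = (\<chi> i j. cnj (g $ j $ i))"

lemma mat2_entries [simp]:
  "torus z $ 1 $ 1 = z" "torus z $ 1 $ 2 = 0" "torus z $ 2 $ 1 = 0" "torus z $ 2 $ 2 = inverse z"
  "upper x $ 1 $ 1 = 1" "upper x $ 1 $ 2 = x" "upper x $ 2 $ 1 = 0" "upper x $ 2 $ 2 = 1"
  "lower x $ 1 $ 1 = 1" "lower x $ 1 $ 2 = 0" "lower x $ 2 $ 1 = x" "lower x $ 2 $ 2 = 1"
  by (simp_all add: torus_def upper_def lower_def)

lemma mat2_SL2 [simp]: "z \<noteq> 0 \<Longrightarrow> torus z \<in> SL2" "upper x \<in> SL2" "lower x \<in> SL2"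
  by (simp_all add: SL2_def det_2)

lemma ctrans_SL2: "g \<in> SL2 \<Longrightarrow> ctrans g \<in> SL2"
  by (simp add: SL2_def det_2 ctrans_def mult.commute flip: complex_cnj_mult complex_cnj_diff)

lemma SL2_mult: "g \<in> SL2 \<Longrightarrow> h \<in> SL2 \<Longrightarrow> g ** h \<in> SL2"
  by (simp add: SL2_def det_mul)

lemma mat2_eqI:
  "g $ 1 $ 1 = h $ 1 $ 1 \<Longrightarrow> g $ 1 $ 2 = h $ 1 $ 2 \<Longrightarrow> g $ 2 $ 1 = h $ 2 $ 1 \<Longrightarrow> g $ 2 $ 2 = h $ 2 $ 2
    \<Longrightarrow> g = (h :: complex^2^2)"
  by (simp add: vec_eq_iff forall_2)

lemma mat2_mult:
  "(g ** h) $ i $ j = g $ i $ 1 * h $ 1 $ j + g $ i $ 2 * (h :: complex^2^2) $ 2 $ j"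
  by (simp add: matrix_matrix_mult_def sum_2)

text \<open>Moving a torus element past a unipotent one rescales the parameter by
  \<open>z^2\<close>. With \<open>z\<close> tending to 0 this contracts the unipotent subgroup to
  the identity.\<close>

lemma upper_torus: "z \<noteq> 0 \<Longrightarrow> torus z ** upper x = upper (z\<^sup>2 * x) ** torus z"
  by (rule mat2_eqI) (simp_all add: mat2_mult power2_eq_square)

lemma lower_torus: "z \<noteq> 0 \<Longrightarrow> lower (z\<^sup>2 * x) ** torus (inverse z) = torus (inverse z) ** lower x"
  by (rule mat2_eqI) (simp_all add: mat2_mult power2_eq_square)

text \<open>On the open cell where the corner entry is nonzero, this reduces the orbit of a highest
  weight vector to its translates by \<open>lower\<close>.\<close>

lemma gauss_decomposition:
  assumes "g \<in> SL2" "g $ 1 $ 1 \<noteq> 0"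
  shows "g = lower (g $ 2 $ 1 / g $ 1 $ 1) ** (torus (g $ 1 $ 1) ** upper (g $ 1 $ 2 / g $ 1 $ 1))"
proof (rule mat2_eqI)
  have "g $ 1 $ 1 * g $ 2 $ 2 = 1 + g $ 1 $ 2 * g $ 2 $ 1"
    using assms by (simp add: SL2_def det_2 algebra_simps)
  then show "g $ 2 $ 2 = (lower (g $ 2 $ 1 / g $ 1 $ 1) **
      (torus (g $ 1 $ 1) ** upper (g $ 1 $ 2 / g $ 1 $ 1))) $ 2 $ 2"
    using assms(2) by (simp add: mat2_mult field_simps)
qed (use assms in \<open>simp_all add: mat2_mult\<close>)

text \<open>By the rule \<open>cong\<close> a regular function is arbitrary outside
  \<open>SL2\<close>, so only a function agreeing with it on \<open>SL2\<close> can be expected to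
  be continuous.\<close>

lemma sl2_regular_continuous:
  "sl2_regular f \<Longrightarrow> \<exists>h. continuous_on UNIV h \<and> (\<forall>g\<in>SL2. f g = h g)"
proof (induction rule: sl2_regular.induct)
  case (const c)
  show ?case by (rule exI[of _ "\<lambda>_. c"]) simp
next
  case (entry i j)
  show ?case by (rule exI[of _ "\<lambda>g. g $ i $ j"]) (auto intro!: continuous_intros)
next
  case (add f h)
  then obtain f' h' where "continuous_on UNIV f'" "continuous_on UNIV h'"
    "\<forall>g\<in>SL2. f g = f' g" "\<forall>g\<in>SL2. h g = h' g" by blast
  then show ?case by (intro exI[of _ "\<lambda>g. f' g + h' g"]) (auto intro!: continuous_intros)
next
  case (mult f h)
  then obtain f' h' where "continuous_on UNIV f'" "continuous_on UNIV h'"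
    "\<forall>g\<in>SL2. f g = f' g" "\<forall>g\<in>SL2. h g = h' g" by blast
  then show ?case by (intro exI[of _ "\<lambda>g. f' g * h' g"]) (auto intro!: continuous_intros)
qed auto

lemma sl2_regular_LIMSEQ:
  assumes "sl2_regular f" "\<And>k. X k \<in> SL2" "g \<in> SL2"
    and "\<And>i j. (\<lambda>k. X k $ i $ j) \<longlonglongrightarrow> g $ i $ j"
  shows "(\<lambda>k. f (X k)) \<longlonglongrightarrow> f g"
proof -
  obtain h where h: "continuous_on UNIV h" "\<forall>g\<in>SL2. f g = h g"
    using sl2_regular_continuous[OF assms(1)] by blast
  have "X \<longlonglongrightarrow> g"
    by (intro vec_tendstoI assms(4))
  then have "(\<lambda>k. h (X k)) \<longlonglongrightarrow> h g"
    using h(1) by (auto intro: continuous_on_tendsto_compose)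
  then show ?thesis using assms(2,3) h(2) by simp
qed

text \<open>\<open>w\<close> are the torus weights of the basis vectors, and the hermitian form
  \<open>\<Sum>i. d i * v i * cnj (w i)\<close> makes the adjoint of \<open>g\<close> act as its conjugate transpose.\<close>

definition star_rep :: "'i sl2_rep \<Rightarrow> ('i \<Rightarrow> int) \<Rightarrow> ('i \<Rightarrow> real) \<Rightarrow> bool" where
  "star_rep R w d \<longleftrightarrow> (\<forall>i\<in>rep_basis R. d i > 0) \<and>
     (\<forall>z. \<forall>i\<in>rep_basis R. \<forall>j\<in>rep_basis R. z \<noteq> 0 \<longrightarrow>
        rep_act R (torus z) i j = (if i = j then z powi w i else 0)) \<and>
     (\<forall>g\<in>SL2. \<forall>i\<in>rep_basis R. \<forall>j\<in>rep_basis R.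
        of_real (d i) * rep_act R g i j = of_real (d j) * cnj (rep_act R (ctrans g) j i))"

lemma star_repD:
  assumes "star_rep R w d" "i \<in> rep_basis R" "j \<in> rep_basis R"
  shows "d i > 0"
    and "z \<noteq> 0 \<Longrightarrow> rep_act R (torus z) i j = (if i = j then z powi w i else 0)"
    and "g \<in> SL2 \<Longrightarrow> of_real (d i) * rep_act R g i j = of_real (d j) * cnj (rep_act R (ctrans g) j i)"
  using assms by (auto simp: star_rep_def)

lemma star_rep_std: "star_rep std_rep (\<lambda>i. if i = 1 then 1 else -1) (\<lambda>_. 1)"
  by (auto simp: star_rep_def forall_2 ctrans_def power_int_minus)

lemma star_rep_tensor:
  assumes "star_rep R w d" "star_rep S w' d'"
  shows "star_rep (tensor_rep R S) (\<lambda>(i, j). w i + w' j) (\<lambda>(i, j). d i * d' j)"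
  unfolding star_rep_def
proof (intro conjI ballI allI impI)
  show "0 < (case i of (i, j) \<Rightarrow> d i * d' j)" if "i \<in> rep_basis (tensor_rep R S)" for i
    using that assms by (auto simp: star_rep_def)
  show "rep_act (tensor_rep R S) (torus z) i j = (if i = j then z powi (case i of (i, j) \<Rightarrow> w i + w' j) else 0)"
    if "i \<in> rep_basis (tensor_rep R S)" "j \<in> rep_basis (tensor_rep R S)" "z \<noteq> 0" for z i j
    using that
    by (auto simp: star_repD(2)[OF assms(1)] star_repD(2)[OF assms(2)] power_int_add split: if_splits)
  fix g i j assume g: "g \<in> SL2" and i: "i \<in> rep_basis (tensor_rep R S)" and j: "j \<in> rep_basis (tensor_rep R S)"
  obtain a b a' b' where ij: "i = (a, b)" "j = (a', b')" by (metis surj_pair)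
  then show "of_real (case i of (i, j) \<Rightarrow> d i * d' j) * rep_act (tensor_rep R S) g i j =
      of_real (case j of (i, j) \<Rightarrow> d i * d' j) * cnj (rep_act (tensor_rep R S) (ctrans g) j i)"
    using i j star_repD(3)[OF assms(1) _ _ g, of a a'] star_repD(3)[OF assms(2) _ _ g, of b b']
    by (simp add: mult_ac)
qed

section \<open>Diagonal matrices and adjoints on symmetric powers\<close>

lemma sym_mat_diag:
  assumes "finite I" "set_mset \<alpha> \<subseteq> I" "\<And>i j. i \<in> I \<Longrightarrow> j \<in> I \<Longrightarrow> i \<noteq> j \<Longrightarrow> M i j = 0"
  shows "sym_mat I M \<beta> \<alpha> = (if \<beta> = \<alpha> then \<Prod>i\<in>#\<alpha>. M i i else 0)"
  using assms(2)
proof (induction \<alpha> arbitrary: \<beta>)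
  case empty
  show ?case by (simp add: sym_mat_empty)
next
  case (add a \<alpha>)
  have "sym_mat I M \<beta> (add_mset a \<alpha>) =
      (\<Sum>j\<in>I. if j = a then (if a \<in># \<beta> \<and> \<beta> - {#a#} = \<alpha> then M a a * (\<Prod>i\<in>#\<alpha>. M i i) else 0) else 0)"
    unfolding sym_mat_add_mset using add assms(3) by (intro sum.cong) auto
  also have "\<dots> = (if a \<in># \<beta> \<and> \<beta> - {#a#} = \<alpha> then M a a * (\<Prod>i\<in>#\<alpha>. M i i) else 0)"
    using add.prems assms(1) by simp
  also have "a \<in># \<beta> \<and> \<beta> - {#a#} = \<alpha> \<longleftrightarrow> \<beta> = add_mset a \<alpha>"
    by auto
  finally show ?case by simp
qed

text \<open>The chain rule for the derivative of a product of linear forms in the direction of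
  the variable \<open>j\<close>.\<close>

lemma sym_mat_derivative:
  assumes I: "finite I" "j \<in> I" and "set_mset \<alpha> \<subseteq> I"
  shows "of_nat (Suc (count \<beta> j)) * sym_mat I M (add_mset j \<beta>) \<alpha> =
    (\<Sum>a\<in>I. of_nat (count \<alpha> a) * M j a * sym_mat I M \<beta> (\<alpha> - {#a#}))"
  using assms(3)
proof (induction \<alpha> arbitrary: \<beta>)
  case empty
  show ?case by (simp add: sym_mat_empty)
next
  case (add c \<alpha>)
  let ?s = "sym_mat I M"
  have c: "c \<in> I" and sub: "set_mset \<alpha> \<subseteq> I" using add.prems by auto
  have "of_nat (Suc (count \<beta> j)) * ?s (add_mset j \<beta>) (add_mset c \<alpha>) =
      (\<Sum>k\<in>I. if k \<in># add_mset j \<beta> then M k c * (of_nat (Suc (count \<beta> j)) * ?s (add_mset j \<beta> - {#k#}) \<alpha>) else 0)"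
    unfolding sym_mat_add_mset sum_distrib_left by (intro sum.cong) auto
  \<comment> \<open>Leibniz rule: at \<open>k = j\<close> one of the
    \<open>Suc (count \<beta> j)\<close> copies differentiates the new linear form. The other
    copies, and all terms with \<open>k\<close> different from \<open>j\<close>, differentiate the
    remaining product, which is the induction hypothesis.\<close>
  also have "\<dots> = (\<Sum>k\<in>I. (if k = j then M j c * ?s \<beta> \<alpha> else 0) +
      (if k \<in># \<beta> then M k c * (\<Sum>a\<in>I. of_nat (count \<alpha> a) * M j a * ?s (\<beta> - {#k#}) (\<alpha> - {#a#})) else 0))"
  proof (rule sum.cong[OF refl])
    fix k
    have IH: "of_nat (count \<beta> j) * ?s \<beta> \<alpha> =
        (\<Sum>a\<in>I. of_nat (count \<alpha> a) * M j a * ?s (\<beta> - {#j#}) (\<alpha> - {#a#}))" if "j \<in># \<beta>"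
      using add.IH[OF sub, of "\<beta> - {#j#}"] that by simp
    have IH': "of_nat (Suc (count \<beta> j)) * ?s (add_mset j \<beta> - {#k#}) \<alpha> =
        (\<Sum>a\<in>I. of_nat (count \<alpha> a) * M j a * ?s (\<beta> - {#k#}) (\<alpha> - {#a#}))" if "k \<in># \<beta>" "k \<noteq> j"
      using add.IH[OF sub, of "\<beta> - {#k#}"] that by simp
    show "(if k \<in># add_mset j \<beta> then M k c * (of_nat (Suc (count \<beta> j)) * ?s (add_mset j \<beta> - {#k#}) \<alpha>) else 0) =
      (if k = j then M j c * ?s \<beta> \<alpha> else 0) +
      (if k \<in># \<beta> then M k c * (\<Sum>a\<in>I. of_nat (count \<alpha> a) * M j a * ?s (\<beta> - {#k#}) (\<alpha> - {#a#})) else 0)"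
    proof (cases "k = j")
      case True
      then show ?thesis
        by (cases "j \<in># \<beta>")
          (simp_all add: IH[symmetric] count_eq_zero_iff[THEN iffD2] distrib_left distrib_right)
    qed (auto simp: IH'[symmetric])
  qed
  also have "\<dots> = M j c * ?s \<beta> \<alpha> +
      (\<Sum>a\<in>I. \<Sum>k\<in>I. if k \<in># \<beta> then M k c * (of_nat (count \<alpha> a) * M j a * ?s (\<beta> - {#k#}) (\<alpha> - {#a#})) else 0)"
  proof -
    have "(\<Sum>a\<in>I. if k \<in># \<beta> then M k c * (of_nat (count \<alpha> a) * M j a * ?s (\<beta> - {#k#}) (\<alpha> - {#a#})) else 0) =
      (if k \<in># \<beta> then M k c * (\<Sum>a\<in>I. of_nat (count \<alpha> a) * M j a * ?s (\<beta> - {#k#}) (\<alpha> - {#a#})) else 0)" for k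
      by (simp add: sum_distrib_left)
    then show ?thesis using I by (subst sum.swap) (simp add: sum.distrib)
  qed
  also have "(\<Sum>a\<in>I. \<Sum>k\<in>I. if k \<in># \<beta> then M k c * (of_nat (count \<alpha> a) * M j a * ?s (\<beta> - {#k#}) (\<alpha> - {#a#})) else 0) =
      (\<Sum>a\<in>I. of_nat (count \<alpha> a) * M j a * ?s \<beta> (add_mset c (\<alpha> - {#a#})))"
    unfolding sym_mat_add_mset sum_distrib_left by (intro sum.cong) (auto simp: mult_ac)
  also have "M j c * ?s \<beta> \<alpha> + \<dots> =
      (\<Sum>a\<in>I. (if a = c then M j c * ?s \<beta> \<alpha> else 0) + of_nat (count \<alpha> a) * M j a * ?s \<beta> (add_mset c (\<alpha> - {#a#})))"
    using I c by (simp add: sum.distrib)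
  also have "\<dots> = (\<Sum>a\<in>I. of_nat (count (add_mset c \<alpha>) a) * M j a * ?s \<beta> (add_mset c \<alpha> - {#a#}))"
  proof (rule sum.cong[OF refl])
    fix a
    have "add_mset c \<alpha> - {#a#} = add_mset c (\<alpha> - {#a#})" if "a \<in># \<alpha>"
      using that by simp
    then show "(if a = c then M j c * ?s \<beta> \<alpha> else 0) + of_nat (count \<alpha> a) * M j a * ?s \<beta> (add_mset c (\<alpha> - {#a#})) =
        of_nat (count (add_mset c \<alpha>) a) * M j a * ?s \<beta> (add_mset c \<alpha> - {#a#})"
      by (cases "a \<in># \<alpha>") (auto simp: count_eq_zero_iff[THEN iffD2] algebra_simps)
  qed
  finally show ?case .
qed

text \<open>The Fischer inner product on polynomials. The factorials make multiplication by the
  variable \<open>j\<close> adjoint to \<open>d j\<close> times differentiation with respect to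
  it.\<close>

definition sym_form :: "'i set \<Rightarrow> ('i \<Rightarrow> real) \<Rightarrow> 'i multiset \<Rightarrow> real" where
  "sym_form I d \<alpha> = (\<Prod>i\<in>I. fact (count \<alpha> i) * d i ^ count \<alpha> i)"

lemma sym_form_add_mset:
  assumes "finite I" "a \<in> I"
  shows "sym_form I d (add_mset a \<alpha>) = of_nat (Suc (count \<alpha> a)) * d a * sym_form I d \<alpha>"
proof -
  have "(\<Prod>i\<in>I - {a}. fact (count (add_mset a \<alpha>) i) * d i ^ count (add_mset a \<alpha>) i) =
      (\<Prod>i\<in>I - {a}. fact (count \<alpha> i) * d i ^ count \<alpha> i)"
    by (rule prod.cong) auto
  then show ?thesis
    unfolding sym_form_def prod.remove[OF assms] by (simp add: algebra_simps)
qed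

lemma sym_form_pos:
  assumes "finite I" "\<And>i. i \<in> I \<Longrightarrow> d i > 0"
  shows "sym_form I d \<alpha> > 0"
  unfolding sym_form_def using assms by (intro prod_pos) simp

text \<open>Induction on the row monomial: splitting off a variable is a derivative for
  \<open>M\<close> (\<open>sym_mat_derivative\<close>) and multiplication by a linear form for
  \<open>N\<close> (\<open>sym_mat_add_mset\<close>). The weights of \<open>sym_form\<close>
  exchange the two.\<close>

lemma sym_mat_adjoint:
  assumes I: "finite I"
    and adj: "\<And>i j. i \<in> I \<Longrightarrow> j \<in> I \<Longrightarrow> of_real (d i) * M i j = of_real (d j) * cnj (N j i)"
    and "set_mset \<alpha> \<subseteq> I" "set_mset \<beta> \<subseteq> I"
  shows "of_real (sym_form I d \<beta>) * sym_mat I M \<beta> \<alpha> = of_real (sym_form I d \<alpha>) * cnj (sym_mat I N \<alpha> \<beta>)"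
  using assms(3,4)
proof (induction \<beta> arbitrary: \<alpha>)
  case empty
  have "sym_mat I M {#} \<alpha> = (if \<alpha> = {#} then 1 else 0)"
    by (cases \<alpha>) (simp_all add: sym_mat_empty sym_mat_add_mset)
  then show ?case by (simp add: sym_mat_empty)
next
  case (add j \<beta>)
  have j: "j \<in> I" and sub: "set_mset \<beta> \<subseteq> I" using add.prems by auto
  have "of_real (sym_form I d (add_mset j \<beta>)) * sym_mat I M (add_mset j \<beta>) \<alpha> =
      of_real (sym_form I d \<beta>) * of_real (d j) * (of_nat (Suc (count \<beta> j)) * sym_mat I M (add_mset j \<beta>) \<alpha>)"
    by (simp add: sym_form_add_mset[OF I j] mult_ac)
  also have "\<dots> = (\<Sum>a\<in>I. of_real (sym_form I d \<beta>) * of_real (d j) * (of_nat (count \<alpha> a) * M j a * sym_mat I M \<beta> (\<alpha> - {#a#})))"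
    unfolding sym_mat_derivative[OF I j add.prems(1)] sum_distrib_left ..
  also have "\<dots> = (\<Sum>a\<in>I. if a \<in># \<alpha> then of_real (sym_form I d \<alpha>) * (cnj (N a j) * cnj (sym_mat I N (\<alpha> - {#a#}) \<beta>)) else 0)"
  proof (rule sum.cong[OF refl])
    fix a assume a: "a \<in> I"
    show "of_real (sym_form I d \<beta>) * of_real (d j) * (of_nat (count \<alpha> a) * M j a * sym_mat I M \<beta> (\<alpha> - {#a#})) =
      (if a \<in># \<alpha> then of_real (sym_form I d \<alpha>) * (cnj (N a j) * cnj (sym_mat I N (\<alpha> - {#a#}) \<beta>)) else 0)"
    proof (cases "a \<in># \<alpha>")
      case True
      then obtain \<gamma> where \<gamma>: "\<alpha> = add_mset a \<gamma>" by (auto dest: multi_member_split)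
      have "of_real (sym_form I d \<beta>) * sym_mat I M \<beta> \<gamma> = of_real (sym_form I d \<gamma>) * cnj (sym_mat I N \<gamma> \<beta>)"
        using add.IH sub add.prems(1) \<gamma> by simp
      moreover have "of_real (d j) * M j a = of_real (d a) * cnj (N a j)" by (rule adj[OF j a])
      ultimately have "(of_real (sym_form I d \<beta>) * sym_mat I M \<beta> \<gamma>) * (of_real (d j) * M j a) * of_nat (count \<alpha> a) =
          (of_real (sym_form I d \<gamma>) * cnj (sym_mat I N \<gamma> \<beta>)) * (of_real (d a) * cnj (N a j)) * of_nat (count \<alpha> a)"
        by simp
      then show ?thesis
        unfolding \<gamma> by (simp add: sym_form_add_mset[OF I a] mult_ac del: of_nat_Suc)
    qed (simp add: count_eq_zero_iff[THEN iffD2])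
  qed
  also have "\<dots> = of_real (sym_form I d \<alpha>) * cnj (sym_mat I N \<alpha> (add_mset j \<beta>))"
    unfolding sym_mat_add_mset cnj_sum sum_distrib_left by (intro sum.cong) auto
  finally show ?case .
qed

lemma star_rep_sym:
  assumes "star_rep R w d"
  shows "star_rep (sym_rep l R) (\<lambda>\<alpha>. \<Sum>i\<in>#\<alpha>. w i) (sym_form (rep_basis R) d)"
  unfolding star_rep_def
proof (intro conjI ballI allI impI)
  show "0 < sym_form (rep_basis R) d \<alpha>" for \<alpha>
    using assms by (intro sym_form_pos) (auto simp: star_rep_def)
  fix \<beta> \<alpha> assume \<beta>: "\<beta> \<in> rep_basis (sym_rep l R)" and \<alpha>: "\<alpha> \<in> rep_basis (sym_rep l R)"
  have sub: "set_mset \<alpha> \<subseteq> rep_basis R" "set_mset \<beta> \<subseteq> rep_basis R"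
    using \<alpha> \<beta> by (auto simp: monomials_def)
  show "rep_act (sym_rep l R) (torus z) \<beta> \<alpha> = (if \<beta> = \<alpha> then z powi (\<Sum>i\<in>#\<beta>. w i) else 0)"
    if z: "z \<noteq> 0" for z
  proof -
    have "(\<Prod>i\<in>#\<alpha>. rep_act R (torus z) i i) = z powi (\<Sum>i\<in>#\<alpha>. w i)"
      using sub(1) by (induction \<alpha>) (use z star_repD(2)[OF assms] in \<open>auto simp: power_int_add\<close>)
    then show ?thesis
      using sym_mat_diag[OF _ sub(1), of "rep_act R (torus z)" \<beta>] star_repD(2)[OF assms] z by simp
  qed
  show "of_real (sym_form (rep_basis R) d \<beta>) * rep_act (sym_rep l R) g \<beta> \<alpha> =
      of_real (sym_form (rep_basis R) d \<alpha>) * cnj (rep_act (sym_rep l R) (ctrans g) \<alpha> \<beta>)"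
    if "g \<in> SL2" for g
    using that sub by (simp add: sym_mat_adjoint[OF _ star_repD(3)[OF assms]])
qed

section \<open>Highest weight vectors\<close>

definition intertwines :: "'i sl2_rep \<Rightarrow> 'j sl2_rep \<Rightarrow> ('j \<Rightarrow> 'i \<Rightarrow> complex) \<Rightarrow> bool" where
  "intertwines R S T \<longleftrightarrow> (\<forall>g\<in>SL2. meq (rep_basis S) (rep_basis R)
     (mmul (rep_basis R) T (rep_act R g)) (mmul (rep_basis S) (rep_act S g) T))"

text \<open>The adjoint for the diagonal hermitian forms \<open>d\<close> on the source and
  \<open>e\<close> on the target of \<open>T\<close>; the quotient \<open>e s / d i\<close> accounts
  for the bases not being normalised.\<close>

definition adjoint :: "('i \<Rightarrow> real) \<Rightarrow> ('j \<Rightarrow> real) \<Rightarrow> ('j \<Rightarrow> 'i \<Rightarrow> complex) \<Rightarrow> 'i \<Rightarrow> 'j \<Rightarrow> complex" where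
  "adjoint d e T = (\<lambda>i s. of_real (e s / d i) * cnj (T s i))"

lemma intertwinesD:
  "intertwines R S T \<Longrightarrow> g \<in> SL2 \<Longrightarrow> s \<in> rep_basis S \<Longrightarrow> i \<in> rep_basis R \<Longrightarrow>
    (\<Sum>k\<in>rep_basis R. T s k * rep_act R g k i) = (\<Sum>k\<in>rep_basis S. rep_act S g s k * T k i)"
  by (simp add: intertwines_def meq_def mmul_def)

lemma intertwinesI:
  assumes "\<And>g s i. g \<in> SL2 \<Longrightarrow> s \<in> rep_basis S \<Longrightarrow> i \<in> rep_basis R \<Longrightarrow>
    (\<Sum>k\<in>rep_basis R. T s k * rep_act R g k i) = (\<Sum>k\<in>rep_basis S. rep_act S g s k * T k i)"
  shows "intertwines R S T"
  using assms by (simp add: intertwines_def meq_def mmul_def)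

lemma intertwines_mone: "intertwines R R mone"
  unfolding intertwines_def
  by (intro ballI meq_trans[OF meq_mone_left meq_sym[OF meq_mone_right]]) simp_all

lemma intertwines_comp:
  assumes "intertwines R S T" "intertwines S U T'"
  shows "intertwines R U (mmul (rep_basis S) T' T)"
  unfolding intertwines_def
proof
  fix g assume g: "g \<in> SL2"
  let ?R = "rep_basis R" and ?S = "rep_basis S" and ?U = "rep_basis U"
  have "meq ?U ?R (mmul ?R (mmul ?S T' T) (rep_act R g)) (mmul ?S T' (mmul ?S (rep_act S g) T))"
    unfolding mmul_assoc using assms(1) g by (intro meq_mmul meq_refl) (simp add: intertwines_def)
  also have "meq ?U ?R \<dots> (mmul ?S (mmul ?U (rep_act U g) T') T)"
    unfolding mmul_assoc[symmetric] using assms(2) g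
    by (intro meq_mmul meq_refl) (simp add: intertwines_def)
  finally show "meq ?U ?R (mmul ?R (mmul ?S T' T) (rep_act R g)) (mmul ?U (rep_act U g) (mmul ?S T' T))"
    by (simp add: mmul_assoc)
qed

lemma intertwines_diff:
  "intertwines R S T \<Longrightarrow> intertwines R S T' \<Longrightarrow> intertwines R S (\<lambda>s i. T s i - T' s i)"
  by (intro intertwinesI) (simp add: algebra_simps sum_subtractf intertwinesD)

text \<open>Take adjoints in the intertwining relation of \<open>T\<close> at
  \<open>ctrans g\<close>: by \<open>star_rep\<close> the adjoint of the action of
  \<open>ctrans g\<close> is the action of \<open>g\<close>.\<close>

lemma intertwines_adjoint:
  assumes R: "star_rep R w d" and S: "star_rep S w' e" and T: "intertwines R S T"
  shows "intertwines S R (adjoint d e T)"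
proof (rule intertwinesI)
  fix g i s assume g: "g \<in> SL2" and i: "i \<in> rep_basis R" and s: "s \<in> rep_basis S"
  note g' = ctrans_SL2[OF g]
  have nz: "complex_of_real (d i) \<noteq> 0" using star_repD(1)[OF R i i] i by simp
  have "of_real (d i) * (\<Sum>k\<in>rep_basis S. adjoint d e T i k * rep_act S g k s) =
      (\<Sum>k\<in>rep_basis S. of_real (e s) * cnj (rep_act S (ctrans g) s k * T k i))"
    unfolding sum_distrib_left
  proof (rule sum.cong[OF refl])
    fix k assume k: "k \<in> rep_basis S"
    show "of_real (d i) * (adjoint d e T i k * rep_act S g k s) =
        of_real (e s) * cnj (rep_act S (ctrans g) s k * T k i)"
      using star_repD(3)[OF S k s g] nz by (simp add: adjoint_def)
  qed
  also have "\<dots> = of_real (e s) * cnj (\<Sum>k\<in>rep_basis R. T s k * rep_act R (ctrans g) k i)"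
    by (simp add: intertwinesD[OF T g' s i] sum_distrib_left)
  also have "\<dots> = of_real (d i) * (\<Sum>k\<in>rep_basis R. rep_act R g i k * adjoint d e T k s)"
    unfolding sum_distrib_left cnj_sum
  proof (rule sum.cong[OF refl])
    fix k assume k: "k \<in> rep_basis R"
    have nz': "complex_of_real (d k) \<noteq> 0" using star_repD(1)[OF R k k] k by simp
    show "of_real (e s) * cnj (T s k * rep_act R (ctrans g) k i) =
        of_real (d i) * (rep_act R g i k * adjoint d e T k s)"
      using star_repD(3)[OF R i k g] nz' by (simp add: adjoint_def field_simps)
  qed
  finally show "(\<Sum>k\<in>rep_basis S. adjoint d e T i k * rep_act S g k s) =
      (\<Sum>k\<in>rep_basis R. rep_act R g i k * adjoint d e T k s)"
    using nz by simp
qed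

lemma power_int_2_inject: "(2 :: complex) powi a = 2 powi b \<Longrightarrow> a = b"
proof -
  assume "(2 :: complex) powi a = 2 powi b"
  then have "norm ((2 :: complex) powi a) = norm ((2 :: complex) powi b)" by simp
  then have "(2 :: real) powi a = 2 powi b" by (simp add: norm_power_int)
  then show "a = b" using power_int_strict_increasing[of a b "2 :: real"]
      power_int_strict_increasing[of b a "2 :: real"] by (cases a b rule: linorder_cases) auto
qed

text \<open>One torus element suffices: at \<open>torus 2\<close> different integer weights have
  different eigenvalues.\<close>

lemma intertwines_weight:
  assumes R: "star_rep R w d" and S: "star_rep S w' e" and T: "intertwines R S T"
    and s: "s \<in> rep_basis S" and i: "i \<in> rep_basis R" and "T s i \<noteq> 0"
  shows "w' s = w i"
proof -
  have "(\<Sum>k\<in>rep_basis R. T s k * rep_act R (torus 2) k i) = (\<Sum>k\<in>rep_basis R. if k = i then T s i * 2 powi w i else 0)"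
    using i by (intro sum.cong) (auto simp: star_repD(2)[OF R])
  moreover have "(\<Sum>k\<in>rep_basis S. rep_act S (torus 2) s k * T k i) = (\<Sum>k\<in>rep_basis S. if k = s then T s i * 2 powi w' s else 0)"
    using s by (intro sum.cong) (auto simp: star_repD(2)[OF S])
  ultimately have "T s i * 2 powi w' s = T s i * 2 powi w i"
    using intertwinesD[OF T _ s i, of "torus 2"] s i by simp
  then have "(2 :: complex) powi w' s = 2 powi w i" using \<open>T s i \<noteq> 0\<close> by simp
  then show ?thesis by (rule power_int_2_inject)
qed

lemma LIMSEQ_half: "(\<lambda>k. inverse (2 ^ k) :: complex) \<longlonglongrightarrow> 0"
  using LIMSEQ_power_zero[of "1 / 2 :: complex"] by (simp add: power_one_over inverse_eq_divide norm_divide)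

text \<open>Conjugating by the torus contracts \<open>upper x\<close> to the identity and scales the matrix entries
  by powers given by the weights.\<close>

lemma rep_act_upper:
  assumes R: "star_rep R w d" and i: "i \<in> rep_basis R" and j: "j \<in> rep_basis R" and w: "w i \<le> w j"
  shows "rep_act R (upper x) i j = (if i = j then 1 else 0)"
proof -
  let ?f = "\<lambda>x. rep_act R (upper x) i j"
  let ?z = "\<lambda>k. inverse (2 ^ k) :: complex"
  \<comment> \<open>The hypothesis on the weights makes the exponent nonnegative, so
    \<open>?z k ^ m\<close> converges: to 1 for \<open>m = 0\<close>, otherwise to 0, which kills
    the entry.\<close>
  define m where "m = nat (w j - w i)"
  have wj: "w j = w i + int m" using w by (simp add: m_def)
  have "?f x = ?f ((?z k)\<^sup>2 * x) * ?z k ^ m" for k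
  proof -
    have z: "?z k \<noteq> 0" by simp
    have "rep_act R (torus (?z k) ** upper x) i j = ?z k powi w i * ?f x"
    proof -
      have "rep_act R (torus (?z k) ** upper x) i j =
          (\<Sum>l\<in>rep_basis R. if l = i then ?z k powi w i * ?f x else 0)"
        unfolding rep_act_mult[OF mat2_SL2(1)[OF z] mat2_SL2(2) i j]
        by (rule sum.cong) (auto simp: star_repD(2)[OF R i _ z])
      then show ?thesis using i by simp
    qed
    moreover have "rep_act R (upper ((?z k)\<^sup>2 * x) ** torus (?z k)) i j = ?f ((?z k)\<^sup>2 * x) * ?z k powi w j"
    proof -
      have "rep_act R (upper ((?z k)\<^sup>2 * x) ** torus (?z k)) i j =
          (\<Sum>l\<in>rep_basis R. if l = j then ?f ((?z k)\<^sup>2 * x) * ?z k powi w j else 0)"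
        unfolding rep_act_mult[OF mat2_SL2(2) mat2_SL2(1)[OF z] i j]
        by (rule sum.cong) (auto simp: star_repD(2)[OF R _ j z])
      then show ?thesis using j by simp
    qed
    ultimately have "?z k powi w i * ?f x = ?z k powi w i * (?f ((?z k)\<^sup>2 * x) * ?z k ^ m)"
      unfolding upper_torus[OF z] wj by (simp add: power_int_add z mult_ac)
    then show ?thesis using z by (simp only: mult_cancel_left power_int_eq_0_iff) simp
  qed
  then have eq: "?f x = ?f ((?z k)\<^sup>2 * x) * ?z k ^ m" for k .
  have "(\<lambda>k. ?f ((?z k)\<^sup>2 * x)) \<longlonglongrightarrow> ?f 0"
  proof (rule sl2_regular_LIMSEQ[OF rep_act_regular[OF i j]])
    have *: "(\<lambda>k. (?z k)\<^sup>2 * x) \<longlonglongrightarrow> 0\<^sup>2 * x"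
      by (intro tendsto_intros LIMSEQ_half)
    have "\<forall>a b. (\<lambda>k. upper ((?z k)\<^sup>2 * x) $ a $ b) \<longlonglongrightarrow> upper 0 $ a $ b"
      unfolding forall_2 using * by simp
    then show "(\<lambda>k. upper ((?z k)\<^sup>2 * x) $ a $ b) \<longlonglongrightarrow> upper 0 $ a $ b" for a b by blast
  qed simp_all
  then have "(\<lambda>k. ?f ((?z k)\<^sup>2 * x) * ?z k ^ m) \<longlonglongrightarrow> ?f 0 * 0 ^ m"
    by (intro tendsto_intros LIMSEQ_half)
  then have "(\<lambda>k. ?f x) \<longlonglongrightarrow> ?f 0 * 0 ^ m"
    by (simp only: eq[symmetric])
  then have "?f x = ?f 0 * 0 ^ m"
    by (rule LIMSEQ_unique[OF tendsto_const])
  moreover have "upper 0 = mat 1"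
    by (rule mat2_eqI) (simp_all add: mat_def)
  ultimately show ?thesis
    using rep_act_one[OF i j] w wj by (cases "m = 0") auto
qed

definition hw_vector :: "'i sl2_rep \<Rightarrow> ('i \<Rightarrow> int) \<Rightarrow> int \<Rightarrow> ('i \<Rightarrow> complex) \<Rightarrow> bool" where
  "hw_vector R w n v \<longleftrightarrow> (\<forall>i\<in>rep_basis R. v i \<noteq> 0 \<longrightarrow> w i = n) \<and>
     (\<forall>x. \<forall>i\<in>rep_basis R. (\<Sum>j\<in>rep_basis R. rep_act R (upper x) i j * v j) = v i)"

lemma hw_vector_scale: "hw_vector R w n v \<Longrightarrow> hw_vector R w n (\<lambda>i. c * v i)"
  by (simp add: hw_vector_def mult.left_commute flip: sum_distrib_left)

text \<open>By \<open>rep_act_upper\<close>, \<open>upper x\<close> sends the basis vector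
  \<open>j\<close> to itself plus vectors of strictly larger weight, and \<open>T\<close> kills
  those by the maximality of \<open>w j\<close>.\<close>

lemma hw_vector_column:
  assumes R: "star_rep R w d" and S: "star_rep S w' e" and T: "intertwines R S T"
    and j: "j \<in> rep_basis R"
    and max: "\<And>i s. i \<in> rep_basis R \<Longrightarrow> s \<in> rep_basis S \<Longrightarrow> T s i \<noteq> 0 \<Longrightarrow> w i \<le> w j"
  shows "hw_vector S w' (w j) (\<lambda>s. T s j)"
  unfolding hw_vector_def
proof (intro conjI ballI allI impI)
  show "w' s = w j" if "s \<in> rep_basis S" "T s j \<noteq> 0" for s
    using intertwines_weight[OF R S T that(1) j that(2)] .
  show "(\<Sum>k\<in>rep_basis S. rep_act S (upper x) s k * T k j) = T s j" if s: "s \<in> rep_basis S" for x s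
  proof -
    have "(\<Sum>k\<in>rep_basis S. rep_act S (upper x) s k * T k j) = (\<Sum>k\<in>rep_basis R. T s k * rep_act R (upper x) k j)"
      by (rule intertwinesD[OF T _ s j, symmetric]) simp
    also have "\<dots> = (\<Sum>k\<in>rep_basis R. if k = j then T s j else 0)"
    proof (rule sum.cong[OF refl])
      fix k assume k: "k \<in> rep_basis R"
      show "T s k * rep_act R (upper x) k j = (if k = j then T s j else 0)"
        using rep_act_upper[OF R k j] max[OF k s] by (cases "T s k = 0") auto
    qed
    finally show ?thesis using j by simp
  qed
qed

lemma rep_vec_mult:
  assumes "g \<in> SL2" "h \<in> SL2" "i \<in> rep_basis R"
  shows "(\<Sum>j\<in>rep_basis R. rep_act R (g ** h) i j * v j) =
    (\<Sum>k\<in>rep_basis R. rep_act R g i k * (\<Sum>j\<in>rep_basis R. rep_act R h k j * v j))"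
proof -
  have "(\<Sum>j\<in>rep_basis R. rep_act R (g ** h) i j * v j) =
      (\<Sum>j\<in>rep_basis R. \<Sum>k\<in>rep_basis R. rep_act R g i k * (rep_act R h k j * v j))"
    using assms by (intro sum.cong) (simp_all add: rep_act_mult sum_distrib_right mult.assoc)
  then show ?thesis by (subst (asm) sum.swap) (simp add: sum_distrib_left)
qed

lemma hw_vector_torus:
  assumes R: "star_rep R w d" and v: "hw_vector R w n v" and i: "i \<in> rep_basis R" and z: "z \<noteq> 0"
  shows "(\<Sum>j\<in>rep_basis R. rep_act R (torus z) i j * v j) = z powi n * v i"
proof -
  have "(\<Sum>j\<in>rep_basis R. rep_act R (torus z) i j * v j) =
      (\<Sum>j\<in>rep_basis R. if j = i then z powi n * v i else 0)"
  proof (rule sum.cong[OF refl])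
    fix j assume j: "j \<in> rep_basis R"
    show "rep_act R (torus z) i j * v j = (if j = i then z powi n * v i else 0)"
      using v i by (cases "v i = 0") (auto simp: star_repD(2)[OF R i j z] hw_vector_def)
  qed
  then show ?thesis using i by simp
qed

text \<open>The orbit map of a highest weight vector factors through the first column of \<open>g\<close>; torus
  equivariance makes each of its coordinates a monomial, and continuity at \<open>c = 0\<close> and at \<open>a = 0\<close>
  bounds the exponents from below.\<close>

lemma hw_vector_orbit:
  assumes R: "star_rep R w d" and v: "hw_vector R w n v" and i: "i \<in> rep_basis R"
  obtains p m where "\<And>g. g \<in> SL2 \<Longrightarrow> g $ 1 $ 1 \<noteq> 0 \<Longrightarrow>
      (\<Sum>j\<in>rep_basis R. rep_act R g i j * v j) =
      (if 0 \<le> n \<and> m \<le> nat n \<and> w i = n - 2 * int m then p * (g $ 1 $ 1) ^ (nat n - m) * (g $ 2 $ 1) ^ m else 0)"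
proof -
  define F where "F g = (\<Sum>j\<in>rep_basis R. rep_act R g i j * v j)" for g
  define p where "p = F (lower 1)"
  let ?z = "\<lambda>k. inverse (2 ^ k) :: complex"
  have lim: "(\<lambda>k. F (X k)) \<longlonglongrightarrow> F g"
    if "\<And>k. X k \<in> SL2" "g \<in> SL2" "\<And>i j. (\<lambda>k. X k $ i $ j) \<longlonglongrightarrow> g $ i $ j" for X g
    unfolding F_def
    by (intro tendsto_intros sl2_regular_LIMSEQ[OF rep_act_regular[OF i]] that)
  have lim_lower: "(\<lambda>k. F (lower (y k))) \<longlonglongrightarrow> F (lower x)" if "y \<longlonglongrightarrow> x" for y x
  proof (rule lim)
    have "\<forall>a b. (\<lambda>k. lower (y k) $ a $ b) \<longlonglongrightarrow> lower x $ a $ b"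
      unfolding forall_2 using that by simp
    then show "(\<lambda>k. lower (y k) $ a $ b) \<longlonglongrightarrow> lower x $ a $ b" for a b by blast
  qed simp_all
  have F: "F g = (g $ 1 $ 1) powi n * F (lower (g $ 2 $ 1 / g $ 1 $ 1))"
    if g: "g \<in> SL2" "g $ 1 $ 1 \<noteq> 0" for g
  proof -
    let ?l = "lower (g $ 2 $ 1 / g $ 1 $ 1)" and ?t = "torus (g $ 1 $ 1)" and ?u = "upper (g $ 1 $ 2 / g $ 1 $ 1)"
    have "F g = F (?l ** (?t ** ?u))"
      using gauss_decomposition[OF g] by simp
    also have "\<dots> = (\<Sum>k\<in>rep_basis R. rep_act R ?l i k * ((g $ 1 $ 1) powi n * v k))"
      unfolding F_def using v g(2) i
      by (subst rep_vec_mult) (auto intro!: SL2_mult sum.cong simp: rep_vec_mult hw_vector_def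
          hw_vector_torus[OF R v])
    also have "\<dots> = (g $ 1 $ 1) powi n * F ?l"
      by (simp add: F_def sum_distrib_left mult_ac)
    finally show ?thesis .
  qed
  \<comment> \<open>Evaluate \<open>F\<close> on both sides of \<open>lower_torus\<close> at
    \<open>x = 1\<close>: a torus factor on the right acts on \<open>v\<close> with weight
    \<open>n\<close>, one on the left acts on coordinate \<open>i\<close> with weight
    \<open>w i\<close>.\<close>
  have low: "F (lower (z\<^sup>2)) = z powi (n - w i) * p" if z: "z \<noteq> 0" for z
  proof -
    have "F (lower (z\<^sup>2) ** torus (inverse z)) = inverse z powi n * F (lower (z\<^sup>2))"
      using F[of "lower (z\<^sup>2) ** torus (inverse z)"] z by (simp add: SL2_mult mat2_mult field_simps)
    moreover have "F (torus (inverse z) ** lower 1) = inverse z powi (w i) * p"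
    proof -
      have "F (torus (inverse z) ** lower 1) = (\<Sum>k\<in>rep_basis R. rep_act R (torus (inverse z)) i k *
          (\<Sum>j\<in>rep_basis R. rep_act R (lower 1) k j * v j))"
        unfolding F_def using z i by (subst rep_vec_mult) simp_all
      also have "\<dots> = (\<Sum>k\<in>rep_basis R. if k = i then inverse z powi (w i) * p else 0)"
        using z by (intro sum.cong) (auto simp: star_repD(2)[OF R i] p_def F_def)
      finally have "F (torus (inverse z) ** lower 1) =
          (\<Sum>k\<in>rep_basis R. if k = i then inverse z powi (w i) * p else 0)" .
      then show ?thesis using i by simp
    qed
    ultimately have "inverse z powi n * F (lower (z\<^sup>2)) = inverse z powi (w i) * p"
      using lower_torus[OF z, of 1] by simp
    then show ?thesis using z by (simp add: power_int_diff power_int_inverse field_simps)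
  qed
  show ?thesis
  proof (cases "p = 0")
    case True
    have low0: "F (lower x) = 0" for x
    proof (cases "x = 0")
      case False
      then show ?thesis using low[of "csqrt x"] True by simp
    next
      case x: True
      have "(\<lambda>k. F (lower ((?z k)\<^sup>2))) \<longlonglongrightarrow> F (lower (0\<^sup>2))"
        by (intro lim_lower tendsto_intros LIMSEQ_half)
      then have "(\<lambda>k. 0) \<longlonglongrightarrow> F (lower (0\<^sup>2))" using low True by simp
      then show ?thesis using x LIMSEQ_unique[OF tendsto_const] by fastforce
    qed
    show ?thesis by (rule that[of 0 0]) (simp add: F[unfolded low0] F_def[symmetric])
  next
    case False
    \<comment> \<open>Since \<open>z\<close> enters \<open>lower (z^2)\<close> only through its
      square, \<open>z = -1\<close> also yields \<open>p\<close>; as \<open>p\<close> is nonzero the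
      exponent is even.\<close>
    have p: "p = (-1) powi (n - w i) * p" using low[of "-1"] by (simp add: p_def)
    have "even (n - w i)"
      using p False by (cases "even (n - w i)") (auto simp: power_int_minus_one_minus)
    then obtain m' where m': "n - w i = 2 * m'" by blast
    have low': "F (lower x) = x powi m' * p" if "x \<noteq> 0" for x
    proof -
      have "csqrt x powi (2 * m') = (csqrt x powi 2) powi m'"
        by (rule power_int_mult)
      then show ?thesis using low[of "csqrt x"] that m' by simp
    qed
    \<comment> \<open>A negative exponent would be a pole at \<open>lower 0\<close>: multiplied by
      the matching power of \<open>?z k\<close> the values stay equal to \<open>p\<close>, although
      continuity sends them to 0.\<close>
    have pos: "0 \<le> m'"
    proof (rule ccontr)
      assume "\<not> 0 \<le> m'"
      then have "m' = - int (Suc (nat (- m' - 1)))" by simp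
      then obtain l where l: "m' = - int (Suc l)" by blast
      have "(\<lambda>k. F (lower (?z k)) * ?z k ^ Suc l) \<longlonglongrightarrow> F (lower 0) * 0 ^ Suc l"
        by (intro tendsto_intros LIMSEQ_half lim_lower)
      moreover have "F (lower (?z k)) * ?z k ^ Suc l = p" for k
        unfolding low'[of "?z k", simplified] l
        by (simp add: power_int_minus power_int_of_nat field_simps del: of_nat_Suc power_Suc)
      ultimately have "(\<lambda>k. p) \<longlonglongrightarrow> 0" by simp
      then show False using False LIMSEQ_unique[OF tendsto_const] by blast
    qed
    then obtain m where m: "m' = int m" by (rule nonneg_int_cases)
    have low_m: "F (lower x) = x ^ m * p" for x
    proof (cases "x = 0")
      case False
      then show ?thesis using low' m by simp
    next
      case x: True
      have "(\<lambda>k. F (lower (?z k))) \<longlonglongrightarrow> F (lower 0)"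
        by (intro lim_lower LIMSEQ_half)
      moreover have "(\<lambda>k. ?z k ^ m * p) \<longlonglongrightarrow> 0 ^ m * p"
        by (intro tendsto_intros LIMSEQ_half)
      ultimately show ?thesis
        unfolding x using low' m by (simp add: LIMSEQ_unique)
    qed
    have "int m \<le> n"
    proof (rule ccontr)
      assume "\<not> int m \<le> n"
      then have "n = int m - int (Suc (nat (int m - n - 1)))" by simp
      then obtain l where l: "n = int m - int (Suc l)" by blast
      \<comment> \<open>The first column of \<open>G a\<close> is (a, 1), so \<open>a\<close> can
        tend to 0 inside \<open>SL2\<close>. There \<open>F (G a)\<close> is \<open>p\<close> times
        the power of \<open>a\<close> with exponent \<open>n - m\<close>, which again must not have
        a pole.\<close>
      define G :: "complex \<Rightarrow> complex^2^2" where "G a = vector [vector [a, -1], vector [1, 0]]" for a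
      have G [simp]: "G a $ 1 $ 1 = a" "G a $ 1 $ 2 = -1" "G a $ 2 $ 1 = 1" "G a $ 2 $ 2 = 0" for a
        by (simp_all add: G_def)
      have GSL: "G a \<in> SL2" for a by (simp add: SL2_def det_2)
      have "(\<lambda>k. F (G (?z k)) * ?z k ^ Suc l) \<longlonglongrightarrow> F (G 0) * 0 ^ Suc l"
      proof (intro tendsto_mult tendsto_power LIMSEQ_half, rule lim)
        have "\<forall>a b. (\<lambda>k. G (?z k) $ a $ b) \<longlonglongrightarrow> G 0 $ a $ b"
          unfolding forall_2 using LIMSEQ_half by simp
        then show "(\<lambda>k. G (?z k) $ a $ b) \<longlonglongrightarrow> G 0 $ a $ b" for a b by blast
      qed (rule GSL)+
      moreover have "F (G (?z k)) * ?z k ^ Suc l = p" for k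
        using F[OF GSL, of "?z k"] unfolding low_m l
        by (simp add: power_int_diff power_int_of_nat field_simps del: of_nat_Suc power_Suc)
      ultimately have "(\<lambda>k. p) \<longlonglongrightarrow> 0" by simp
      then show False using False LIMSEQ_unique[OF tendsto_const] by blast
    qed
    then have n: "0 \<le> n" "m \<le> nat n" "w i = n - 2 * int m" using m m' by linarith+
    show ?thesis
    proof (rule that[of m p])
      fix g assume g: "g \<in> SL2" "g $ 1 $ 1 \<noteq> 0"
      have "(g $ 1 $ 1) powi n = (g $ 1 $ 1) ^ (nat n - m) * (g $ 1 $ 1) ^ m"
        using n by (simp add: power_int_def flip: power_add)
      then have "F g = p * (g $ 1 $ 1) ^ (nat n - m) * (g $ 2 $ 1) ^ m"
        unfolding F[OF g] low_m using g(2) by (simp add: power_divide)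
      then show "(\<Sum>j\<in>rep_basis R. rep_act R g i j * v j) =
        (if 0 \<le> n \<and> m \<le> nat n \<and> w i = n - 2 * int m then p * (g $ 1 $ 1) ^ (nat n - m) * (g $ 2 $ 1) ^ m else 0)"
        using n by (simp add: F_def)
    qed
  qed
qed

section \<open>Binary forms\<close>

abbreviation bin :: "nat \<Rightarrow> 2 multiset sl2_rep" where
  "bin n \<equiv> sym_rep (int n) std_rep"

abbreviation bin_basis :: "nat \<Rightarrow> 2 multiset set" where
  "bin_basis n \<equiv> monomials (int n) UNIV"

abbreviation bin_top :: "nat \<Rightarrow> 2 multiset" where
  "bin_top n \<equiv> replicate_mset n 1"

definition bin_weight :: "2 multiset \<Rightarrow> int" where
  "bin_weight \<alpha> = (\<Sum>i\<in>#\<alpha>. if i = 1 then 1 else -1)"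

definition bin_form :: "2 multiset \<Rightarrow> real" where
  "bin_form = sym_form UNIV (\<lambda>_. 1)"

lemma star_rep_bin: "star_rep (bin n) bin_weight bin_form"
  using star_rep_sym[OF star_rep_std, of "int n"] by (simp add: bin_weight_def[abs_def] bin_form_def)

lemma size_mset2: "size (\<alpha> :: 2 multiset) = count \<alpha> 1 + count \<alpha> 2"
proof (induction \<alpha>)
  case (add x \<alpha>)
  then show ?case using exhaust_2[of x] by auto
qed simp

lemma mset2_eqI: "count \<alpha> 1 = count \<beta> 1 \<Longrightarrow> count \<alpha> 2 = count \<beta> 2 \<Longrightarrow> \<alpha> = (\<beta> :: 2 multiset)"
  by (rule multiset_eqI) (metis exhaust_2)

lemma bin_weight_count: "bin_weight \<alpha> = int (count \<alpha> 1) - int (count \<alpha> 2)"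
proof (induction \<alpha>)
  case (add x \<alpha>)
  then show ?case using exhaust_2[of x] by (auto simp: bin_weight_def)
qed (simp add: bin_weight_def)

lemma bin_top_in_basis [simp]: "bin_top n \<in> bin_basis n"
  by (simp add: monomials_def)

lemma bin_weight_eq_top:
  assumes "\<beta> \<in> bin_basis n" "bin_weight \<beta> = int n"
  shows "\<beta> = bin_top n"
  using assms by (intro mset2_eqI) (auto simp: bin_weight_count monomials_def size_mset2)

definition bin_mono :: "nat \<Rightarrow> nat \<Rightarrow> 2 multiset" where
  "bin_mono n j = replicate_mset (n - j) 1 + replicate_mset j 2"

lemma count_bin_mono [simp]:
  "count (bin_mono n j) 1 = n - j" "count (bin_mono n j) 2 = j"
  by (simp_all add: bin_mono_def)

lemma bij_bin_mono: "bij_betw (bin_mono n) {..n} (bin_basis n)"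
proof (rule bij_betw_byWitness[where f' = "\<lambda>\<beta>. count \<beta> 2"])
  show "\<forall>\<beta>\<in>bin_basis n. bin_mono n (count \<beta> 2) = \<beta>"
    by (auto intro!: mset2_eqI simp: monomials_def size_mset2)
qed (auto simp: monomials_def size_mset2)

lemma sum_bin_basis: "(\<Sum>\<beta>\<in>bin_basis n. f \<beta>) = (\<Sum>j\<le>n. f (bin_mono n j))"
  by (rule sum.reindex_bij_betw[OF bij_bin_mono, symmetric])

text \<open>The binomial expansion of the \<open>n\<close>-th power of the linear form given by the
  first column of \<open>g\<close>; the induction uses Pascal's rule.\<close>

lemma sym_mat_bin_top:
  "size \<beta> = n \<Longrightarrow> sym_mat UNIV (\<lambda>i j. g $ i $ j) \<beta> (bin_top n) =
    of_nat (n choose count \<beta> 2) * (g $ 1 $ 1) ^ count \<beta> 1 * (g $ 2 $ (1 :: 2)) ^ count \<beta> 2"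
proof (induction n arbitrary: \<beta>)
  case 0
  then show ?case by (simp add: sym_mat_empty)
next
  case (Suc n)
  let ?s = "sym_mat UNIV (\<lambda>i j. g $ i $ j)"
  have *: "?s \<beta> (bin_top (Suc n)) =
      (if 1 \<in># \<beta> then g $ 1 $ 1 * ?s (\<beta> - {#1#}) (bin_top n) else 0) +
      (if 2 \<in># \<beta> then g $ 2 $ 1 * ?s (\<beta> - {#2#}) (bin_top n) else 0)"
    by (simp add: sym_mat_add_mset sum_2)
  have s: "size (\<beta> - {#x#}) = n" if "x \<in># \<beta>" for x
    using Suc.prems that by (simp add: size_Diff_singleton)
  define p q where "p = count \<beta> 1" and "q = count \<beta> 2"
  have pq: "p + q = Suc n" using Suc.prems by (simp add: p_def q_def size_mset2)
  have m: "1 \<in># \<beta> \<longleftrightarrow> p \<noteq> 0" "2 \<in># \<beta> \<longleftrightarrow> q \<noteq> 0"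
    by (simp_all add: p_def q_def)
  have e1: "?s (\<beta> - {#1#}) (bin_top n) = of_nat (n choose q) * (g $ 1 $ 1) ^ (p - 1) * (g $ 2 $ 1) ^ q" if "p \<noteq> 0"
    using Suc.IH[OF s[OF m(1)[THEN iffD2, OF that]]] by (simp add: p_def q_def)
  have e2: "?s (\<beta> - {#2#}) (bin_top n) = of_nat (n choose (q - 1)) * (g $ 1 $ 1) ^ p * (g $ 2 $ 1) ^ (q - 1)" if "q \<noteq> 0"
    using Suc.IH[OF s[OF m(2)[THEN iffD2, OF that]]] by (simp add: p_def q_def)
  have "?s \<beta> (bin_top (Suc n)) = of_nat (Suc n choose q) * (g $ 1 $ 1) ^ p * (g $ 2 $ 1) ^ q"
  proof (cases p)
    case 0
    then show ?thesis unfolding * m using e2 pq by simp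
  next
    case (Suc p')
    then show ?thesis unfolding * m using e1 e2 pq by (cases q) (simp_all add: algebra_simps)
  qed
  then show ?case by (simp add: p_def q_def)
qed

lemma rep_act_std_eta: "rep_act std_rep g = (\<lambda>i j. g $ i $ j)"
  by (simp add: fun_eq_iff)

lemma sum_rep_act_bin_top:
  "(\<Sum>\<beta>\<in>bin_basis n. L \<beta> * rep_act (bin n) g \<beta> (bin_top n)) =
   (\<Sum>j\<le>n. L (bin_mono n j) * (of_nat (n choose j) * (g $ 1 $ 1) ^ (n - j) * (g $ 2 $ 1) ^ j))"
  unfolding sum_bin_basis rep_act_sym rep_act_std_eta rep_basis_std
  by (intro sum.cong refl) (simp add: sym_mat_bin_top size_mset2)

text \<open>The translates of the top vector by the lower unipotent subgroup span.\<close>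

lemma bin_functional_eq_0:
  assumes "infinite C"
    and "\<And>c. c \<in> C \<Longrightarrow> (\<Sum>\<beta>\<in>bin_basis n. L \<beta> * rep_act (bin n) (lower c) \<beta> (bin_top n)) = 0"
    and "\<beta> \<in> bin_basis n"
  shows "L \<beta> = 0"
proof -
  \<comment> \<open>On the translate by \<open>lower c\<close> the functional is a polynomial in
    \<open>c\<close> with these coefficients. Infinitely many roots make them zero, and the binomial
    factors do not vanish.\<close>
  let ?c = "\<lambda>j. L (bin_mono n j) * of_nat (n choose j)"
  have "C \<subseteq> {c. (\<Sum>j\<le>n. ?c j * c ^ j) = 0}"
    using assms(2)[unfolded sum_rep_act_bin_top] by (auto simp: mult.assoc)
  then have "infinite {c. (\<Sum>j\<le>n. ?c j * c ^ j) = 0}"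
    using assms(1) finite_subset by blast
  then have "?c j = 0" if "j \<le> n" for j
    using polyfun_finite_roots[where c = ?c and n = n] that by blast
  moreover obtain j where "j \<le> n" "\<beta> = bin_mono n j"
    using assms(3) bij_bin_mono[of n] by (auto simp: bij_betw_def)
  ultimately show ?thesis by simp
qed

text \<open>The difference kills the top vector, hence all its translates, and these span by
  \<open>bin_functional_eq_0\<close>.\<close>

lemma bin_intertwiner_unique:
  assumes "intertwines (bin n) R T" "intertwines (bin n) R T'"
    and eq: "\<And>i. i \<in> rep_basis R \<Longrightarrow> T i (bin_top n) = T' i (bin_top n)"
  shows "meq (rep_basis R) (bin_basis n) T T'"
  unfolding meq_def
proof (intro ballI)
  fix i \<beta> assume i: "i \<in> rep_basis R" and \<beta>: "\<beta> \<in> bin_basis n"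
  have D: "intertwines (bin n) R (\<lambda>i \<beta>. T i \<beta> - T' i \<beta>)"
    by (rule intertwines_diff[OF assms(1,2)])
  have "T i \<beta> - T' i \<beta> = 0"
  proof (rule bin_functional_eq_0[OF _ _ \<beta>])
    show "infinite (UNIV :: complex set)" by (rule infinite_UNIV_char_0)
    show "(\<Sum>\<beta>\<in>bin_basis n. (T i \<beta> - T' i \<beta>) * rep_act (bin n) (lower c) \<beta> (bin_top n)) = 0" for c
      using intertwinesD[OF D _ i, of "lower c" "bin_top n"] by (simp add: eq)
  qed
  then show "T i \<beta> = T' i \<beta>" by simp
qed

text \<open>Each orbit coordinate of \<open>v\<close> is a single monomial of degree
  \<open>n\<close> in the first column of \<open>g\<close>, just as for the top vector of
  \<open>bin N\<close>. Matching monomials defines \<open>A\<close>; equivariance is then tested on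
  the spanning translates of the top vector.\<close>

lemma hw_vector_intertwiner:
  assumes R: "star_rep R w d" and v: "hw_vector R w n v"
    and nz: "\<exists>i\<in>rep_basis R. v i \<noteq> 0"
  obtains N A where "n = int N" "intertwines (bin N) R A"
    "\<And>i. i \<in> rep_basis R \<Longrightarrow> A i (bin_top N) = v i"
proof -
  define F where "F g i = (\<Sum>j\<in>rep_basis R. rep_act R g i j * v j)" for g i
  let ?P = "\<lambda>i m. 0 \<le> n \<and> m \<le> nat n \<and> w i = n - 2 * int m"
  let ?Q = "\<lambda>i pm. \<forall>g. g \<in> SL2 \<longrightarrow> g $ 1 $ 1 \<noteq> 0 \<longrightarrow>
      F g i = (if ?P i (snd pm) then fst pm * (g $ 1 $ 1) ^ (nat n - snd pm) * (g $ 2 $ 1) ^ snd pm else 0)"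
  have "\<forall>i\<in>rep_basis R. \<exists>pm. ?Q i pm"
  proof
    fix i assume i: "i \<in> rep_basis R"
    obtain p m where "\<And>g. g \<in> SL2 \<Longrightarrow> g $ 1 $ 1 \<noteq> 0 \<Longrightarrow>
      F g i = (if ?P i m then p * (g $ 1 $ 1) ^ (nat n - m) * (g $ 2 $ 1) ^ m else 0)"
      by (rule hw_vector_orbit[OF R v i, folded F_def]) (rule that)
    then have "?Q i (p, m)" by (simp only: fst_conv snd_conv) blast
    then show "\<exists>pm. ?Q i pm" by (rule exI)
  qed
  then have "\<exists>pm. \<forall>i\<in>rep_basis R. ?Q i (pm i)" by (rule bchoice)
  then obtain pm where pm0: "\<forall>i\<in>rep_basis R. ?Q i (pm i)" by (rule exE)
  have pm: "F g i = (if ?P i (snd (pm i)) then fst (pm i) * (g $ 1 $ 1) ^ (nat n - snd (pm i)) * (g $ 2 $ 1) ^ snd (pm i) else 0)"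
    if "i \<in> rep_basis R" "g \<in> SL2" "g $ 1 $ 1 \<noteq> 0" for i g
    using pm0[rule_format, OF that] .
  have one: "mat 1 \<in> SL2" by (simp add: SL2_def)
  have F1: "F (mat 1) i = v i" if i: "i \<in> rep_basis R" for i
  proof -
    have "F (mat 1) i = (\<Sum>j\<in>rep_basis R. if j = i then v i else 0)"
      unfolding F_def using i by (intro sum.cong) (auto simp: rep_act_one)
    then show ?thesis using i by simp
  qed
  define N where "N = nat n"
  obtain i where i: "i \<in> rep_basis R" "v i \<noteq> 0" using nz by blast
  have "(mat 1 :: complex^2^2) $ 1 $ 1 \<noteq> 0" by (simp add: mat_def)
  then have "0 \<le> n"
    using pm[OF i(1) one] F1[OF i(1)] i(2) by (metis (no_types, lifting))
  then have n: "n = int N" by (simp add: N_def)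
  \<comment> \<open>Division by the binomial coefficient compensates the one in
    \<open>sum_rep_act_bin_top\<close>. Each row has at most one nonzero entry, at the monomial of
    the matching weight.\<close>
  define A where "A i \<beta> = (if ?P i (snd (pm i)) \<and> count \<beta> (2 :: 2) = snd (pm i)
    then fst (pm i) / of_nat (N choose snd (pm i)) else 0)" for i \<beta>
  have orbit: "(\<Sum>\<beta>\<in>bin_basis N. A i \<beta> * rep_act (bin N) g \<beta> (bin_top N)) = F g i"
    if i: "i \<in> rep_basis R" and g: "g \<in> SL2" "g $ 1 $ 1 \<noteq> 0" for i g
  proof (cases "?P i (snd (pm i))")
    case True
    have "(\<Sum>\<beta>\<in>bin_basis N. A i \<beta> * rep_act (bin N) g \<beta> (bin_top N)) =
        (\<Sum>j\<le>N. if j = snd (pm i) then F g i else 0)"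
      unfolding sum_rep_act_bin_top
    proof (rule sum.cong[OF refl])
      fix j assume "j \<in> {..N}"
      then show "A i (bin_mono N j) * (of_nat (N choose j) * (g $ 1 $ 1) ^ (N - j) * (g $ 2 $ 1) ^ j) =
          (if j = snd (pm i) then F g i else 0)"
        using True by (simp add: A_def pm[OF i g] N_def)
    qed
    then show ?thesis using True by (simp add: N_def)
  next
    case False
    have "A i \<beta> = 0" for \<beta>
      unfolding A_def by (rule if_not_P) (use False in blast)
    moreover have "F g i = 0"
      unfolding pm[OF i g] by (rule if_not_P[OF False])
    ultimately show ?thesis by simp
  qed
  show ?thesis
  proof (rule that[OF n])
    show "A i (bin_top N) = v i" if i: "i \<in> rep_basis R" for i
    proof -
      have "(\<Sum>\<beta>\<in>bin_basis N. A i \<beta> * rep_act (bin N) (mat 1) \<beta> (bin_top N)) =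
          (\<Sum>\<beta>\<in>bin_basis N. if \<beta> = bin_top N then A i (bin_top N) else 0)"
        by (rule sum.cong) (use rep_act_one[of _ "bin N" "bin_top N"] in auto)
      then show ?thesis
        using orbit[OF i one] F1[OF i] by (simp add: mat_def finite_monomials)
    qed
    show "intertwines (bin N) R A"
    proof (rule intertwinesI)
      fix h i \<beta> assume h: "h \<in> SL2" and i: "i \<in> rep_basis R" and \<beta>: "\<beta> \<in> rep_basis (bin N)"
      \<comment> \<open>Only these \<open>c\<close> keep \<open>h ** lower c\<close> in the open
        cell where \<open>orbit\<close> applies; at most one value of \<open>c\<close> is
        lost.\<close>
      define C where "C = {c. h $ 1 $ 1 + h $ 1 $ 2 * c \<noteq> 0}"
      have "finite (- C)"
      proof (cases "h $ 1 $ 2 = 0")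
        case True
        then have "- C = {}" using h by (auto simp: C_def SL2_def det_2)
        then show ?thesis by simp
      next
        case False
        then have "- C \<subseteq> {- (h $ 1 $ 1) / h $ 1 $ 2}"
          by (auto simp: C_def field_simps eq_neg_iff_add_eq_0)
        then show ?thesis using finite_subset by blast
      qed
      then have "infinite C"
        using infinite_UNIV_char_0[where 'a = complex] by (metis finite_compl)
      define L where "L \<beta> = (\<Sum>k\<in>bin_basis N. A i k * rep_act (bin N) h k \<beta>) -
        (\<Sum>k\<in>rep_basis R. rep_act R h i k * A k \<beta>)" for \<beta>
      have "L \<beta> = 0"
      proof (rule bin_functional_eq_0[OF \<open>infinite C\<close>])
        show "\<beta> \<in> bin_basis N" using \<beta> by simp
        fix c assume c: "c \<in> C"
        let ?r = "\<lambda>g \<beta>. rep_act (bin N) g \<beta> (bin_top N)"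
        have "(\<Sum>\<beta>\<in>bin_basis N. L \<beta> * ?r (lower c) \<beta>) =
            (\<Sum>\<beta>\<in>bin_basis N. \<Sum>k\<in>bin_basis N. A i k * (rep_act (bin N) h k \<beta> * ?r (lower c) \<beta>)) -
            (\<Sum>\<beta>\<in>bin_basis N. \<Sum>k\<in>rep_basis R. rep_act R h i k * (A k \<beta> * ?r (lower c) \<beta>))"
          unfolding L_def left_diff_distrib sum_subtractf sum_distrib_right mult.assoc ..
        also have "\<dots> = (\<Sum>k\<in>bin_basis N. A i k * (\<Sum>\<beta>\<in>bin_basis N. rep_act (bin N) h k \<beta> * ?r (lower c) \<beta>)) -
            (\<Sum>k\<in>rep_basis R. rep_act R h i k * (\<Sum>\<beta>\<in>bin_basis N. A k \<beta> * ?r (lower c) \<beta>))"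
          unfolding sum_distrib_left by (intro arg_cong2[where f = minus] sum.swap)
        also have "(\<Sum>k\<in>bin_basis N. A i k * (\<Sum>\<beta>\<in>bin_basis N. rep_act (bin N) h k \<beta> * ?r (lower c) \<beta>)) =
            (\<Sum>k\<in>bin_basis N. A i k * ?r (h ** lower c) k)"
        proof (rule sum.cong[OF refl])
          fix k assume "k \<in> bin_basis N"
          then show "A i k * (\<Sum>\<beta>\<in>bin_basis N. rep_act (bin N) h k \<beta> * ?r (lower c) \<beta>) =
              A i k * ?r (h ** lower c) k"
            using rep_act_mult[OF h mat2_SL2(3), of k "bin N" "bin_top N" c] by simp
        qed
        also have "\<dots> = F (h ** lower c) i"
          using c by (intro orbit i SL2_mult h) (simp_all add: mat2_mult C_def)
        also have "(\<Sum>k\<in>rep_basis R. rep_act R h i k * (\<Sum>\<beta>\<in>bin_basis N. A k \<beta> * ?r (lower c) \<beta>)) =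
            (\<Sum>k\<in>rep_basis R. rep_act R h i k * F (lower c) k)"
          by (intro sum.cong refl arg_cong2[where f = times] orbit) simp_all
        also have "\<dots> = F (h ** lower c) i"
          unfolding F_def by (rule rep_vec_mult[symmetric]) (simp_all add: h i)
        finally show "(\<Sum>\<beta>\<in>bin_basis N. L \<beta> * ?r (lower c) \<beta>) = 0" by simp
      qed
      then show "(\<Sum>k\<in>rep_basis (bin N). A i k * rep_act (bin N) h k \<beta>) =
          (\<Sum>k\<in>rep_basis R. rep_act R h i k * A k \<beta>)"
        by (simp add: L_def)
    qed
  qed
qed

section \<open>Complete reducibility\<close>

text \<open>Tagging basis vectors by the number of their block keeps the index type fixed as
  \<open>K\<close> grows, whereas iterating \<open>dsum_rep\<close> would change the type with every
  summand.\<close>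

lift_definition block_rep :: "nat \<Rightarrow> (nat \<Rightarrow> 'i sl2_rep) \<Rightarrow> (nat \<times> 'i) sl2_rep" is
  "\<lambda>K F. (SIGMA k:{..<K}. fst (F k), \<lambda>g (k, i) (l, j). if k = l then snd (F k) g i j else 0)"
proof (clarsimp, goal_cases)
  case (1 K F)
  then have F: "is_sl2_rep (fst (F k)) (snd (F k))" for k by (simp add: case_prod_beta)
  let ?I = "SIGMA k:{..<K}. fst (F k)"
  let ?\<rho> = "\<lambda>g (k, i) (l, j). if k = l then snd (F k) g i j else (0 :: complex)"
  show ?case
    unfolding is_sl2_rep_def
  proof (intro conjI ballI)
    show "finite ?I" using F by (auto simp: is_sl2_rep_def)
    show "sl2_regular (\<lambda>g. ?\<rho> g x y)" if "x \<in> ?I" "y \<in> ?I" for x y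
    proof (cases "fst x = fst y")
      case True
      then show ?thesis using that F by (auto simp: is_sl2_rep_def)
    qed (auto simp: case_prod_beta intro: sl2_regular.const)
    show "meq ?I ?I (?\<rho> (mat 1)) mone"
      using F by (auto simp: is_sl2_rep_def meq_def mone_def)
    fix g h assume gh: "g \<in> SL2" "h \<in> SL2"
    show "meq ?I ?I (?\<rho> (g ** h)) (mmul ?I (?\<rho> g) (?\<rho> h))"
      unfolding meq_def
    proof (intro ballI)
      fix x y assume x: "x \<in> ?I" and y: "y \<in> ?I"
      obtain k i l j where xy: "x = (k, i)" "y = (l, j)" by (metis surj_pair)
      have "mmul ?I (?\<rho> g) (?\<rho> h) x y =
          (\<Sum>m<K. \<Sum>a\<in>fst (F m). ?\<rho> g x (m, a) * ?\<rho> h (m, a) y)"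
        unfolding mmul_def using F by (subst sum.Sigma) (auto simp: is_sl2_rep_def case_prod_beta intro!: sum.cong)
      also have "\<dots> = (\<Sum>m<K. if m = k then \<Sum>a\<in>fst (F k). snd (F k) g i a * ?\<rho> h (k, a) y else 0)"
        by (rule sum.cong) (auto simp: xy)
      also have "\<dots> = (\<Sum>a\<in>fst (F k). snd (F k) g i a * ?\<rho> h (k, a) y)"
        using x xy by simp
      also have "\<dots> = ?\<rho> (g ** h) x y"
        using F[of k] x y gh by (auto simp: xy is_sl2_rep_def meq_def mmul_def)
      finally show "?\<rho> (g ** h) x y = mmul ?I (?\<rho> g) (?\<rho> h) x y" ..
    qed
  qed
qed

lemma rep_basis_block [simp]: "rep_basis (block_rep K F) = (SIGMA k:{..<K}. rep_basis (F k))"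
  by transfer (simp add: case_prod_beta)

lemma rep_act_block [simp]:
  "rep_act (block_rep K F) g (k, i) (l, j) = (if k = l then rep_act (F k) g i j else 0)"
  by transfer (simp add: case_prod_beta)

lemma rep_cls_block: "rep_cls (block_rep K F) = (\<Sum>k<K. rep_cls (F k))"
proof (induction K)
  case 0
  have "rep_iso (block_rep 0 F) zero_rep"
    by (rule rep_iso_reindex[of "\<lambda>_. ()"]) (auto simp: bij_betw_def)
  then show ?case using rep_cls_cong rep_cls_zero by fastforce
next
  case (Suc K)
  have "rep_iso (dsum_rep (block_rep K F) (F K)) (block_rep (Suc K) F)"
  proof (rule rep_iso_reindex[of "\<lambda>x. case x of Inl y \<Rightarrow> y | Inr i \<Rightarrow> (K, i)"])
    show "bij_betw (\<lambda>x. case x of Inl y \<Rightarrow> y | Inr i \<Rightarrow> (K, i))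
        (rep_basis (dsum_rep (block_rep K F) (F K))) (rep_basis (block_rep (Suc K) F))"
      by (rule bij_betw_byWitness[where f' = "\<lambda>x. if fst x < K then Inl x else Inr (snd x)"])
        (auto simp: less_Suc_eq)
  qed auto
  then show ?case by (simp add: rep_cls_cong[symmetric] rep_cls_dsum Suc)
qed

text \<open>A common \<open>w\<close> and \<open>d\<close> for all blocks is enough for sums of
  \<open>bin n\<close>, since \<open>bin_weight\<close> and \<open>bin_form\<close> depend only on
  the monomial.\<close>

lemma star_rep_block:
  assumes "\<And>k. k < K \<Longrightarrow> star_rep (F k) w d"
  shows "star_rep (block_rep K F) (\<lambda>(k, i). w i) (\<lambda>(k, i). d i)"
  using assms unfolding star_rep_def by (auto simp: star_repD)

lemma sum_block:
  "(\<Sum>x\<in>rep_basis (block_rep K F). f x) = (\<Sum>k<K. \<Sum>i\<in>rep_basis (F k). f (k, i))"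
  by (simp add: sum.Sigma case_prod_beta)

lemma intertwines_block:
  "intertwines (block_rep K F) R T \<longleftrightarrow> (\<forall>k<K. intertwines (F k) R (\<lambda>i b. T i (k, b)))"
proof -
  have *: "(\<Sum>x\<in>rep_basis (block_rep K F). T s x * rep_act (block_rep K F) g x (k, b)) =
      (\<Sum>i\<in>rep_basis (F k). T s (k, i) * rep_act (F k) g i b)" if "k < K" for s g k b
  proof -
    have "(\<Sum>x\<in>rep_basis (block_rep K F). T s x * rep_act (block_rep K F) g x (k, b)) =
        (\<Sum>l<K. if l = k then \<Sum>i\<in>rep_basis (F k). T s (k, i) * rep_act (F k) g i b else 0)"
      unfolding sum_block by (rule sum.cong) auto
    then show ?thesis using that by simp
  qed
  show ?thesis
    unfolding intertwines_def meq_def mmul_def using * by auto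
qed

section \<open>Isometric embeddings of sums of binary forms\<close>

definition gram :: "'i set \<Rightarrow> ('i \<Rightarrow> real) \<Rightarrow> ('i \<Rightarrow> 'x \<Rightarrow> complex) \<Rightarrow> 'x \<Rightarrow> 'x \<Rightarrow> complex" where
  "gram I d A x y = (\<Sum>i\<in>I. of_real (d i) * cnj (A i x) * A i y)"

lemma gram_sym: "gram I d A y x = cnj (gram I d A x y)"
  by (simp add: gram_def mult_ac)

lemma mmul_adjoint_gram: "mmul I (adjoint f d A) A x y = gram I d A x y / of_real (f x)"
  by (simp add: mmul_def adjoint_def gram_def sum_divide_distrib)

text \<open>\<open>f\<close> and \<open>d\<close> are the diagonal hermitian forms of \<open>M\<close> and \<open>R\<close>.\<close>

definition isometric :: "'x sl2_rep \<Rightarrow> ('x \<Rightarrow> real) \<Rightarrow> 'i sl2_rep \<Rightarrow> ('i \<Rightarrow> real) \<Rightarrow>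
    ('i \<Rightarrow> 'x \<Rightarrow> complex) \<Rightarrow> bool" where
  "isometric M f R d A \<longleftrightarrow> intertwines M R A \<and>
     (\<forall>x\<in>rep_basis M. \<forall>y\<in>rep_basis M. gram (rep_basis R) d A x y = (if x = y then of_real (f x) else 0))"

lemma isometric_left_inverse:
  assumes "star_rep M u f" "isometric M f R d A"
  shows "meq (rep_basis M) (rep_basis M) (mmul (rep_basis R) (adjoint f d A) A) mone"
  unfolding meq_def mmul_adjoint_gram mone_def
proof (intro ballI)
  fix x y assume "x \<in> rep_basis M" "y \<in> rep_basis M"
  then show "gram (rep_basis R) d A x y / of_real (f x) = (if x = y then 1 else 0)"
    using assms star_repD(1)[OF assms(1), of x x] by (auto simp: isometric_def)
qed

text \<open>The trace of the orthogonal projection \<open>A A\<^sup>*\<close> is at most the dimension.\<close>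

lemma isometric_card_le:
  assumes M: "star_rep M u f" and R: "star_rep R w d" and A: "isometric M f R d A"
  shows "card (rep_basis M) \<le> card (rep_basis R)"
proof -
  let ?I = "rep_basis R" and ?X = "rep_basis M"
  let ?B = "adjoint f d A"
  define E where "E = mmul ?X A ?B"
  have BA: "meq ?X ?X (mmul ?I ?B A) mone" by (rule isometric_left_inverse[OF M A])
  have "meq ?I ?I (mmul ?I E E) E"
  proof -
    have "mmul ?I E E = mmul ?X A (mmul ?X (mmul ?I ?B A) ?B)"
      by (simp add: E_def mmul_assoc)
    moreover have "meq ?I ?I (mmul ?X A (mmul ?X (mmul ?I ?B A) ?B)) (mmul ?X A (mmul ?X mone ?B))"
      by (intro meq_mmul meq_refl BA)
    moreover have "meq ?I ?I (mmul ?X A (mmul ?X mone ?B)) E"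
      unfolding E_def by (intro meq_mmul meq_refl meq_mone_left) simp
    ultimately show ?thesis by (metis meq_trans)
  qed
  then have EE: "(\<Sum>j\<in>?I. E i j * E j i) = E i i" if "i \<in> ?I" for i
    using that by (simp add: meq_def mmul_def)
  have dpos: "d i > 0" if "i \<in> ?I" for i using star_repD(1)[OF R that that] .
  have herm: "of_real (d j) * E j i = of_real (d i) * cnj (E i j)" for i j
    unfolding E_def mmul_def adjoint_def by (simp add: sum_distrib_left mult_ac)
  \<comment> \<open>Idempotent and self-adjoint: \<open>E i i\<close> is a sum of nonnegative terms
    including \<open>(cmod (E i i))^2\<close>, so its real part is at most 1.\<close>
  have le1: "Re (E i i) \<le> 1" if i: "i \<in> ?I" for i
  proof -
    have "E i j * E j i = of_real (d i / d j * (cmod (E i j))\<^sup>2)" if "j \<in> ?I" for j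
    proof -
      have "E j i = of_real (d i / d j) * cnj (E i j)"
        using herm[of j i] dpos[OF that] by (simp add: field_simps)
      then show ?thesis by (simp only: of_real_mult complex_norm_square) (simp add: mult_ac)
    qed
    then have "E i i = of_real (\<Sum>j\<in>?I. d i / d j * (cmod (E i j))\<^sup>2)"
      using EE[OF i] by simp
    then have "Re (E i i) = (\<Sum>j\<in>?I. d i / d j * (cmod (E i j))\<^sup>2)"
      by (metis Re_complex_of_real)
    also have "\<dots> \<ge> d i / d i * (cmod (E i i))\<^sup>2"
      using i dpos by (intro member_le_sum[of i ?I "\<lambda>j. d i / d j * (cmod (E i j))\<^sup>2"])
        (auto intro!: mult_nonneg_nonneg divide_nonneg_nonneg simp: less_imp_le)
    finally have "(cmod (E i i))\<^sup>2 \<le> Re (E i i)" using dpos[OF i] by simp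
    moreover have "(Re (E i i))\<^sup>2 \<le> (cmod (E i i))\<^sup>2"
      by (simp add: cmod_power2)
    ultimately have "Re (E i i) * Re (E i i) \<le> Re (E i i)"
      by (simp add: power2_eq_square)
    then show ?thesis
      by (metis less_eq_real_def linorder_not_less mult_le_cancel_left2 mult_less_cancel_left1 not_one_le_zero order_less_le_trans zero_less_one)
  qed
  have "(\<Sum>i\<in>?I. E i i) = (\<Sum>x\<in>?X. mmul ?I ?B A x x)"
    unfolding E_def mmul_def by (subst sum.swap) (simp add: mult.commute)
  also have "\<dots> = of_nat (card ?X)"
    using BA by (simp add: meq_def mone_def)
  finally have "real (card ?X) = (\<Sum>i\<in>?I. Re (E i i))"
    by (metis Re_sum complex_Re_of_nat)
  also have "\<dots> \<le> real (card ?I)"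
    using sum_mono[of ?I "\<lambda>i. Re (E i i)" "\<lambda>_. 1"] le1 by simp
  finally show ?thesis by simp
qed

text \<open>A Schur type argument: the adjoint of \<open>A\<close> composed with \<open>A\<close> is
  an endomorphism preserving weights, so it maps the top vector to a multiple of itself. The norm
  condition makes the factor 1, and \<open>bin_intertwiner_unique\<close> does the rest.\<close>

lemma isometric_bin:
  assumes R: "star_rep R w d" and A: "intertwines (bin n) R A"
    and norm: "gram (rep_basis R) d A (bin_top n) (bin_top n) = of_real (bin_form (bin_top n))"
  shows "isometric (bin n) bin_form R d A"
proof -
  let ?B = "adjoint bin_form d A"
  let ?D = "mmul (rep_basis R) ?B A"
  note S = star_rep_bin[of n]
  have B: "intertwines R (bin n) ?B" by (rule intertwines_adjoint[OF S R A])
  have D: "intertwines (bin n) (bin n) ?D" by (rule intertwines_comp[OF A B])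
  have pos: "bin_form \<beta> > 0" for \<beta> by (simp add: bin_form_def sym_form_pos)
  have "meq (rep_basis (bin n)) (bin_basis n) ?D mone"
  proof (rule bin_intertwiner_unique[OF D intertwines_mone])
    fix \<beta> assume \<beta>: "\<beta> \<in> rep_basis (bin n)"
    show "?D \<beta> (bin_top n) = mone \<beta> (bin_top n)"
    proof (cases "\<beta> = bin_top n")
      case True
      then show ?thesis
        using norm pos[of "bin_top n"] by (simp add: mmul_adjoint_gram mone_def)
    next
      case False
      have "?D \<beta> (bin_top n) = 0"
      proof (rule ccontr)
        assume "?D \<beta> (bin_top n) \<noteq> 0"
        then have "bin_weight \<beta> = bin_weight (bin_top n)"
          using \<beta> by (intro intertwines_weight[OF S S D]) simp_all
        then have "\<beta> = bin_top n"
          using \<beta> by (intro bin_weight_eq_top) (simp_all add: bin_weight_count)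
        then show False using False by simp
      qed
      then show ?thesis using False by (simp add: mone_def)
    qed
  qed
  then have "gram (rep_basis R) d A x y = (if x = y then of_real (bin_form x) else 0)"
    if "x \<in> bin_basis n" "y \<in> bin_basis n" for x y
    using that pos[of x] unfolding meq_def mmul_adjoint_gram mone_def
    by (auto split: if_splits simp: field_simps)
  then show ?thesis using A by (simp add: isometric_def)
qed

text \<open>The copy of \<open>bin l\<close> generated by \<open>v\<close> is entirely orthogonal to
  the image of \<open>A\<close>: the adjoint of \<open>A\<close> composed with its embedding is an
  intertwiner killing the top vector, hence zero.\<close>

lemma isometric_extend:
  fixes N :: "nat \<Rightarrow> nat"
  assumes R: "star_rep R w d"
    and A: "isometric (block_rep K (\<lambda>k. bin (N k))) (\<lambda>(k, \<beta>). bin_form \<beta>) R d A"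
    and v: "hw_vector R w n v" "\<exists>i\<in>rep_basis R. v i \<noteq> 0"
    and orth: "\<And>x. x \<in> rep_basis (block_rep K (\<lambda>k. bin (N k))) \<Longrightarrow>
      (\<Sum>i\<in>rep_basis R. of_real (d i) * cnj (A i x) * v i) = 0"
  shows "\<exists>N' A'. isometric (block_rep (Suc K) (\<lambda>k. bin (N' k))) (\<lambda>(k, \<beta>). bin_form \<beta>) R d A'"
proof -
  let ?I = "rep_basis R" and ?M = "block_rep K (\<lambda>k. bin (N k))"
  have dpos: "d i > 0" if "i \<in> ?I" for i using star_repD(1)[OF R that that] .
  have M: "star_rep ?M (\<lambda>(k, \<beta>). bin_weight \<beta>) (\<lambda>(k, \<beta>). bin_form \<beta>)"
    by (rule star_rep_block) (rule star_rep_bin)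
  define s where "s = (\<Sum>i\<in>?I. d i * (cmod (v i))\<^sup>2)"
  have s: "s > 0"
  proof -
    obtain i where "i \<in> ?I" "v i \<noteq> 0" using v(2) by blast
    then show ?thesis
      unfolding s_def using dpos by (intro sum_pos2[of ?I i]) (auto simp: less_imp_le)
  qed
  \<comment> \<open>The degree is needed first because the normalising factor \<open>c\<close>
    depends on it; the embedding itself comes from a second application, to the rescaled
    vector.\<close>
  obtain l where l: "n = int l"
    using hw_vector_intertwiner[OF R v] by metis
  define c where "c = sqrt (bin_form (bin_top l) / s)"
  have fpos: "bin_form \<beta> > 0" for \<beta> by (simp add: bin_form_def sym_form_pos)
  have c: "c > 0" and c2: "c\<^sup>2 * s = bin_form (bin_top l)"
    using s fpos[of "bin_top l"] by (simp_all add: c_def)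
  have "\<exists>i\<in>?I. of_real c * v i \<noteq> 0" using v(2) c by auto
  then obtain l' C where C: "n = int l'" "intertwines (bin l') R C"
      "\<And>i. i \<in> ?I \<Longrightarrow> C i (bin_top l') = of_real c * v i"
    using hw_vector_intertwiner[OF R hw_vector_scale[OF v(1), of "of_real c"]] by metis
  have "l' = l" using C(1) l by simp
  note C = C[unfolded this]
  have "gram ?I d C (bin_top l) (bin_top l) = (\<Sum>i\<in>?I. of_real (c\<^sup>2 * (d i * (cmod (v i))\<^sup>2)))"
    unfolding gram_def
  proof (rule sum.cong[OF refl])
    fix i assume "i \<in> ?I"
    then show "of_real (d i) * cnj (C i (bin_top l)) * C i (bin_top l) = of_real (c\<^sup>2 * (d i * (cmod (v i))\<^sup>2))"
      by (simp only: C(3) of_real_mult complex_norm_square complex_cnj_mult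
          complex_cnj_complex_of_real) (simp add: power2_eq_square mult_ac)
  qed
  also have "\<dots> = of_real (bin_form (bin_top l))"
    unfolding c2[symmetric] s_def by (simp add: sum_distrib_left)
  finally have CC: "isometric (bin l) bin_form R d C"
    by (intro isometric_bin[OF R C(2)])
  have AC: "(\<Sum>i\<in>?I. of_real (d i) * cnj (A i x) * C i \<beta>) = 0"
    if x: "x \<in> rep_basis ?M" and \<beta>: "\<beta> \<in> bin_basis l" for x \<beta>
  proof -
    let ?B = "adjoint (\<lambda>(k, \<beta>). bin_form \<beta>) d A"
    have B: "intertwines R ?M ?B"
      using A by (intro intertwines_adjoint[OF M R]) (simp add: isometric_def)
    have D: "intertwines (bin l) ?M (mmul ?I ?B C)"
      by (rule intertwines_comp[OF C(2) B])
    have Z: "intertwines (bin l) ?M (\<lambda>_ _. 0)"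
      by (simp add: intertwines_def meq_def mmul_def)
    have e: "mmul ?I ?B C y \<gamma> = (\<Sum>i\<in>?I. of_real (d i) * cnj (A i y) * C i \<gamma>) / of_real (bin_form (snd y))"
      for y \<gamma>
      by (simp add: mmul_def adjoint_def case_prod_beta sum_divide_distrib)
    have "meq (rep_basis ?M) (bin_basis l) (mmul ?I ?B C) (\<lambda>_ _. 0)"
    proof (rule bin_intertwiner_unique[OF D Z])
      fix y assume y: "y \<in> rep_basis ?M"
      have "(\<Sum>i\<in>?I. of_real (d i) * cnj (A i y) * C i (bin_top l)) =
          of_real c * (\<Sum>i\<in>?I. of_real (d i) * cnj (A i y) * v i)"
        unfolding sum_distrib_left by (intro sum.cong refl) (simp add: C(3))
      then show "mmul ?I ?B C y (bin_top l) = 0"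
        unfolding e by (simp add: orth[OF y])
    qed
    then have "mmul ?I ?B C x \<beta> = 0" using x \<beta> by (simp only: meq_def)
    then show ?thesis using fpos[of "snd x"] unfolding e by simp
  qed
  define N' where "N' = N(K := l)"
  define A' where "A' i x = (if fst x < K then A i x else C i (snd x))" for i x
  have "isometric (block_rep (Suc K) (\<lambda>k. bin (N' k))) (\<lambda>(k, \<beta>). bin_form \<beta>) R d A'"
    unfolding isometric_def
  proof (intro conjI ballI)
    have "intertwines (bin (N k)) R (\<lambda>i b. A i (k, b))" if "k < K" for k
      using A that by (simp add: isometric_def intertwines_block)
    then have "intertwines (bin (N' k)) R (\<lambda>i b. A' i (k, b))" if "k < Suc K" for k
      using that C(2) by (cases "k = K") (simp_all add: N'_def A'_def)
    then show "intertwines (block_rep (Suc K) (\<lambda>k. bin (N' k))) R A'"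
      by (simp add: intertwines_block)
    fix x y
    assume x: "x \<in> rep_basis (block_rep (Suc K) (\<lambda>k. bin (N' k)))"
      and y: "y \<in> rep_basis (block_rep (Suc K) (\<lambda>k. bin (N' k)))"
    have cases: "z \<in> rep_basis ?M \<and> fst z < K \<or> (\<exists>\<beta>. z = (K, \<beta>) \<and> \<beta> \<in> bin_basis l)"
      if "z \<in> rep_basis (block_rep (Suc K) (\<lambda>k. bin (N' k)))" for z
      using that by (cases "fst z = K") (auto simp: N'_def less_Suc_eq)
    have mix: "gram ?I d A' x' (K, \<beta>) = 0" if "x' \<in> rep_basis ?M" "fst x' < K" "\<beta> \<in> bin_basis l" for x' \<beta>
      using AC[OF that(1,3)] by (simp add: gram_def A'_def that(2))
    from cases[OF x] cases[OF y]
    show "gram ?I d A' x y = (if x = y then of_real (case x of (k, \<beta>) \<Rightarrow> bin_form \<beta>) else 0)"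
    proof (elim disjE exE conjE)
      assume "x \<in> rep_basis ?M" "fst x < K" "y \<in> rep_basis ?M" "fst y < K"
      moreover from this have "gram ?I d A' x y = gram ?I d A x y"
        by (simp add: gram_def A'_def)
      ultimately show ?thesis using A unfolding isometric_def by simp
    next
      fix \<beta> assume "x \<in> rep_basis ?M" "fst x < K" "y = (K, \<beta>)" "\<beta> \<in> bin_basis l"
      then show ?thesis using mix by auto
    next
      fix \<beta> assume "y \<in> rep_basis ?M" "fst y < K" "x = (K, \<beta>)" "\<beta> \<in> bin_basis l"
      then show ?thesis using mix[of y \<beta>] gram_sym[of ?I d A' y x] by auto
    next
      fix \<beta> \<gamma> assume "x = (K, \<beta>)" "\<beta> \<in> bin_basis l" "y = (K, \<gamma>)" "\<gamma> \<in> bin_basis l"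
      moreover have "gram ?I d A' (K, \<beta>) (K, \<gamma>) = gram ?I d C \<beta> \<gamma>"
        by (simp add: gram_def A'_def)
      ultimately show ?thesis using CC unfolding isometric_def by simp
    qed
  qed
  then show ?thesis by blast
qed

text \<open>With a maximal number of orthogonal copies of binary forms, the projection
  \<open>T\<close> onto their complement is still an intertwiner. A nonzero column of
  \<open>T\<close> of greatest weight would be a highest weight vector for
  \<open>isometric_extend\<close>.\<close>

lemma star_rep_decomposition:
  assumes R: "star_rep R w d"
  obtains K N where "rep_iso (block_rep K (\<lambda>k. bin (N k))) R"
proof -
  let ?I = "rep_basis R" and ?f = "\<lambda>(k :: nat, \<beta>). bin_form \<beta>"
  let ?ex = "\<lambda>K. \<exists>N A. isometric (block_rep K (\<lambda>k. bin (N k))) ?f R d A"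
  have M: "star_rep (block_rep K (\<lambda>k. bin (N k))) (\<lambda>(k, \<beta>). bin_weight \<beta>) ?f" for K and N :: "nat \<Rightarrow> nat"
    by (rule star_rep_block) (rule star_rep_bin)
  \<comment> \<open>Every block contains its top vector, so \<open>K\<close> blocks have dimension
    at least \<open>K\<close>; this bound makes \<open>Greatest ?ex\<close> meaningful.\<close>
  have bound: "K \<le> card ?I" if ex: "?ex K" for K
  proof -
    obtain N A where "isometric (block_rep K (\<lambda>k. bin (N k))) ?f R d A" using ex by blast
    from isometric_card_le[OF M R this]
    have "card (rep_basis (block_rep K (\<lambda>k. bin (N k)))) \<le> card ?I" .
    moreover have "card ((\<lambda>k. (k, bin_top (N k))) ` {..<K}) \<le> card (rep_basis (block_rep K (\<lambda>k. bin (N k))))"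
      by (intro card_mono finite_rep_basis) auto
    moreover have "card ((\<lambda>k. (k, bin_top (N k))) ` {..<K}) = K"
      by (subst card_image) (auto simp: inj_on_def)
    ultimately show ?thesis by simp
  qed
  have "?ex 0"
    by (intro exI[of _ "\<lambda>_. 0"] exI[of _ "\<lambda>_ _. 0"]) (simp add: isometric_def intertwines_block)
  then have ex: "?ex (Greatest ?ex)" and max: "\<not> ?ex (Suc (Greatest ?ex))"
    using GreatestI_nat[of ?ex 0 "card ?I"] Greatest_le_nat[of ?ex "Suc (Greatest ?ex)" "card ?I"] bound
    by (blast, fastforce)
  define K where "K = Greatest ?ex"
  obtain N A where A: "isometric (block_rep K (\<lambda>k. bin (N k))) ?f R d A"
    using ex unfolding K_def by blast
  let ?M = "block_rep K (\<lambda>k. bin (N k))"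
  let ?X = "rep_basis ?M" and ?B = "adjoint ?f d A"
  have AI: "intertwines ?M R A" using A by (simp add: isometric_def)
  have B: "intertwines R ?M ?B" by (rule intertwines_adjoint[OF M R AI])
  have BA: "meq ?X ?X (mmul ?I ?B A) mone" by (rule isometric_left_inverse[OF M A])
  define T where "T i j = mone i j - mmul ?X A ?B i j" for i j
  have T: "intertwines R R T"
    unfolding T_def by (intro intertwines_diff intertwines_mone intertwines_comp[OF B AI])
  have "T i j = 0" if "i \<in> ?I" "j \<in> ?I" for i j
  proof (rule ccontr)
    assume "T i j \<noteq> 0"
    \<comment> \<open>The indices of the nonzero columns of \<open>T\<close>; the maximality asked
      for by \<open>hw_vector_column\<close> only has to hold among these.\<close>
    let ?J = "{j \<in> ?I. \<exists>i\<in>?I. T i j \<noteq> 0}"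
    have "finite (w ` ?J)" "w ` ?J \<noteq> {}" using that \<open>T i j \<noteq> 0\<close> by auto
    then have "Max (w ` ?J) \<in> w ` ?J" by (rule Max_in)
    then obtain m where m: "Max (w ` ?J) = w m" "m \<in> ?J" by (rule imageE)
    have wmax: "w k \<le> w m" if "k \<in> ?I" "s \<in> ?I" "T s k \<noteq> 0" for k s
      unfolding m(1)[symmetric] using that by (intro Max_ge) auto
    have v: "hw_vector R w (w m) (\<lambda>s. T s m)"
      using m(2) by (intro hw_vector_column[OF R R T] wmax) auto
    have "?ex (Suc K)"
    proof (rule isometric_extend[OF R A v])
      show "\<exists>i\<in>?I. T i m \<noteq> 0" using m(2) by blast
      fix x assume x: "x \<in> ?X"
      have mI: "m \<in> ?I" using m(2) by blast
      have fx: "of_real (?f x) \<noteq> (0 :: complex)"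
        using star_repD(1)[OF M x x] by simp
      \<comment> \<open>As \<open>?B\<close> is a left inverse of \<open>A\<close>, composing it
        with \<open>T\<close> gives \<open>?B - ?B = 0\<close>. Up to the nonzero factor
        \<open>?f x\<close> this is orthogonality of column \<open>m\<close> of \<open>T\<close> to
        column \<open>x\<close> of \<open>A\<close>.\<close>
      have "(\<Sum>i\<in>?I. ?B x i * T i m) =
          (\<Sum>i\<in>?I. ?B x i * mone i m) - mmul ?I ?B (mmul ?X A ?B) x m"
        unfolding T_def by (simp add: right_diff_distrib sum_subtractf mmul_def)
      also have "(\<Sum>i\<in>?I. ?B x i * mone i m) = ?B x m"
        using meq_mone_right[OF finite_rep_basis, of "{x}" R ?B] mI by (simp add: meq_def mmul_def)
      also have "mmul ?I ?B (mmul ?X A ?B) x m = ?B x m"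
      proof -
        have "meq ?X ?I (mmul ?X (mmul ?I ?B A) ?B) (mmul ?X mone ?B)"
          by (intro meq_mmul BA meq_refl)
        also have "meq ?X ?I (mmul ?X mone ?B) ?B"
          by (intro meq_mone_left finite_rep_basis)
        finally show ?thesis unfolding mmul_assoc using x mI by (simp only: meq_def)
      qed
      finally have "(\<Sum>i\<in>?I. ?B x i * T i m) = 0" by simp
      moreover have "(\<Sum>i\<in>?I. ?B x i * T i m) =
          (\<Sum>i\<in>?I. of_real (d i) * cnj (A i x) * T i m) / of_real (?f x)"
        by (simp add: adjoint_def sum_divide_distrib)
      ultimately show "(\<Sum>i\<in>?I. of_real (d i) * cnj (A i x) * T i m) = 0"
        using fx by simp
    qed
    then show False using max unfolding K_def by blast
  qed
  then have "meq ?I ?I (mmul ?X A ?B) mone"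
    unfolding meq_def T_def by simp
  then have "rep_iso ?M R"
    unfolding rep_iso_def using BA AI unfolding intertwines_def by blast
  then show ?thesis by (rule that)
qed

section \<open>Characters\<close>

definition torus_trace :: "'i sl2_rep \<Rightarrow> complex \<Rightarrow> complex" where
  "torus_trace R q = (\<Sum>i\<in>rep_basis R. rep_act R (torus q) i i)"

lemma sum_mmul_swap: "(\<Sum>i\<in>I. mmul J A B i i) = (\<Sum>j\<in>J. mmul I B A j j)"
  unfolding mmul_def by (subst sum.swap) (simp add: mult.commute)

lemma trace_iso:
  assumes "rep_iso R S" "q \<noteq> 0"
  shows "torus_trace R q = torus_trace S q"
proof -
  let ?I = "rep_basis R" and ?J = "rep_basis S"
  let ?r = "rep_act R (torus q)" and ?s = "rep_act S (torus q)"
  obtain P Q where QP: "meq ?I ?I (mmul ?J Q P) mone" and PQ: "meq ?J ?J (mmul ?I P Q) mone"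
    and tw: "meq ?J ?I (mmul ?I P ?r) (mmul ?J ?s P)"
    using assms unfolding rep_iso_def by auto
  have tr: "(\<Sum>i\<in>K. M i i) = (\<Sum>i\<in>K. M' i i)" if "meq K K M M'" for K :: "'x set" and M M'
    using that by (simp add: meq_def)
  have "meq ?I ?I ?r (mmul ?I mone ?r)"
    by (intro meq_sym[OF meq_mone_left]) simp
  also have "meq ?I ?I \<dots> (mmul ?I (mmul ?J Q P) ?r)"
    by (intro meq_mmul meq_sym[OF QP] meq_refl)
  also have "meq ?I ?I \<dots> (mmul ?J Q (mmul ?J ?s P))"
    unfolding mmul_assoc by (intro meq_mmul tw meq_refl)
  finally have "torus_trace R q = (\<Sum>i\<in>?I. mmul ?J Q (mmul ?J ?s P) i i)"
    unfolding torus_trace_def by (rule tr)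
  also have "\<dots> = (\<Sum>j\<in>?J. mmul ?J ?s (mmul ?I P Q) j j)"
    by (subst sum_mmul_swap) (simp add: mmul_assoc)
  also have "\<dots> = torus_trace S q"
    unfolding torus_trace_def
    by (intro tr meq_trans[OF meq_mmul[OF meq_refl PQ] meq_mone_right]) simp
  finally show ?thesis .
qed

lemma trace_block: "torus_trace (block_rep K F) q = (\<Sum>k<K. torus_trace (F k) q)"
  unfolding torus_trace_def sum_block by simp

lemma trace_tensor: "torus_trace (tensor_rep R S) q = torus_trace R q * torus_trace S q"
  by (auto simp: torus_trace_def sum_product sum.cartesian_product intro!: sum.cong)

lemma trace_sym:
  assumes "star_rep R w d" "q \<noteq> 0"
  shows "torus_trace (sym_rep l R) q = (\<Sum>\<alpha>\<in>monomials l (rep_basis R). \<Prod>i\<in>#\<alpha>. rep_act R (torus q) i i)"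
  unfolding torus_trace_def rep_basis_sym rep_act_sym
  by (intro sum.cong refl) (use assms in \<open>auto simp: sym_mat_diag monomials_def star_repD(2)\<close>)

lemma trace_sym_neg: "l < 0 \<Longrightarrow> torus_trace (sym_rep l R) q = 0"
  by (simp add: torus_trace_def monomials_def)

text \<open>Sorting monomials by whether they contain the new variable \<open>a\<close> gives a
  recurrence that cancels exactly the factor of \<open>a\<close>.\<close>

lemma complete_homogeneous_fps:
  fixes c :: "'i \<Rightarrow> complex"
  assumes "finite I"
  shows "Abs_fps (\<lambda>l. \<Sum>\<alpha>\<in>monomials (int l) I. \<Prod>i\<in>#\<alpha>. c i) * (\<Prod>i\<in>I. 1 - fps_const (c i) * fps_X) = 1"
  using assms
proof (induction I)
  case empty
  have "monomials (int l) ({} :: 'i set) = (if l = 0 then {{#}} else {})" for l :: nat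
    by (auto simp: monomials_def)
  then have "(\<Sum>\<alpha>\<in>monomials (int l) {}. \<Prod>i\<in>#\<alpha>. c i) = (if l = 0 then 1 else 0)" for l
    by (simp only:) simp
  then show ?case by (simp add: fps_eq_iff)
next
  case (insert a I)
  define h where "h J l = (\<Sum>\<alpha>\<in>monomials (int l) J. \<Prod>i\<in>#\<alpha>. c i)" for J l
  have fin: "finite (monomials l (insert a I))" for l
    using insert by (intro finite_monomials) simp
  have "h (insert a I) (Suc l) = c a * h (insert a I) l + h I (Suc l)" for l
  proof -
    have "h (insert a I) (Suc l) =
        (\<Sum>\<alpha>\<in>monomials (int l + 1) (insert a I). if a \<in># \<alpha> then \<Prod>i\<in>#\<alpha>. c i else 0) +
        (\<Sum>\<alpha>\<in>monomials (int l + 1) (insert a I). if a \<notin># \<alpha> then \<Prod>i\<in>#\<alpha>. c i else 0)"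
      unfolding h_def sum.distrib[symmetric] by (intro sum.cong) (auto simp: add.commute)
    also have "(\<Sum>\<alpha>\<in>monomials (int l + 1) (insert a I). if a \<in># \<alpha> then \<Prod>i\<in>#\<alpha>. c i else 0) =
        c a * h (insert a I) l"
      using sum_monomials_shift[of "insert a I" a "\<lambda>_ \<alpha>. \<Prod>i\<in>#\<alpha>. c i" "int l"] insert
      by (simp add: h_def sum_distrib_left)
    also have "(\<Sum>\<alpha>\<in>monomials (int l + 1) (insert a I). if a \<notin># \<alpha> then \<Prod>i\<in>#\<alpha>. c i else 0) = h I (Suc l)"
      unfolding h_def using insert
      by (subst sum.inter_filter[OF fin, symmetric], intro sum.cong)
        (auto simp: monomials_def add.commute)
    finally show ?thesis .
  qed
  moreover have "h J 0 = 1" for J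
  proof -
    have "monomials 0 J = {{#}}" by (auto simp: monomials_def)
    then show ?thesis by (simp add: h_def)
  qed
  ultimately have "Abs_fps (h (insert a I)) * (1 - fps_const (c a) * fps_X) = Abs_fps (h I)"
  proof (intro fps_ext, goal_cases)
    case (1 l)
    then show ?case by (cases l) (simp_all add: algebra_simps)
  qed
  then show ?case
    using insert by (simp add: h_def[abs_def] mult.assoc[symmetric])
qed

lemma rep_act_bin_torus:
  assumes "q \<noteq> 0" "j \<le> n"
  shows "rep_act (bin n) (torus q) (bin_mono n j) (bin_mono n j) = sym_weight q n j"
proof -
  have "bin_mono n j \<in> rep_basis (bin n)"
    using bij_bin_mono[of n] assms(2) by (auto simp: bij_betw_def)
  then show ?thesis
    using assms by (simp add: star_repD(2)[OF star_rep_bin] sym_weight_def bin_weight_count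
        of_nat_diff algebra_simps del: rep_act_sym)
qed

text \<open>The sum of the weights telescopes after multiplication by
  \<open>q - inverse q\<close>.\<close>

lemma trace_bin:
  assumes q: "q \<noteq> 0" "q\<^sup>2 \<noteq> 1"
  shows "torus_trace (bin n) q = qint q (int n + 1)"
proof -
  have D: "q - inverse q \<noteq> 0"
    using q by (auto simp: power2_eq_square) (metis right_inverse)
  have tele: "(\<Sum>j<k. sym_weight q n j) * (q - inverse q) = q powi (int n + 1) - q powi (int n + 1 - 2 * int k)" for k
  proof (induction k)
    case (Suc k)
    have "q powi (int n + 1 - 2 * int k) = q powi (int n - 2 * int k) * q"
      and "q powi (int n + 1 - 2 * int (Suc k)) = q powi (int n - 2 * int k) * inverse q"
      using power_int_add[of q "int n - 2 * int k" 1] power_int_add[of q "int n - 2 * int k" "-1"] q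
      by (simp_all add: algebra_simps)
    then show ?case using Suc by (simp add: sym_weight_def algebra_simps)
  qed simp
  have "torus_trace (bin n) q = (\<Sum>j\<le>n. sym_weight q n j)"
    unfolding torus_trace_def rep_basis_sym rep_basis_std sum_bin_basis
    by (intro sum.cong refl) (simp add: rep_act_bin_torus q(1) del: rep_act_sym)
  also have "\<dots> = qint q (int n + 1)"
    using tele[of "Suc n"] D
    by (simp add: qint_def lessThan_Suc_atMost field_simps)
  finally show ?thesis .
qed

text \<open>Both generating functions are inverse to the same product over the weights of
  \<open>bin n\<close>.\<close>

lemma trace_sym_bin:
  assumes q: "q \<noteq> 0"
  shows "torus_trace (sym_rep (int m) (bin n)) q = fps_nth (hsym q n) m"
proof -
  let ?c = "\<lambda>\<beta>. rep_act (bin n) (torus q) \<beta> \<beta>"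
  let ?H = "Abs_fps (\<lambda>l. \<Sum>\<alpha>\<in>monomials (int l) (bin_basis n). \<Prod>i\<in>#\<alpha>. ?c i)"
  have "(\<Prod>\<beta>\<in>bin_basis n. 1 - fps_const (?c \<beta>) * fps_X) =
      (\<Prod>j\<le>n. 1 - fps_const (?c (bin_mono n j)) * fps_X)"
    by (rule prod.reindex_bij_betw[OF bij_bin_mono, symmetric])
  also have "\<dots> = lin_prod (Suc n) (sym_weight q n)"
    unfolding lin_prod_def lessThan_Suc_atMost
    by (intro prod.cong refl) (simp add: rep_act_bin_torus q del: rep_act_sym)
  finally have "?H * lin_prod (Suc n) (sym_weight q n) = hsym q n * lin_prod (Suc n) (sym_weight q n)"
    using complete_homogeneous_fps[where c = ?c and I = "bin_basis n"]
    by (simp only: hsym_mult finite_monomials finite)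
  moreover have "lin_prod (Suc n) (sym_weight q n) \<noteq> 0"
    using hsym_mult[of q n] by auto
  ultimately have "?H = hsym q n"
    by (rule mult_right_cancel[THEN iffD1, rotated])
  then have "fps_nth ?H m = fps_nth (hsym q n) m" by simp
  then show ?thesis
    using trace_sym[OF star_rep_bin q, of "int m" n] by simp
qed

section \<open>Recovering virtual classes from characters\<close>

text \<open>\<open>f\<close> is the character, away from \<open>q = 0\<close> and \<open>q = \<plusminus>1\<close>, of the element \<open>x\<close> of the subgroup
  spanned by the classes of the \<open>bin n\<close>.\<close>

definition has_char :: "rep_ring \<Rightarrow> (complex \<Rightarrow> complex) \<Rightarrow> bool" where
  "has_char x f \<longleftrightarrow> (\<exists>N a. \<forall>M\<ge>N. x = (\<Sum>n\<le>M. of_int (a n) * rep_cls (bin n)) \<and>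
     (\<forall>q. q \<noteq> 0 \<longrightarrow> q\<^sup>2 \<noteq> 1 \<longrightarrow> f q = (\<Sum>n\<le>M. of_int (a n) * qint q (int n + 1))))"

lemma has_char_0: "has_char 0 (\<lambda>_. 0)"
  unfolding has_char_def by (intro exI[of _ 0] exI[of _ "\<lambda>_. 0"]) simp

lemma has_char_bin: "has_char (rep_cls (bin n)) (\<lambda>q. qint q (int n + 1))"
  unfolding has_char_def
  by (intro exI[of _ n] exI[of _ "\<lambda>k. if k = n then 1 else 0"])
    (simp add: if_distrib[of of_int] if_distrib[of "\<lambda>x. x * _"] cong: if_cong)

text \<open>Because \<open>has_char\<close> demands the expansion for every large upper bound
  \<open>M\<close>, two expansions can be added over a common range.\<close>

lemma has_char_add:
  assumes "has_char x f" "has_char y g"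
  shows "has_char (x + y) (\<lambda>q. f q + g q)"
proof -
  obtain N a where a: "\<And>M. M \<ge> N \<Longrightarrow> x = (\<Sum>n\<le>M. of_int (a n) * rep_cls (bin n)) \<and>
     (\<forall>q. q \<noteq> 0 \<longrightarrow> q\<^sup>2 \<noteq> 1 \<longrightarrow> f q = (\<Sum>n\<le>M. of_int (a n) * qint q (int n + 1)))"
    using assms(1) unfolding has_char_def by blast
  obtain N' b where b: "\<And>M. M \<ge> N' \<Longrightarrow> y = (\<Sum>n\<le>M. of_int (b n) * rep_cls (bin n)) \<and>
     (\<forall>q. q \<noteq> 0 \<longrightarrow> q\<^sup>2 \<noteq> 1 \<longrightarrow> g q = (\<Sum>n\<le>M. of_int (b n) * qint q (int n + 1)))"
    using assms(2) unfolding has_char_def by blast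
  have *: "x + y = (\<Sum>n\<le>M. of_int (a n + b n) * rep_cls (bin n)) \<and>
     (\<forall>q. q \<noteq> 0 \<longrightarrow> q\<^sup>2 \<noteq> 1 \<longrightarrow> f q + g q = (\<Sum>n\<le>M. of_int (a n + b n) * qint q (int n + 1)))"
    if "M \<ge> max N N'" for M
    using a[of M] b[of M] that by (simp add: distrib_right sum.distrib)
  show ?thesis
    unfolding has_char_def
    by (rule exI[of _ "max N N'"], rule exI[of _ "\<lambda>n. a n + b n"], intro allI impI) (rule *)
qed

lemma has_char_minus:
  assumes "has_char x f"
  shows "has_char (- x) (\<lambda>q. - f q)"
proof -
  obtain N a where a: "\<And>M. M \<ge> N \<Longrightarrow> x = (\<Sum>n\<le>M. of_int (a n) * rep_cls (bin n)) \<and>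
     (\<forall>q. q \<noteq> 0 \<longrightarrow> q\<^sup>2 \<noteq> 1 \<longrightarrow> f q = (\<Sum>n\<le>M. of_int (a n) * qint q (int n + 1)))"
    using assms unfolding has_char_def by blast
  have *: "- x = (\<Sum>n\<le>M. of_int (- a n) * rep_cls (bin n)) \<and>
     (\<forall>q. q \<noteq> 0 \<longrightarrow> q\<^sup>2 \<noteq> 1 \<longrightarrow> - f q = (\<Sum>n\<le>M. of_int (- a n) * qint q (int n + 1)))"
    if "M \<ge> N" for M
    using a[OF that] by (simp add: sum_negf)
  show ?thesis
    unfolding has_char_def
    by (rule exI[of _ N], rule exI[of _ "\<lambda>n. - a n"], intro allI impI) (rule *)
qed

lemma has_char_sign: "has_char x f \<Longrightarrow> has_char ((-1) ^ m * x) (\<lambda>q. (-1) ^ m * f q)"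
  by (cases "even m") (simp_all add: has_char_minus)

lemma has_char_sum:
  "(\<And>i. i \<in> I \<Longrightarrow> has_char (x i) (f i)) \<Longrightarrow> has_char (\<Sum>i\<in>I. x i) (\<lambda>q. \<Sum>i\<in>I. f i q)"
  by (induction I rule: infinite_finite_induct) (simp_all add: has_char_0 has_char_add)

lemma has_char_cong:
  "has_char x f \<Longrightarrow> (\<And>q. q \<noteq> 0 \<Longrightarrow> q\<^sup>2 \<noteq> 1 \<Longrightarrow> f q = g q) \<Longrightarrow> has_char x g"
  unfolding has_char_def by simp

lemma has_char_rep_cls:
  assumes "star_rep R w d"
  shows "has_char (rep_cls R) (torus_trace R)"
proof -
  obtain K N where iso: "rep_iso (block_rep K (\<lambda>k. bin (N k))) R"
    by (rule star_rep_decomposition[OF assms])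
  have "has_char (\<Sum>k<K. rep_cls (bin (N k))) (\<lambda>q. \<Sum>k<K. qint q (int (N k) + 1))"
    by (intro has_char_sum has_char_bin)
  then have "has_char (rep_cls R) (\<lambda>q. \<Sum>k<K. qint q (int (N k) + 1))"
    by (simp add: rep_cls_cong[OF iso, symmetric] rep_cls_block)
  then show ?thesis
    by (rule has_char_cong) (simp add: trace_iso[OF iso, symmetric] trace_block trace_bin)
qed

lemma has_char_eq_0:
  assumes "has_char x f" and f: "\<And>q. q \<noteq> 0 \<Longrightarrow> q\<^sup>2 \<noteq> 1 \<Longrightarrow> f q = 0"
  shows "x = 0"
proof -
  obtain N a where x: "x = (\<Sum>n\<le>N. of_int (a n) * rep_cls (bin n))"
    and a: "\<And>q. q \<noteq> 0 \<Longrightarrow> q\<^sup>2 \<noteq> 1 \<Longrightarrow> f q = (\<Sum>n\<le>N. of_int (a n) * qint q (int n + 1))"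
    using assms(1) unfolding has_char_def by blast
  \<comment> \<open>The combination of quantum integers multiplied by \<open>q ^ (N + 1)\<close> and
    \<open>q - inverse q\<close>; the shift keeps all exponents nonnegative.\<close>
  define p :: "complex poly" where
    "p = (\<Sum>n\<le>N. smult (of_int (a n)) (monom 1 (N + n + 2) - monom 1 (N - n)))"
  have "poly p q = 0" if q: "q \<noteq> 0" "q\<^sup>2 \<noteq> 1" for q
  proof -
    have D: "q - inverse q \<noteq> 0"
      using q by (auto simp: power2_eq_square) (metis right_inverse)
    have "poly p q = (\<Sum>n\<le>N. q ^ (N + 1) * (q - inverse q) * (of_int (a n) * qint q (int n + 1)))"
      unfolding p_def poly_sum
    proof (rule sum.cong[OF refl])
      fix n assume "n \<in> {..N}"
      then have e: "q ^ (N + 1) = q ^ (N - n) * q ^ (n + 1)" "q ^ (N + n + 2) = q ^ (N - n) * (q ^ (n + 1) * q ^ (n + 1))"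
        by (simp_all flip: power_add)
      have "(q - inverse q) * qint q (int n + 1) = q ^ (n + 1) - inverse (q ^ (n + 1))"
        using power_int_of_nat[of q "n + 1"] power_int_minus[of q "int n + 1"] D
        by (simp add: qint_def add.commute)
      moreover have "q ^ (n + 1) * (q ^ (n + 1) - inverse (q ^ (n + 1))) = q ^ (n + 1) * q ^ (n + 1) - 1"
        by (simp only: right_diff_distrib right_inverse[OF power_not_zero[OF q(1)]])
      ultimately have "q ^ (N + 1) * ((q - inverse q) * qint q (int n + 1)) = q ^ (N + n + 2) - q ^ (N - n)"
        unfolding e by (simp only: mult.assoc) (simp only: right_diff_distrib mult_1_right)
      then show "poly (smult (of_int (a n)) (monom 1 (N + n + 2) - monom 1 (N - n))) q =
          q ^ (N + 1) * (q - inverse q) * (of_int (a n) * qint q (int n + 1))"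
        by (simp add: poly_monom mult_ac)
    qed
    then show ?thesis
      using f[OF q] a[OF q] by (simp add: sum_distrib_left[symmetric])
  qed
  then have "UNIV \<subseteq> {q. poly p q = 0} \<union> {0, 1, -1}"
    by (auto simp: power2_eq_1_iff)
  then have "infinite {q. poly p q = 0}"
    using infinite_UNIV_char_0[where 'a = complex] by (metis finite.emptyI finite_UnI finite_insert finite_subset)
  then have "p = 0" using poly_roots_finite by blast
  have "a m = 0" if "m \<le> N" for m
  proof -
    \<comment> \<open>The negative monomials have degree at most \<open>N\<close>, so only the
      leading monomial for \<open>n = m\<close> contributes here.\<close>
    have "coeff p (N + m + 2) = (\<Sum>n\<le>N. if n = m then of_int (a n) else 0)"
      unfolding p_def coeff_sum by (rule sum.cong) auto
    then show ?thesis using \<open>p = 0\<close> that by simp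
  qed
  then show ?thesis unfolding x by simp
qed

theorem mainTheorem5:
  fixes d t :: nat
  assumes "d \<ge> 2" and "t \<ge> 2"
  shows "rep_cls (sym_rep (int t) (sym_rep (int d) std_rep)) =
    rep_cls (sym_rep (int (t * d)) std_rep) +
    (\<Sum>m = 2..d. (-1) ^ m *
       rep_cls (sym_rep (int m - 2) std_rep) *
       rep_cls (sym_rep (int m) (sym_rep (int d - int m) std_rep)) *
       rep_cls (sym_rep (int t - int m) (sym_rep (int d) std_rep)))"
proof -
  let ?T = "\<lambda>m. tensor_rep (tensor_rep (sym_rep (int m - 2) std_rep)
      (sym_rep (int m) (sym_rep (int d - int m) std_rep)))
      (sym_rep (int t - int m) (sym_rep (int d) std_rep))"
  \<comment> \<open>The difference of the two sides, written with \<open>+\<close> and unary minus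
    so that the closure rules of \<open>has_char\<close> apply.\<close>
  let ?x = "rep_cls (sym_rep (int t) (bin d)) + - (rep_cls (bin (t * d)) +
    (\<Sum>m = 2..d. (-1) ^ m * rep_cls (?T m)))"
  let ?f = "\<lambda>q. torus_trace (sym_rep (int t) (bin d)) q + - (torus_trace (bin (t * d)) q +
    (\<Sum>m = 2..d. (-1) ^ m * torus_trace (?T m) q))"
  have "has_char ?x ?f"
    by (intro has_char_add has_char_minus has_char_sum has_char_sign
        has_char_rep_cls[OF star_rep_sym[OF star_rep_bin]] has_char_rep_cls[OF star_rep_bin]
        has_char_rep_cls[OF star_rep_tensor[OF star_rep_tensor[OF star_rep_sym[OF star_rep_std]
          star_rep_sym[OF star_rep_sym[OF star_rep_std]]] star_rep_sym[OF star_rep_bin]]])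
  moreover have "?f q = 0" if q: "q \<noteq> 0" "q\<^sup>2 \<noteq> 1" for q
  proof -
    have "torus_trace (?T m) q = qint q (int m - 1) * fps_nth (hsym q (d - m)) m *
       (if m \<le> t then fps_nth (hsym q d) (t - m) else 0)" if "m \<in> {2..d}" for m
    proof -
      \<comment> \<open>In the range \<open>2 <= m <= d\<close> these differences are natural
        numbers, so the inner powers are binary forms. Only \<open>t - m\<close> can be negative,
        where the symmetric power is zero.\<close>
      have "int m - 2 = int (m - 2)" "int d - int m = int (d - m)" using that by auto
      moreover have "torus_trace (sym_rep (int t - int m) (bin d)) q =
          (if m \<le> t then fps_nth (hsym q d) (t - m) else 0)"
      proof (cases "m \<le> t")
        case True
        then have "int t - int m = int (t - m)" by simp
        then show ?thesis using True by (simp only: trace_sym_bin[OF q(1)] if_True)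
      qed (simp add: trace_sym_neg)
      moreover have "torus_trace (bin (m - 2)) q = qint q (int m - 1)"
      proof -
        have "int (m - 2) + 1 = int m - 1" using that by auto
        then show ?thesis by (simp only: trace_bin[OF q])
      qed
      ultimately show ?thesis by (simp only: trace_tensor trace_sym_bin[OF q(1)])
    qed
    then show ?thesis
      using hsym_plethysm[OF q assms(1), of t] q
      by (simp add: trace_sym_bin trace_bin mult.assoc del: of_nat_mult)
  qed
  ultimately have "?x = 0" by (rule has_char_eq_0)
  then have "rep_cls (sym_rep (int t) (bin d)) =
      rep_cls (bin (t * d)) + (\<Sum>m = 2..d. (-1) ^ m * rep_cls (?T m))"
    unfolding add_uminus_conv_diff right_minus_eq .
  then show ?thesis
    by (simp only: rep_cls_tensor mult.assoc)
qed

end
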